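(* Let $K$ be a commutative ring and $\delta\in K$, and let $\mathcal{AB}(\delta)$ and $\mathcal B(\delta)$ be as in the context. Then: (1) For objects $r,s$, the $K$-span of the morphisms $\mathbb I_0\otimes A$, with $A$ ranging over Brauer $(r,s)$-diagrams (the polar diagrams with no connectors), gives a subcategory $\mathcal{AB}_0(\delta)$ of $\mathcal{AB}(\delta)$ with objects $\mathbb N$, and $A\mapsto \mathbb I_0\otimes A$ identifies $\mathcal{AB}_0(\delta)$ with $\mathcal B(\delta)$ (the two categories are isomorphic). (2) There is a bifunctor $\otimes:\mathcal{AB}(\delta)\times\mathcal B(\delta)\to\mathcal{AB}(\delta)$ with $r\otimes r_0=r+r_0$ on objects and, on morphisms, $\mathbb A\otimes B$ given by juxtaposing the Brauer morphism $B$ to the right of $\mathbb A$; thus $\mathcal{AB}(\delta)$ is a right module category over the monoidal category $\mathcal B(\delta)$. (3) There is a functor $\varpi:\mathcal{AB}(\delta)\to\mathcal B(\delta)$ with $\varpi(r)=r+1$ on objects, $\varpi(\mathbb I_0)=I$, $\varpi(\mathbb H)=H$, and $\varpi(\mathbb D\otimes B)=\varpi(\mathbb D)\otimes B$ for all morphisms $\mathbb D$ of $\mathcal{AB}(\delta)$ and $B$ of $\mathcal B(\delta)$ (i.e. $\otimes\circ(\varpi\times\mathrm{id})=\varpi\circ\otimes$).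
   Context: Let $K$ be a commutative ring and $\delta\in K$. The Brauer category $\mathcal B(\delta)$ has objects $\mathbb N=\{0,1,2,\dots\}$; $\mathrm{Hom}_{\mathcal B(\delta)}(r,s)$ is the free $K$-module on Brauer $(r,s)$-diagrams (pairings of $r$ bottom and $s$ top vertices by strings); composition $BA$ (first $A$, then $B$) is vertical stacking, each closed loop being deleted and replaced by a factor $\delta$; $\otimes$ is horizontal juxtaposition. Write $I$ for the identity of $1$, $I_r=I^{\otimes r}$, $X\in\mathrm{Hom}(2,2)$ for the crossing, $\cap\in\mathrm{Hom}(2,0)$ the cap, $\cup\in\mathrm{Hom}(0,2)$ the cup, and $H=X-\cup\circ\cap\in\mathrm{Hom}(2,2)$. The polar Brauer category $\mathcal{AB}(\delta)$ is the $K$-linear category with objects $\mathbb N$ whose morphisms are linear combinations of polar diagrams (a thick vertical pole at the left, Brauer diagrams $D_1,\dots,D_k$ stacked to its right, and between $D_i$ and $D_{i+1}$ a horizontal connector joining the pole to the leftmost thin strand; such a diagram with $D_1:r_0\to r_1$ at the bottom and $D_k:r_{k-1}\to r_k$ on top is a morphism $r_0\to r_k$), modulo relations. Algebraically, $\mathcal{AB}(\delta)$ is generated under composition and under the right action $\mathbb D\mapsto\mathbb D\otimes B$ by morphisms $B$ of $\mathcal B(\delta)$ (juxtaposition of $B$ on the right; $\mathbb D:r\to s$, $B:k\to\ell$ give $\mathbb D\otimes B:r+k\to s+\ell$) by $\mathbb I_0$ (the bare pole, identity of $0$) and $\mathbb H:1\to1$ (pole with one connector to one thin strand), subject to: (i)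 $(\mathbb I_0\otimes B)(\mathbb I_0\otimes A)=\mathbb I_0\otimes BA$ and $(\mathbb H\otimes B)(\mathbb I_1\otimes A)=(\mathbb I_1\otimes B)(\mathbb H\otimes A)=\mathbb H\otimes BA$, where $\mathbb I_r=\mathbb I_0\otimes I_r$; (ii) the four-term relation $[\mathbb H_{01},\mathbb H_{02}+\mathbb H_{12}]=0$ where $[a,b]=ab-ba$, $\mathbb H_{01}=\mathbb H\otimes I$, $\mathbb X_0=\mathbb I_0\otimes X$, $\mathbb H_{02}=\mathbb X_0\mathbb H_{01}\mathbb X_0$, $\mathbb H_{12}=\mathbb I_0\otimes H$; (iii) skew symmetry $\mathbb H^T=-\mathbb H$, where for $\mathbb D:1\to1$, $\mathbb D^T=(\mathbb I_0\otimes\cap\otimes I)(\mathbb D\otimes X)(\mathbb I_0\otimes\cup\otimes I)$. The relations are imposed inside arbitrary composites and right tensor products (quotient by the smallest submodule containing them and stable under composition on both sides and under $-\otimes B$). Products of morphisms denote composition. *)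

theory Defs
  imports Main
begin

text \<open>Vertices of a Brauer (r,s)-diagram: Inl i is the i-th bottom vertex (i < r, counted
from the left), Inr j is the j-th top vertex (j < s).  A diagram is encoded as the
fixed-point-free involution on the vertex set pairing each vertex with the other end of its
string; it is the identity outside the vertex set (so the encoding is unique).\<close>

type_synonym bv = "nat + nat"
type_synonym bdiag = "bv \<Rightarrow> bv"

definition bverts :: "nat \<Rightarrow> nat \<Rightarrow> bv set" where
  "bverts r s = Inl ` {..<r} \<union> Inr ` {..<s}"

definition is_bdiag :: "nat \<Rightarrow> nat \<Rightarrow> bdiag \<Rightarrow> bool" where
  "is_bdiag r s d \<longleftrightarrow>
     (\<forall>v\<in>bverts r s. d v \<in> bverts r s \<and> d v \<noteq> v \<and> d (d v) = v) \<and>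
     (\<forall>v. v \<notin> bverts r s \<longrightarrow> d v = v)"

definition dswap :: "bv \<Rightarrow> bv \<Rightarrow> bdiag" where
  "dswap a b = (\<lambda>v. if v = a then b else if v = b then a else v)"

definition did :: "nat \<Rightarrow> bdiag" where
  "did n = (\<lambda>v. case v of Inl i \<Rightarrow> if i < n then Inr i else v
                        | Inr j \<Rightarrow> if j < n then Inl j else v)"

definition dX :: bdiag where "dX = dswap (Inl 0) (Inr 1) \<circ> dswap (Inl 1) (Inr 0)"
definition dcap :: bdiag where "dcap = dswap (Inl 0) (Inl 1)"
definition dcup :: bdiag where "dcup = dswap (Inr 0) (Inr 1)"

text \<open>Vertical stacking of a:(r,s) (bottom) and b:(s,t) (top).  The stacked picture has
vertices (0,i) (bottom of a), (1,j) (middle row), (2,k) (top of b).\<close>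

definition lowA :: "bv \<Rightarrow> nat \<times> nat" where
  "lowA v = (case v of Inl i \<Rightarrow> (0, i) | Inr j \<Rightarrow> (1, j))"
definition upB :: "bv \<Rightarrow> nat \<times> nat" where
  "upB v = (case v of Inl j \<Rightarrow> (1, j) | Inr k \<Rightarrow> (2, k))"
definition outer :: "bv \<Rightarrow> nat \<times> nat" where
  "outer v = (case v of Inl i \<Rightarrow> (0, i) | Inr k \<Rightarrow> (2, k))"

definition stack_edges :: "nat \<Rightarrow> nat \<Rightarrow> nat \<Rightarrow> bdiag \<Rightarrow> bdiag \<Rightarrow> ((nat \<times> nat) \<times> (nat \<times> nat)) set" where
  "stack_edges r s t b a =
     {(lowA v, lowA (a v)) | v. v \<in> bverts r s} \<union> {(upB v, upB (b v)) | v. v \<in> bverts s t}"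

definition stack_conn :: "nat \<Rightarrow> nat \<Rightarrow> nat \<Rightarrow> bdiag \<Rightarrow> bdiag \<Rightarrow> ((nat \<times> nat) \<times> (nat \<times> nat)) set" where
  "stack_conn r s t b a = (stack_edges r s t b a)\<^sup>*"

definition dcomp :: "nat \<Rightarrow> nat \<Rightarrow> nat \<Rightarrow> bdiag \<Rightarrow> bdiag \<Rightarrow> bdiag" where
  "dcomp r s t b a = (\<lambda>v. if v \<in> bverts r t
      then (THE w. w \<in> bverts r t \<and> w \<noteq> v \<and> (outer v, outer w) \<in> stack_conn r s t b a)
      else v)"

definition loops :: "nat \<Rightarrow> nat \<Rightarrow> nat \<Rightarrow> bdiag \<Rightarrow> bdiag \<Rightarrow> nat" where
  "loops r s t b a = card {stack_conn r s t b a `` {(1, j)} | j. j < s \<and>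
                             stack_conn r s t b a `` {(1, j)} \<subseteq> {1} \<times> {..<s}}"

definition shiftv :: "nat \<Rightarrow> nat \<Rightarrow> bv \<Rightarrow> bv" where
  "shiftv r s v = (case v of Inl i \<Rightarrow> Inl (i + r) | Inr j \<Rightarrow> Inr (j + s))"

definition dtens :: "nat \<Rightarrow> nat \<Rightarrow> nat \<Rightarrow> nat \<Rightarrow> bdiag \<Rightarrow> bdiag \<Rightarrow> bdiag" where
  "dtens r s k l a b = (\<lambda>v. case v of
      Inl i \<Rightarrow> if i < r then a v else if i < r + k then shiftv r s (b (Inl (i - r))) else v
    | Inr j \<Rightarrow> if j < s then a v else if j < s + l then shiftv r s (b (Inr (j - s))) else v)"

text \<open>A morphism r \<rightarrow> s of B(delta): a K-linear combination of (r,s)-diagrams, i.e. a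
coefficient function supported on (r,s)-diagrams (a finite set).\<close>

definition bmor :: "nat \<Rightarrow> nat \<Rightarrow> (bdiag \<Rightarrow> 'k::comm_ring_1) \<Rightarrow> bool" where
  "bmor r s f \<longleftrightarrow> (\<forall>d. f d \<noteq> 0 \<longrightarrow> is_bdiag r s d)"

definition bsing :: "bdiag \<Rightarrow> bdiag \<Rightarrow> 'k::comm_ring_1" where
  "bsing d = (\<lambda>e. if e = d then 1 else 0)"

definition bcomp :: "'k::comm_ring_1 \<Rightarrow> nat \<Rightarrow> nat \<Rightarrow> nat \<Rightarrow> (bdiag \<Rightarrow> 'k) \<Rightarrow> (bdiag \<Rightarrow> 'k) \<Rightarrow> bdiag \<Rightarrow> 'k" where
  "bcomp \<delta> r s t g f = (\<lambda>d. \<Sum>(a, b)\<in>{(a, b). is_bdiag r s a \<and> is_bdiag s t b \<and> dcomp r s t b a = d}.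
                              f a * g b * \<delta> ^ loops r s t b a)"

definition btens :: "nat \<Rightarrow> nat \<Rightarrow> nat \<Rightarrow> nat \<Rightarrow> (bdiag \<Rightarrow> 'k::comm_ring_1) \<Rightarrow> (bdiag \<Rightarrow> 'k) \<Rightarrow> bdiag \<Rightarrow> 'k" where
  "btens r s k l f g = (\<lambda>d. \<Sum>(a, b)\<in>{(a, b). is_bdiag r s a \<and> is_bdiag k l b \<and> dtens r s k l a b = d}.
                              f a * g b)"

definition bid :: "nat \<Rightarrow> bdiag \<Rightarrow> 'k::comm_ring_1" where "bid n = bsing (did n)"
definition bI :: "bdiag \<Rightarrow> 'k::comm_ring_1" where "bI = bid 1"
definition bX :: "bdiag \<Rightarrow> 'k::comm_ring_1" where "bX = bsing dX"
definition bcap :: "bdiag \<Rightarrow> 'k::comm_ring_1" where "bcap = bsing dcap"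
definition bcup :: "bdiag \<Rightarrow> 'k::comm_ring_1" where "bcup = bsing dcup"

definition bH :: "'k::comm_ring_1 \<Rightarrow> bdiag \<Rightarrow> 'k" where
  "bH \<delta> = (\<lambda>d. bX d - bcomp \<delta> 2 0 2 bcup bcap d)"

text \<open>A polar diagram r_0 \<rightarrow> r_k is a nonempty list [(r_0,r_1,D_1), ..., (r_(k-1),r_k,D_k)]
(bottom first) of Brauer diagrams D_i : r_(i-1) \<rightarrow> r_i; between D_i and D_(i+1) there is a
connector from the pole to the leftmost thin strand, so each interior level r_i has r_i \<ge> 1.\<close>

type_synonym pdiag = "(nat \<times> nat \<times> bdiag) list"

definition is_pdiag :: "nat \<Rightarrow> nat \<Rightarrow> pdiag \<Rightarrow> bool" where
  "is_pdiag r s P \<longleftrightarrow> P \<noteq> [] \<and> fst (hd P) = r \<and> fst (snd (last P)) = s \<and>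
     (\<forall>i<length P. is_bdiag (fst (P ! i)) (fst (snd (P ! i))) (snd (snd (P ! i)))) \<and>
     (\<forall>i. Suc i < length P \<longrightarrow> fst (snd (P ! i)) = fst (P ! Suc i) \<and> 1 \<le> fst (snd (P ! i)))"

definition fmor :: "nat \<Rightarrow> nat \<Rightarrow> (pdiag \<Rightarrow> 'k::comm_ring_1) \<Rightarrow> bool" where
  "fmor r s x \<longleftrightarrow> finite {P. x P \<noteq> 0} \<and> (\<forall>P. x P \<noteq> 0 \<longrightarrow> is_pdiag r s P)"

definition psing :: "pdiag \<Rightarrow> pdiag \<Rightarrow> 'k::comm_ring_1" where
  "psing P = (\<lambda>Q. if Q = P then 1 else 0)"

text \<open>Stacking Q on top of P: the top Brauer diagram of P and the bottom one of Q are composed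
(no connector between them), closed loops being replaced by delta.\<close>
definition pcomp :: "pdiag \<Rightarrow> pdiag \<Rightarrow> pdiag" where
  "pcomp Q P = butlast P @
     [(fst (last P), fst (snd (hd Q)),
       dcomp (fst (last P)) (fst (snd (last P))) (fst (snd (hd Q))) (snd (snd (hd Q))) (snd (snd (last P))))]
     @ tl Q"

definition ploops :: "pdiag \<Rightarrow> pdiag \<Rightarrow> nat" where
  "ploops Q P = loops (fst (last P)) (fst (snd (last P))) (fst (snd (hd Q))) (snd (snd (hd Q))) (snd (snd (last P)))"

definition pcompose :: "'k::comm_ring_1 \<Rightarrow> (pdiag \<Rightarrow> 'k) \<Rightarrow> (pdiag \<Rightarrow> 'k) \<Rightarrow> pdiag \<Rightarrow> 'k" where
  "pcompose \<delta> y x = (\<lambda>R. \<Sum>(P, Q)\<in>{(P, Q). x P \<noteq> 0 \<and> y Q \<noteq> 0 \<and> pcomp Q P = R}.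
                          x P * y Q * \<delta> ^ ploops Q P)"

text \<open>Juxtaposing a Brauer diagram B : k \<rightarrow> l to the right of a polar diagram; by convention
B is placed into the bottom level, the other levels get I_l (relation (i) makes the choice
of level irrelevant in the quotient).\<close>
definition ptens :: "nat \<Rightarrow> nat \<Rightarrow> bdiag \<Rightarrow> pdiag \<Rightarrow> pdiag" where
  "ptens k l B P = (case P of [] \<Rightarrow> []
     | (a, b, D) # rest \<Rightarrow> (a + k, b + l, dtens a b k l D B) #
                          map (\<lambda>(a, b, D). (a + l, b + l, dtens a b l l D (did l))) rest)"

definition ftens :: "nat \<Rightarrow> nat \<Rightarrow> (pdiag \<Rightarrow> 'k::comm_ring_1) \<Rightarrow> (bdiag \<Rightarrow> 'k) \<Rightarrow> pdiag \<Rightarrow> 'k" where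
  "ftens k l x g = (\<lambda>R. \<Sum>(P, B)\<in>{(P, B). x P \<noteq> 0 \<and> is_bdiag k l B \<and> g B \<noteq> 0 \<and> ptens k l B P = R}.
                          x P * g B)"

definition pI0 :: "pdiag \<Rightarrow> 'k::comm_ring_1" where "pI0 = psing [(0, 0, did 0)]"
definition pH :: "pdiag \<Rightarrow> 'k::comm_ring_1" where "pH = psing [(1, 1, did 1), (1, 1, did 1)]"

definition pid :: "nat \<Rightarrow> pdiag \<Rightarrow> 'k::comm_ring_1" where "pid r = ftens r r pI0 (bid r)"

definition padd :: "(pdiag \<Rightarrow> 'k::comm_ring_1) \<Rightarrow> (pdiag \<Rightarrow> 'k) \<Rightarrow> pdiag \<Rightarrow> 'k" where
  "padd x y = (\<lambda>P. x P + y P)"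
definition pdiff :: "(pdiag \<Rightarrow> 'k::comm_ring_1) \<Rightarrow> (pdiag \<Rightarrow> 'k) \<Rightarrow> pdiag \<Rightarrow> 'k" where
  "pdiff x y = (\<lambda>P. x P - y P)"

definition pH01 :: "pdiag \<Rightarrow> 'k::comm_ring_1" where "pH01 = ftens 1 1 pH bI"
definition pX0 :: "pdiag \<Rightarrow> 'k::comm_ring_1" where "pX0 = ftens 2 2 pI0 bX"
definition pH02 :: "'k::comm_ring_1 \<Rightarrow> pdiag \<Rightarrow> 'k" where
  "pH02 \<delta> = pcompose \<delta> pX0 (pcompose \<delta> pH01 pX0)"
definition pH12 :: "'k::comm_ring_1 \<Rightarrow> pdiag \<Rightarrow> 'k" where
  "pH12 \<delta> = ftens 2 2 pI0 (bH \<delta>)"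

definition ptransp :: "'k::comm_ring_1 \<Rightarrow> (pdiag \<Rightarrow> 'k) \<Rightarrow> pdiag \<Rightarrow> 'k" where
  "ptransp \<delta> D = pcompose \<delta> (ftens 3 1 pI0 (btens 2 0 1 1 bcap bI))
                        (pcompose \<delta> (ftens 2 2 D bX) (ftens 1 3 pI0 (btens 0 2 1 1 bcup bI)))"

inductive relAB :: "'k::comm_ring_1 \<Rightarrow> nat \<Rightarrow> nat \<Rightarrow> (pdiag \<Rightarrow> 'k) \<Rightarrow> bool" for \<delta> :: "'k" where
  rel_i1: "bmor k1 k2 A \<Longrightarrow> bmor k2 k3 B \<Longrightarrow>
     relAB \<delta> k1 k3 (pdiff (pcompose \<delta> (ftens k2 k3 pI0 B) (ftens k1 k2 pI0 A))
                          (ftens k1 k3 pI0 (bcomp \<delta> k1 k2 k3 B A)))"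
| rel_i2: "bmor k1 k2 A \<Longrightarrow> bmor k2 k3 B \<Longrightarrow>
     relAB \<delta> (1 + k1) (1 + k3) (pdiff (pcompose \<delta> (ftens k2 k3 pH B) (ftens k1 k2 (ftens 1 1 pI0 bI) A))
                                     (ftens k1 k3 pH (bcomp \<delta> k1 k2 k3 B A)))"
| rel_i3: "bmor k1 k2 A \<Longrightarrow> bmor k2 k3 B \<Longrightarrow>
     relAB \<delta> (1 + k1) (1 + k3) (pdiff (pcompose \<delta> (ftens k2 k3 (ftens 1 1 pI0 bI) B) (ftens k1 k2 pH A))
                                     (ftens k1 k3 pH (bcomp \<delta> k1 k2 k3 B A)))"
| rel_4T: "relAB \<delta> 2 2 (pdiff (pcompose \<delta> pH01 (padd (pH02 \<delta>) (pH12 \<delta>)))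
                              (pcompose \<delta> (padd (pH02 \<delta>) (pH12 \<delta>)) pH01))"
| rel_skew: "relAB \<delta> 1 1 (padd (ptransp \<delta> pH) pH)"
| rel_zero: "relAB \<delta> r s (\<lambda>_. 0)"
| rel_add: "relAB \<delta> r s x \<Longrightarrow> relAB \<delta> r s y \<Longrightarrow> relAB \<delta> r s (padd x y)"
| rel_smult: "relAB \<delta> r s x \<Longrightarrow> relAB \<delta> r s (\<lambda>P. c * x P)"
| rel_compL: "relAB \<delta> r s x \<Longrightarrow> fmor s t y \<Longrightarrow> relAB \<delta> r t (pcompose \<delta> y x)"
| rel_compR: "relAB \<delta> r s x \<Longrightarrow> fmor q r y \<Longrightarrow> relAB \<delta> q s (pcompose \<delta> x y)"
| rel_tens: "relAB \<delta> r s x \<Longrightarrow> bmor k l B \<Longrightarrow> relAB \<delta> (r + k) (s + l) (ftens k l x B)"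

text \<open>Equality of morphisms r \<rightarrow> s in AB(delta) = free module modulo relAB.\<close>
definition abeq :: "'k::comm_ring_1 \<Rightarrow> nat \<Rightarrow> nat \<Rightarrow> (pdiag \<Rightarrow> 'k) \<Rightarrow> (pdiag \<Rightarrow> 'k) \<Rightarrow> bool" where
  "abeq \<delta> r s x y \<longleftrightarrow> relAB \<delta> r s (pdiff x y)"

end

theory Submission
  imports Defs
begin

text \<open>Label the vertices of a diagram by two colours. Call a labelling admissible if it is constant
on strings. An admissible labelling of the outer vertices of a stacked picture extends to the
middle row in \<open>2 ^ loops\<close> ways, and a diagram is determined by its admissible labellings. Hence
every identity between diagrams with its count of closed loops (associativity, interchange of
composition and juxtaposition) follows from a rearrangement of finite sums over labellings of
middle rows.

The functor \<open>varpi\<close> replaces the pole by a strand and every connector by \<open>H\<close>; it kills the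
relations because the four-term relation and skew symmetry hold for \<open>H\<close> in the Brauer category.
It sends \<open>I_0 \<otimes> A\<close> to \<open>I \<otimes> A\<close>, so the map \<open>A \<mapsto> I_0 \<otimes> A\<close> is injective. The interchange law for
polar diagrams holds since relation (i) moves a Brauer diagram on the added strands past a
connector.\<close>

text \<open>\<open>dcomp\<close> and \<open>loops\<close> are defined through a transitive closure
  and a \<open>THE\<close>, so a direct proof of associativity would have to follow paths and loops
  through three stacked diagrams. With labellings, paths are followed only once, for a single stack
  (\<open>alternating_path\<close>); afterwards both data sit in one number,
  \<open>2 ^ loops\<close> times an indicator. Two colours suffice because a power of
  \<open>2\<close> in the naturals determines its exponent. The count cannot be made in the
  coefficient ring, where \<open>2\<close> may vanish, and since \<delta> is arbitrary the numbers
  of loops have to agree exactly.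

  By convention a Brauer diagram juxtaposed to a polar diagram goes into the lowest level. Units,
  associativity and compatibility with \<open>varpi\<close> are then strict equalities of formal
  combinations. Stacking two such diagrams, however, leaves the Brauer diagram of the upper one
  above the connectors of the lower one. This is why the interchange law holds only modulo the
  relations, and why it takes most of the work on the action.\<close>

section \<open>Alternating walks of two involutions\<close>

lemma even_card_involution:
  assumes "finite C" and "\<And>x. x \<in> C \<Longrightarrow> f x \<in> C" and "\<And>x. x \<in> C \<Longrightarrow> f x \<noteq> x"
    and "\<And>x. x \<in> C \<Longrightarrow> f (f x) = x"
  shows "even (card C)"
  using assms
proof (induction C rule: finite_psubset_induct)
  case (psubset C)
  show ?case
  proof (cases "C = {}")
    case False
    then obtain x where x: "x \<in> C" by blast
    have fx: "f x \<in> C" "f x \<noteq> x" "f (f x) = x" using psubset.prems x by auto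
    have "even (card (C - {x, f x}))"
    proof (rule psubset.IH)
      fix y assume y: "y \<in> C - {x, f x}"
      then have fy: "f (f y) = y" "f y \<in> C" using psubset.prems by auto
      moreover have "f y \<noteq> x" using y fy by auto
      moreover have "f y \<noteq> f x" using y fy fx by (metis DiffD2 insertCI)
      ultimately show "f y \<in> C - {x, f x}" by blast
    qed (use x fx psubset.prems in auto)
    moreover have "card (C - {x, f x}) = card C - 2"
      using x fx psubset.hyps by (simp add: card_Diff_subset)
    moreover have "card {x, f x} \<le> card C"
      using x fx psubset.hyps by (intro card_mono) auto
    ultimately show ?thesis using fx by auto
  qed simp
qed

text \<open>The walk from \<open>v\<close> that applies \<open>A\<close> and \<open>B\<close> alternately sweeps the whole component up to
the first vertex at which it gets stuck, so no third endpoint exists; a second endpoint exists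
by parity.\<close>
lemma alternating_path_aux:
  fixes A B :: "'v \<Rightarrow> 'v"
  assumes A: "\<And>x. A (A x) = x" and B: "\<And>x. B (B x) = x"
    and C: "C = R\<^sup>* `` {v}" and R: "\<And>x y. (x, y) \<in> R \<Longrightarrow> y = A x \<or> y = B x"
    and fin: "finite C" and AC: "\<And>x. x \<in> C \<Longrightarrow> A x \<in> C" and BC: "\<And>x. x \<in> C \<Longrightarrow> B x \<in> C"
    and nofix: "\<And>x. x \<in> C \<Longrightarrow> \<not> (A x = x \<and> B x = x)"
    and v: "B v = v"
  shows "\<exists>!w. w \<in> C \<and> w \<noteq> v \<and> (A w = w \<or> B w = w)"
proof -
  \<comment> \<open>Since \<open>B\<close> fixes \<open>v\<close>, the walk has to leave
    \<open>v\<close> by \<open>A\<close>.\<close>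
  define p where "p = rec_nat v (\<lambda>n x. if even n then A x else B x)"
  have p0: "p 0 = v" and pS: "\<And>n. p (Suc n) = (if even n then A (p n) else B (p n))"
    by (simp_all add: p_def)
  have nxt: "p (Suc n) = (if even n then A (p n) else B (p n))"
    and prv: "p n = (if even n then A (p (Suc n)) else B (p (Suc n)))" for n
    by (simp_all add: pS A B)
  have vC: "v \<in> C" using C by blast
  have other: "\<exists>w. w \<in> C \<and> w \<noteq> v \<and> (A w = w \<or> B w = w)"
  proof (rule ccontr)
    assume no: "\<not> ?thesis"
    \<comment> \<open>By \<open>nofix\<close>, \<open>A\<close> moves \<open>v\<close>. Without a
      second endpoint, \<open>A\<close> is therefore fixed-point free on \<open>C\<close>, and
      \<open>B\<close> is so on \<open>C - {v}\<close>, so two consecutive numbers would both be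
      even.\<close>
    have "even (card C)"
      by (rule even_card_involution[of C A]) (use fin AC A no nofix v vC in \<open>auto\<close>)
    moreover have "even (card (C - {v}))"
    proof (rule even_card_involution[of _ B])
      show "B x \<in> C - {v}" if "x \<in> C - {v}" for x
        using that BC B[of x] v by auto
    qed (use fin BC B no in auto)
    ultimately show False using fin vC
      by (metis card_Diff_singleton card_0_eq dvd_diffD1 empty_iff odd_one
          less_one not_less One_nat_def)
  qed
  have closed_all: "R\<^sup>* `` {v} \<subseteq> S"
    if "v \<in> S" "\<And>x. x \<in> S \<Longrightarrow> A x \<in> S \<and> B x \<in> S" for S
  proof
    fix w assume "w \<in> R\<^sup>* `` {v}"
    then have "(v, w) \<in> R\<^sup>*" by simp
    then show "w \<in> S" by induction (use that R in blast)+
  qed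
  \<comment> \<open>One of the two involutions continues the walk and the other undoes its last
    step; at \<open>i = 0\<close> there is no last step, and \<open>B\<close> stays at
    \<open>v\<close>.\<close>
  have step: "A (p i) \<in> {p i, p (Suc i), p (i - 1)} \<and> B (p i) \<in> {p i, p (Suc i), p (i - 1)}" for i
  proof (cases i)
    case 0 then show ?thesis using v p0 pS[of 0] by simp
  next
    case (Suc j)
    then show ?thesis using nxt[of i] prv[of j] by (cases "even j") auto
  qed
  have "C \<subseteq> range p" unfolding C
  proof (rule closed_all)
    show "v \<in> range p" using p0 by (metis rangeI)
    show "A x \<in> range p \<and> B x \<in> range p" if "x \<in> range p" for x
      using that step by blast
  qed
  obtain w where w: "w \<in> C" "w \<noteq> v" "A w = w \<or> B w = w" using other by blast
  obtain i where i: "w = p i" using w(1) \<open>C \<subseteq> range p\<close> by blast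
  \<comment> \<open>If the involution due next fixes \<open>p j\<close>, the walk stalls on leaving
    \<open>p j\<close>; if the other one does, the walk had already stalled on arriving
    there.\<close>
  have endp: "p (Suc j) = p j \<or> (0 < j \<and> p j = p (j - 1)) \<or> j = 0"
    if "A (p j) = p j \<or> B (p j) = p j" for j
  proof (cases j)
    case (Suc k)
    then show ?thesis using that nxt[of j] prv[of k] by (cases "even k") auto
  qed simp
  have ex: "\<exists>n. p (Suc n) = p n"
    using endp[of i] w i p0 by (metis One_nat_def Suc_pred)
  define n where "n = (LEAST n. p (Suc n) = p n)"
  have n: "p (Suc n) = p n" unfolding n_def using LeastI_ex[OF ex] .
  have nmin: "p (Suc j) \<noteq> p j" if "j < n" for j
    using not_less_Least that unfolding n_def by blast
  have sub: "C \<subseteq> p ` {..n}" unfolding C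
  proof (rule closed_all)
    show "v \<in> p ` {..n}" using p0 by (metis atMost_iff image_eqI zero_le)
    show "A x \<in> p ` {..n} \<and> B x \<in> p ` {..n}" if x: "x \<in> p ` {..n}" for x
    proof -
      obtain j where j: "x = p j" "j \<le> n" using x by blast
      have "{p j, p (Suc j), p (j - 1)} \<subseteq> p ` {..n}"
        using j n by (cases "j = n") auto
      then show ?thesis using step[of j] j by blast
    qed
  qed
  \<comment> \<open>No step up to \<open>p n\<close> stalls, so by \<open>endp\<close> an endpoint
    other than \<open>v\<close> must stall the step that follows it, which first happens at
    \<open>p n\<close>.\<close>
  have only: "u = p n" if u: "u \<in> C" "u \<noteq> v" "A u = u \<or> B u = u" for u
  proof -
    obtain j where j: "u = p j" "j \<le> n" using u sub by blast
    have "j \<noteq> 0" using j u p0 by metis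
    moreover have "p j \<noteq> p (j - 1)" using nmin[of "j - 1"] j \<open>j \<noteq> 0\<close> by simp
    ultimately have "p (Suc j) = p j" using endp[of j] u j by auto
    then show ?thesis using nmin[of j] j by (cases "j = n") auto
  qed
  show ?thesis using w only by blast
qed

lemma alternating_path:
  fixes A B :: "'v \<Rightarrow> 'v"
  assumes A: "\<And>x. A (A x) = x" and B: "\<And>x. B (B x) = x"
    and C: "C = R\<^sup>* `` {v}" and R: "\<And>x y. (x, y) \<in> R \<Longrightarrow> y = A x \<or> y = B x"
    and fin: "finite C" and AC: "\<And>x. x \<in> C \<Longrightarrow> A x \<in> C" and BC: "\<And>x. x \<in> C \<Longrightarrow> B x \<in> C"
    and nofix: "\<And>x. x \<in> C \<Longrightarrow> \<not> (A x = x \<and> B x = x)"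
    and v: "A v = v \<or> B v = v"
  shows "\<exists>!w. w \<in> C \<and> w \<noteq> v \<and> (A w = w \<or> B w = w)"
proof (cases "B v = v")
  case True
  then show ?thesis using alternating_path_aux[OF A B C R fin AC BC nofix] by blast
next
  case False
  then have "A v = v" using v by blast
  have R': "y = B x \<or> y = A x" if "(x, y) \<in> R" for x y using R[OF that] by blast
  have nofix': "\<not> (B x = x \<and> A x = x)" if "x \<in> C" for x using nofix[OF that] by blast
  show ?thesis using alternating_path_aux[OF B A C R' fin BC AC nofix' \<open>A v = v\<close>]
    by (simp add: disj_commute)
qed

section \<open>Diagrams as involutions\<close>

lemma bverts_simps [simp]:
  "Inl i \<in> bverts r s \<longleftrightarrow> i < r" "Inr j \<in> bverts r s \<longleftrightarrow> j < s"
  by (auto simp: bverts_def)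

lemma finite_bverts [simp]: "finite (bverts r s)"
  by (simp add: bverts_def)

lemma bdiag_outside: "is_bdiag r s d \<Longrightarrow> v \<notin> bverts r s \<Longrightarrow> d v = v"
  by (simp add: is_bdiag_def)

lemma bdiag_neq: "is_bdiag r s d \<Longrightarrow> v \<in> bverts r s \<Longrightarrow> d v \<noteq> v"
  by (simp add: is_bdiag_def)

lemma bdiag_invol: "is_bdiag r s d \<Longrightarrow> d (d v) = v"
  by (cases "v \<in> bverts r s") (auto simp: is_bdiag_def)

lemma bdiag_in: "is_bdiag r s d \<Longrightarrow> d v \<in> bverts r s \<longleftrightarrow> v \<in> bverts r s"
  by (metis is_bdiag_def)

lemma finite_bdiags [simp]: "finite {d. is_bdiag r s d}"
proof (rule finite_subset)
  show "{d. is_bdiag r s d} \<subseteq>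
    {d. (\<forall>v. v \<in> bverts r s \<longrightarrow> d v \<in> bverts r s) \<and> (\<forall>v. v \<notin> bverts r s \<longrightarrow> d v = v)}"
    by (auto simp: is_bdiag_def)
next
  let ?V = "bverts r s"
  \<comment> \<open>The finiteness theorem for function spaces asks for a constant value outside a
    finite set, whereas a diagram is the identity there. \<open>?F\<close> overwrites these values
    by \<open>Inl 0\<close> and stays injective.\<close>
  let ?F = "\<lambda>d v. if v \<in> ?V then d v else Inl 0"
  have "finite {d. \<forall>v. (v \<in> ?V \<longrightarrow> d v \<in> ?V) \<and> (v \<notin> ?V \<longrightarrow> d v = Inl 0)}"
    by (rule finite_set_of_finite_funs) simp_all
  moreover have "?F ` {d. (\<forall>v. v \<in> ?V \<longrightarrow> d v \<in> ?V) \<and> (\<forall>v. v \<notin> ?V \<longrightarrow> d v = v)}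
      \<subseteq> {d. \<forall>v. (v \<in> ?V \<longrightarrow> d v \<in> ?V) \<and> (v \<notin> ?V \<longrightarrow> d v = Inl 0)}" by auto
  ultimately have "finite (?F ` {d. (\<forall>v. v \<in> ?V \<longrightarrow> d v \<in> ?V) \<and> (\<forall>v. v \<notin> ?V \<longrightarrow> d v = v)})"
    by (rule rev_finite_subset)
  then show "finite {d. (\<forall>v. v \<in> ?V \<longrightarrow> d v \<in> ?V) \<and> (\<forall>v. v \<notin> ?V \<longrightarrow> d v = v)}"
  proof (rule finite_imageD)
    show "inj_on ?F {d. (\<forall>v. v \<in> ?V \<longrightarrow> d v \<in> ?V) \<and> (\<forall>v. v \<notin> ?V \<longrightarrow> d v = v)}"
    proof (rule inj_onI, rule ext)
      fix d d' v
      assume "d \<in> {d. (\<forall>v. v \<in> ?V \<longrightarrow> d v \<in> ?V) \<and> (\<forall>v. v \<notin> ?V \<longrightarrow> d v = v)}"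
        "d' \<in> {d. (\<forall>v. v \<in> ?V \<longrightarrow> d v \<in> ?V) \<and> (\<forall>v. v \<notin> ?V \<longrightarrow> d v = v)}" and eq: "?F d = ?F d'"
      then show "d v = d' v" using fun_cong[OF eq, of v] by (cases "v \<in> ?V") auto
    qed
  qed
qed

section \<open>Stacking two diagrams\<close>

text \<open>\<open>stA\<close> and \<open>stB\<close> extend the two diagrams to involutions on the
  vertices of the stacked picture. Within the picture \<open>stA\<close> fixes exactly the top row
  and \<open>stB\<close> exactly the bottom row, so the outer vertices are the endpoints in the
  sense of \<open>alternating_path\<close>.\<close>

definition stA :: "bdiag \<Rightarrow> nat \<times> nat \<Rightarrow> nat \<times> nat" where
  "stA a p = (if fst p = 0 then lowA (a (Inl (snd p))) else if fst p = 1 then lowA (a (Inr (snd p))) else p)"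

definition stB :: "bdiag \<Rightarrow> nat \<times> nat \<Rightarrow> nat \<times> nat" where
  "stB b p = (if fst p = 1 then upB (b (Inl (snd p))) else if fst p = 2 then upB (b (Inr (snd p))) else p)"

definition stV :: "nat \<Rightarrow> nat \<Rightarrow> nat \<Rightarrow> (nat \<times> nat) set" where
  "stV r s t = {0} \<times> {..<r} \<union> {1} \<times> {..<s} \<union> {2} \<times> {..<t}"

lemma low_up_simps [simp]:
  "lowA (Inl i) = (0, i)" "lowA (Inr i) = (1, i)" "upB (Inl i) = (1, i)" "upB (Inr i) = (2, i)"
  "outer (Inl i) = (0, i)" "outer (Inr i) = (2, i)"
  by (simp_all add: lowA_def upB_def outer_def)

lemma inj_lowA: "lowA v = lowA w \<longleftrightarrow> v = w" and inj_upB: "upB v = upB w \<longleftrightarrow> v = w"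
  and inj_outer: "outer v = outer w \<longleftrightarrow> v = w"
  by (cases v; cases w; simp)+

lemma stA_lowA: "stA a (lowA v) = lowA (a v)" and stB_upB: "stB b (upB v) = upB (b v)"
  by (cases v; simp add: stA_def stB_def)+

lemma stA_cases: "(\<exists>v. p = lowA v) \<or> stA a p = p" and stB_cases: "(\<exists>v. p = upB v) \<or> stB b p = p"
proof -
  obtain n i where [simp]: "p = (n, i)" by force
  show "(\<exists>v. p = lowA v) \<or> stA a p = p"
    using low_up_simps(1,2)[of i] by (cases "n = 0"; cases "n = 1") (auto simp: stA_def simp del: low_up_simps, metis+)
  show "(\<exists>v. p = upB v) \<or> stB b p = p"
    using low_up_simps(3,4)[of i] by (cases "n = 1"; cases "n = 2") (auto simp: stB_def simp del: low_up_simps, metis+)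
qed

lemma stA_invol: "is_bdiag r s a \<Longrightarrow> stA a (stA a p) = p"
  using stA_cases[of p a] by (auto simp: stA_lowA bdiag_invol)

lemma stB_invol: "is_bdiag s t b \<Longrightarrow> stB b (stB b p) = p"
  using stB_cases[of p b] by (auto simp: stB_upB bdiag_invol)

lemma lowA_in: "lowA v \<in> stV r s t \<longleftrightarrow> v \<in> bverts r s"
  and upB_in: "upB v \<in> stV r s t \<longleftrightarrow> v \<in> bverts s t"
  and outer_in: "outer v \<in> stV r s t \<longleftrightarrow> v \<in> bverts r t"
  by (cases v; auto simp: stV_def)+

lemma fst_lowA: "fst (lowA v) \<noteq> 2" and fst_upB: "fst (upB v) \<noteq> 0"
  by (cases v; simp)+

lemma stV_lowA: "p \<in> stV r s t \<Longrightarrow> (\<exists>v \<in> bverts r s. p = lowA v) \<or> fst p = 2"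
proof -
  assume p: "p \<in> stV r s t"
  let ?v = "if fst p = 0 then Inl (snd p) else Inr (snd p)"
  have "fst p \<noteq> 2 \<Longrightarrow> p = lowA ?v" "fst p \<noteq> 2 \<Longrightarrow> ?v \<in> bverts r s"
    using p by (auto simp: stV_def)
  then show ?thesis by blast
qed

lemma stV_upB: "p \<in> stV r s t \<Longrightarrow> (\<exists>v \<in> bverts s t. p = upB v) \<or> fst p = 0"
proof -
  assume p: "p \<in> stV r s t"
  let ?v = "if fst p = 1 then Inl (snd p) else Inr (snd p)"
  have "fst p \<noteq> 0 \<Longrightarrow> p = upB ?v" "fst p \<noteq> 0 \<Longrightarrow> ?v \<in> bverts s t"
    using p by (auto simp: stV_def)
  then show ?thesis by blast
qed

lemma finite_stV [simp]: "finite (stV r s t)" by (simp add: stV_def)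

text \<open>A two-colouring of the vertices is encoded by the set of bottom indices and the set of top
indices of one colour.\<close>

definition compat :: "bdiag \<Rightarrow> nat set \<Rightarrow> nat set \<Rightarrow> bool" where
  "compat d x y \<longleftrightarrow> (\<forall>v \<in> x <+> y. d v \<in> x <+> y)"

context
  fixes r s t a b
  assumes a: "is_bdiag r s a" and b: "is_bdiag s t b"
begin

private abbreviation "E \<equiv> stack_edges r s t b a"
private abbreviation "conn \<equiv> stack_conn r s t b a"

lemma edges_iff: "(p, q) \<in> E \<longleftrightarrow>
   (\<exists>v \<in> bverts r s. p = lowA v \<and> q = lowA (a v)) \<or> (\<exists>v \<in> bverts s t. p = upB v \<and> q = upB (b v))"
  by (auto simp: stack_edges_def)

lemma edgesD: "(p, q) \<in> E \<Longrightarrow> q = stA a p \<or> q = stB b p"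
  by (auto simp: edges_iff stA_lowA stB_upB)

lemma edges_in: "(p, q) \<in> E \<Longrightarrow> p \<in> stV r s t \<and> q \<in> stV r s t"
  using a b by (auto simp: edges_iff lowA_in upB_in bdiag_in)

lemma stA_conn: "p \<in> stV r s t \<Longrightarrow> (p, stA a p) \<in> conn"
  unfolding stack_conn_def using stA_cases[of p a]
  by (cases "stA a p = p") (auto simp: stA_lowA lowA_in edges_iff intro!: r_into_rtrancl)

lemma stB_conn: "p \<in> stV r s t \<Longrightarrow> (p, stB b p) \<in> conn"
  unfolding stack_conn_def using stB_cases[of p b]
  by (cases "stB b p = p") (auto simp: stB_upB upB_in edges_iff intro!: r_into_rtrancl)

lemma sym_edges: "sym E"
proof (rule symI)
  fix p q assume "(p, q) \<in> E"
  then show "(q, p) \<in> E"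
    unfolding edges_iff using a b by (metis bdiag_in bdiag_invol)
qed

lemma conn_sym: "(p, q) \<in> conn \<Longrightarrow> (q, p) \<in> conn"
  unfolding stack_conn_def by (meson sym_edges sym_rtrancl symD)

lemma conn_refl [simp]: "(p, p) \<in> conn" by (simp add: stack_conn_def)

lemma conn_trans: "(p, q) \<in> conn \<Longrightarrow> (q, u) \<in> conn \<Longrightarrow> (p, u) \<in> conn"
  unfolding stack_conn_def by (rule rtrancl_trans)

lemma conn_closed: "(p, q) \<in> conn \<Longrightarrow> p \<in> S \<Longrightarrow> (\<And>p q. p \<in> S \<Longrightarrow> (p, q) \<in> E \<Longrightarrow> q \<in> S) \<Longrightarrow> q \<in> S"
  unfolding stack_conn_def by (induction rule: rtrancl_induct) auto

lemma conn_in: "(p, q) \<in> conn \<Longrightarrow> p \<in> stV r s t \<Longrightarrow> q \<in> stV r s t"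
  by (erule conn_closed) (use edges_in in auto)

lemma stA_fix: "p \<in> stV r s t \<Longrightarrow> stA a p = p \<longleftrightarrow> fst p = 2"
  using stV_lowA[of p r s t] bdiag_neq[OF a] fst_lowA
  by (metis inj_lowA numeral_One numeral_eq_iff semiring_norm(85) stA_def stA_lowA zero_neq_numeral)

lemma stB_fix: "p \<in> stV r s t \<Longrightarrow> stB b p = p \<longleftrightarrow> fst p = 0"
  using stV_upB[of p r s t] bdiag_neq[OF b] fst_upB
  by (metis inj_upB one_neq_zero zero_neq_numeral stB_def stB_upB)

lemma outer_row: "fst (outer v) = 0 \<or> fst (outer v) = 2" by (cases v) auto

lemma outer_surj: "p \<in> stV r s t \<Longrightarrow> fst p = 0 \<or> fst p = 2 \<Longrightarrow> \<exists>v \<in> bverts r t. p = outer v"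
proof -
  assume p: "p \<in> stV r s t" "fst p = 0 \<or> fst p = 2"
  have "p = outer (if fst p = 0 then Inl (snd p) else Inr (snd p))" using p by (cases p) auto
  moreover have "(if fst p = 0 then Inl (snd p) else Inr (snd p)) \<in> bverts r t"
    using p by (auto simp: stV_def)
  ultimately show ?thesis by blast
qed

text \<open>Justifies the \<open>THE\<close> in \<open>dcomp\<close>: the component of an outer
  vertex is a path along which strings of \<open>a\<close> and \<open>b\<close> alternate, and its
  two ends are its only outer vertices.\<close>

lemma outer_partner:
  assumes v: "v \<in> bverts r t"
  shows "\<exists>!w. w \<in> bverts r t \<and> w \<noteq> v \<and> (outer v, outer w) \<in> conn"
proof -
  let ?C = "E\<^sup>* `` {outer v}"
  have C: "?C = conn `` {outer v}" by (simp add: stack_conn_def)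
  have CV: "p \<in> stV r s t" if "p \<in> ?C" for p
    using that conn_in v unfolding C by (auto simp: outer_in)
  have "\<exists>!p. p \<in> ?C \<and> p \<noteq> outer v \<and> (stA a p = p \<or> stB b p = p)"
  proof (rule alternating_path)
    show "finite ?C" by (rule finite_subset[of _ "stV r s t"]) (use CV in auto)
    show "stA a p \<in> ?C" "stB b p \<in> ?C" if "p \<in> ?C" for p
      using that stA_conn stB_conn CV[OF that] conn_trans unfolding C by blast+
    show "\<not> (stA a p = p \<and> stB b p = p)" if "p \<in> ?C" for p
      using stA_fix stB_fix CV[OF that] by auto
    show "stA a (outer v) = outer v \<or> stB b (outer v) = outer v"
      using stA_fix stB_fix v outer_row[of v] by (auto simp: outer_in)
  qed (fact stA_invol[OF a] stB_invol[OF b] refl | erule edgesD)+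
  then obtain p where p: "p \<in> ?C" "p \<noteq> outer v" "stA a p = p \<or> stB b p = p"
    and uni: "\<And>q. q \<in> ?C \<Longrightarrow> q \<noteq> outer v \<Longrightarrow> stA a q = q \<or> stB b q = q \<Longrightarrow> q = p"
    by (elim ex1E) blast
  obtain w where w: "w \<in> bverts r t" "p = outer w"
    using outer_surj[OF CV[OF p(1)]] p(3) stA_fix[OF CV[OF p(1)]] stB_fix[OF CV[OF p(1)]] by blast
  show ?thesis
  proof (rule ex1I[of _ w])
    show "w \<in> bverts r t \<and> w \<noteq> v \<and> (outer v, outer w) \<in> conn"
      using w p C by auto
  next
    fix u assume u: "u \<in> bverts r t \<and> u \<noteq> v \<and> (outer v, outer u) \<in> conn"
    have "outer u = p"
      by (rule uni) (use u C outer_row[of u] stA_fix stB_fix in \<open>auto simp: inj_outer outer_in\<close>)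
    then show "u = w" using w by (simp add: inj_outer)
  qed
qed

lemma dcomp_iff:
  assumes "v \<in> bverts r t"
  shows "dcomp r s t b a v = w \<longleftrightarrow> w \<in> bverts r t \<and> w \<noteq> v \<and> (outer v, outer w) \<in> conn"
proof -
  have "dcomp r s t b a v = (THE w. w \<in> bverts r t \<and> w \<noteq> v \<and> (outer v, outer w) \<in> conn)"
    using assms by (simp add: dcomp_def)
  then show ?thesis
    using theI'[OF outer_partner[OF assms]] the1_equality[OF outer_partner[OF assms]] by metis
qed

lemma bdiag_dcomp: "is_bdiag r t (dcomp r s t b a)"
  unfolding is_bdiag_def
proof (intro conjI ballI allI impI)
  fix v assume v: "v \<in> bverts r t"
  obtain w where w: "dcomp r s t b a v = w" by blast
  then have *: "w \<in> bverts r t" "w \<noteq> v" "(outer v, outer w) \<in> conn"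
    using dcomp_iff[OF v, of w] by blast+
  then show "dcomp r s t b a v \<in> bverts r t" "dcomp r s t b a v \<noteq> v" using w by auto
  show "dcomp r s t b a (dcomp r s t b a v) = v"
    unfolding w using dcomp_iff[OF *(1)] * v conn_sym by blast
qed (simp add: dcomp_def)

text \<open>Labellings of all three rows, respectively of the two outer rows, written as sets of
  vertices of the stacked picture, so that connectivity can be applied to them.\<close>

private abbreviation "full x z y \<equiv> {0::nat} \<times> x \<union> {1} \<times> z \<union> {2} \<times> (y :: nat set)"
private abbreviation "O2 x y \<equiv> {0::nat} \<times> x \<union> {2} \<times> (y :: nat set)"

lemma full_low: "lowA v \<in> full x z y \<longleftrightarrow> v \<in> x <+> z"
  by (cases v) auto

lemma full_up: "upB v \<in> full x z y \<longleftrightarrow> v \<in> z <+> y"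
  by (cases v) auto

lemma full_outer: "outer v \<in> O2 x y \<longleftrightarrow> v \<in> x <+> y"
  by (cases v) auto

lemma edges_full:
  assumes "(p, q) \<in> E" "p \<in> full x z y" and ca: "compat a x z" and cb: "compat b z y"
  shows "q \<in> full x z y"
proof -
  have "(\<exists>v. p = lowA v \<and> q = lowA (a v)) \<or> (\<exists>v. p = upB v \<and> q = upB (b v))"
    using edges_iff[of p q] assms(1) by auto
  then show ?thesis
  proof (elim disjE exE conjE)
    fix v assume v: "p = lowA v" "q = lowA (a v)"
    then have "v \<in> x <+> z" using assms(2) full_low[of v x z y] by simp
    then have "a v \<in> x <+> z" using ca by (simp add: compat_def)
    then show ?thesis using v full_low[of "a v" x z y] by simp
  next
    fix v assume v: "p = upB v" "q = upB (b v)"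
    then have "v \<in> z <+> y" using assms(2) full_up[of v x z y] by simp
    then have "b v \<in> z <+> y" using cb by (simp add: compat_def)
    then show ?thesis using v full_up[of "b v" x z y] by simp
  qed
qed

text \<open>A labelling that is constant on each string is constant along chains of strings.
  Admissible labellings of the whole picture are thus unions of components.\<close>

lemma compat_full:
  assumes "x \<subseteq> {..<r}" "z \<subseteq> {..<s}" "y \<subseteq> {..<t}"
  shows "compat a x z \<and> compat b z y \<longleftrightarrow> (\<forall>p \<in> full x z y. \<forall>q. (p, q) \<in> conn \<longrightarrow> q \<in> full x z y)"
    (is "?L \<longleftrightarrow> ?R")
proof
  assume ?L
  show ?R
  proof (intro ballI allI impI)
    fix p q assume "p \<in> full x z y" "(p, q) \<in> conn"
    from this(2,1) show "q \<in> full x z y"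
      by (rule conn_closed) (use edges_full \<open>?L\<close> in blast)
  qed
next
  assume R: ?R
  have "a v \<in> x <+> z" if "v \<in> x <+> z" for v
  proof -
    have "v \<in> bverts r s" using that assms by auto
    then have "(lowA v, lowA (a v)) \<in> conn"
      unfolding stack_conn_def by (intro r_into_rtrancl) (auto simp: edges_iff)
    then show ?thesis using R that by (metis full_low)
  qed
  moreover have "b v \<in> z <+> y" if "v \<in> z <+> y" for v
  proof -
    have "v \<in> bverts s t" using that assms by auto
    then have "(upB v, upB (b v)) \<in> conn"
      unfolding stack_conn_def by (intro r_into_rtrancl) (auto simp: edges_iff)
    then show ?thesis using R that by (metis full_up)
  qed
  ultimately show ?L unfolding compat_def by blast
qed

text \<open>Distinct outer vertices of one component are the two ends of a string of the composite,
  so its admissible labellings can be described by connectivity in the stacked picture.\<close>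

lemma compat_dcomp_iff:
  assumes "x \<subseteq> {..<r}" "y \<subseteq> {..<t}"
  shows "compat (dcomp r s t b a) x y \<longleftrightarrow>
    (\<forall>p \<in> O2 x y. \<forall>q \<in> stV r s t. (p, q) \<in> conn \<longrightarrow> fst q \<noteq> 1 \<longrightarrow> q \<in> O2 x y)" (is "?L \<longleftrightarrow> ?R")
proof
  assume L: ?L
  show ?R
  proof (intro ballI impI)
    fix p q assume p: "p \<in> O2 x y" and q: "q \<in> stV r s t" and pq: "(p, q) \<in> conn" "fst q \<noteq> 1"
    have pV: "p \<in> stV r s t" using p assms by (auto simp: stV_def)
    obtain v where v: "v \<in> bverts r t" "p = outer v" using outer_surj[OF pV] p by auto
    obtain w where w: "w \<in> bverts r t" "q = outer w" using outer_surj[OF q] q pq by (auto simp: stV_def)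
    show "q \<in> O2 x y"
    proof (cases "w = v")
      case False
      then have "dcomp r s t b a v = w" using v w pq dcomp_iff by auto
      then show ?thesis using L p v w unfolding compat_def by (metis full_outer)
    qed (use p v w in auto)
  qed
next
  assume R: ?R
  show ?L unfolding compat_def
  proof
    fix v assume v: "v \<in> x <+> y"
    then have vb: "v \<in> bverts r t" using assms by auto
    let ?w = "dcomp r s t b a v"
    have w: "?w \<in> bverts r t" "(outer v, outer ?w) \<in> conn" using dcomp_iff[OF vb, of ?w] by auto
    have "outer ?w \<in> O2 x y"
      using R v w outer_row[of ?w] by (metis full_outer outer_in one_neq_zero numeral_One numeral_eq_iff semiring_norm(85))
    then show "?w \<in> x <+> y" by (metis full_outer)
  qed
qed

text \<open>A subset of the outer vertices that respects \<open>dcomp\<close> extends to a union of components by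
a free choice for each closed loop.\<close>
lemma card_compat_mid:
  assumes x: "x \<subseteq> {..<r}" and y: "y \<subseteq> {..<t}"
  shows "card {z. z \<subseteq> {..<s} \<and> compat a x z \<and> compat b z y} =
     (if compat (dcomp r s t b a) x y then 2 ^ loops r s t b a else 0)"
proof (cases "compat (dcomp r s t b a) x y")
  case False
  have "{z. z \<subseteq> {..<s} \<and> compat a x z \<and> compat b z y} = {}"
  proof safe
    fix z assume z: "z \<subseteq> {..<s}" and c: "compat a x z" "compat b z y"
    have cl: "\<forall>p \<in> full x z y. \<forall>q. (p, q) \<in> conn \<longrightarrow> q \<in> full x z y"
      using compat_full[OF x z y] c by blast
    have "compat (dcomp r s t b a) x y"
      unfolding compat_dcomp_iff[OF x y]
    proof (intro ballI impI)
      fix p q assume "p \<in> O2 x y" "(p, q) \<in> conn" "fst q \<noteq> 1"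
      then have "q \<in> full x z y" using cl by blast
      then show "q \<in> O2 x y" using \<open>fst q \<noteq> 1\<close> by auto
    qed
    then show "z \<in> {}" using False by simp
  qed
  then show ?thesis using False by simp
next
  case True
  define L where "L = {conn `` {(1, j)} | j. j < s \<and> conn `` {(1, j)} \<subseteq> {1} \<times> {..<s}}"
  have finL: "finite L"
    by (rule finite_subset[of _ "(\<lambda>j. conn `` {(1, j)}) ` {..<s}"]) (auto simp: L_def)
  have cL: "card L = loops r s t b a" by (simp add: L_def loops_def)
  \<comment> \<open>The part of every extension that is forced by the outer labelling.\<close>
  define O' where "O' = conn `` (O2 x y)"
  have OV: "O2 x y \<subseteq> stV r s t" using x y by (auto simp: stV_def)
  \<comment> \<open>Here admissibility for the composite is used: closing up under connectivity
    colours no further outer vertex.\<close>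
  have O'_out: "O' \<inter> {p. fst p \<noteq> 1} = O2 x y"
  proof (intro equalityI subsetI)
    fix q assume "q \<in> O' \<inter> {p. fst p \<noteq> 1}"
    then obtain p where p: "p \<in> O2 x y" "(p, q) \<in> conn" and q: "fst q \<noteq> 1" by (auto simp: O'_def)
    moreover have "q \<in> stV r s t" using conn_in p OV by blast
    ultimately show "q \<in> O2 x y" using True unfolding compat_dcomp_iff[OF x y] by blast
  next
    fix q assume "q \<in> O2 x y"
    moreover have "fst q \<noteq> 1" using \<open>q \<in> O2 x y\<close> by auto
    ultimately show "q \<in> O' \<inter> {p. fst p \<noteq> 1}" using conn_refl[of q] unfolding O'_def by blast
  qed
  have O'V: "O' \<subseteq> stV r s t" using OV conn_in unfolding O'_def by blast
  have O'_cl: "q \<in> O'" if "p \<in> O'" "(p, q) \<in> conn" for p q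
    using that conn_trans unfolding O'_def by blast
  have L_cl: "q \<in> c" if "c \<in> L" "p \<in> c" "(p, q) \<in> conn" for p q c
    using that conn_trans unfolding L_def by blast
  have L_row: "c \<subseteq> {1} \<times> {..<s}" if "c \<in> L" for c using that by (auto simp: L_def)
  have L_mem: "c = conn `` {p}" if "c \<in> L" "p \<in> c" for c p
    using that conn_trans conn_sym unfolding L_def by blast
  have mid: "conn `` {(1, j)} \<in> L \<or> (\<exists>q \<in> stV r s t. fst q \<noteq> 1 \<and> ((1, j), q) \<in> conn)" if "j < s" for j
  proof (cases "conn `` {(1, j)} \<subseteq> {1} \<times> {..<s}")
    case True then show ?thesis using that by (auto simp: L_def)
  next
    case False
    then obtain q where q: "((1, j), q) \<in> conn" "q \<notin> {1} \<times> {..<s}" by auto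
    moreover have "q \<in> stV r s t" using q(1) conn_in that by (auto simp: stV_def)
    moreover have "fst q \<noteq> 1" using q(2) \<open>q \<in> stV r s t\<close> by (auto simp: stV_def)
    ultimately show ?thesis by blast
  qed
  \<comment> \<open>The middle row of the forced part together with an arbitrary choice
    \<open>T\<close> of loops.\<close>
  define Z where "Z T = {j. j < s \<and> (1, j) \<in> O' \<union> \<Union>T}" for T
  have full_Z: "full x (Z T) y = O' \<union> \<Union>T" if "T \<subseteq> L" for T
  proof
    show "full x (Z T) y \<subseteq> O' \<union> \<Union>T" using O'_out by (auto simp: Z_def)
    show "O' \<union> \<Union>T \<subseteq> full x (Z T) y"
    proof
      fix p assume p: "p \<in> O' \<union> \<Union>T"
      have pV: "p \<in> stV r s t"
      proof (cases "p \<in> O'")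
        case False
        then have "p \<in> {1} \<times> {..<s}" using p L_row that by blast
        then show ?thesis by (auto simp: stV_def)
      qed (use O'V in blast)
      show "p \<in> full x (Z T) y"
      proof (cases "fst p = 1")
        case True then show ?thesis using p pV by (cases p) (auto simp: Z_def stV_def)
      next
        case False
        then have "p \<notin> {1} \<times> {..<s}" by auto
        then have "p \<in> O'" using p L_row that by blast
        then show ?thesis using O'_out False by blast
      qed
    qed
  qed
  have "bij_betw Z (Pow L) {z. z \<subseteq> {..<s} \<and> compat a x z \<and> compat b z y}"
  proof (rule bij_betw_byWitness[where f' = "\<lambda>z. {c \<in> L. c \<subseteq> {1} \<times> z}"])
    show "\<forall>T \<in> Pow L. {c \<in> L. c \<subseteq> {1} \<times> Z T} = T"
    proof (intro ballI equalityI subsetI)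
      fix T c assume T: "T \<in> Pow L" and c: "c \<in> {c \<in> L. c \<subseteq> {1} \<times> Z T}"
      obtain j where j: "j < s" "c = conn `` {(1, j)}" using c by (auto simp: L_def)
      then have jc: "(1, j) \<in> c" by simp
      then have "(1, j) \<in> O' \<union> \<Union>T" using c by (auto simp: Z_def)
      then show "c \<in> T"
      proof
        \<comment> \<open>A loop meeting the forced part would contain an outer vertex, although it
          lies in the middle row.\<close>
        assume "(1, j) \<in> O'"
        then obtain p where p: "p \<in> O2 x y" "(p, (1, j)) \<in> conn" by (auto simp: O'_def)
        then have "p \<in> c" using j conn_sym by blast
        then show ?thesis using p c by auto
      next
        assume "(1, j) \<in> \<Union>T"
        then obtain c' where "c' \<in> T" "(1, j) \<in> c'" by blast
        then show ?thesis using L_mem[of c' "(1, j)"] j T by auto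
      qed
    next
      fix T c assume T: "T \<in> Pow L" and c: "c \<in> T"
      then show "c \<in> {c \<in> L. c \<subseteq> {1} \<times> Z T}"
        using L_row[of c] by (auto simp: Z_def)
    qed
    show "\<forall>z \<in> {z. z \<subseteq> {..<s} \<and> compat a x z \<and> compat b z y}. Z {c \<in> L. c \<subseteq> {1} \<times> z} = z"
    proof
      fix z assume "z \<in> {z. z \<subseteq> {..<s} \<and> compat a x z \<and> compat b z y}"
      then have z: "z \<subseteq> {..<s}" and "compat a x z \<and> compat b z y" by auto
      then have cl: "\<And>p q. p \<in> full x z y \<Longrightarrow> (p, q) \<in> conn \<Longrightarrow> q \<in> full x z y"
        using compat_full[OF x z y] by blast
      show "Z {c \<in> L. c \<subseteq> {1} \<times> z} = z"
      proof (intro equalityI subsetI)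
        fix j assume "j \<in> Z {c \<in> L. c \<subseteq> {1} \<times> z}"
        then have "(1, j) \<in> O' \<or> (1::nat, j) \<in> {1} \<times> z" by (auto simp: Z_def)
        moreover have "(1, j) \<in> full x z y" if "(1, j) \<in> O'"
        proof -
          obtain p where "p \<in> O2 x y" "(p, (1, j)) \<in> conn" using \<open>(1, j) \<in> O'\<close> by (auto simp: O'_def)
          then show ?thesis using cl[of p "(1, j)"] by blast
        qed
        ultimately show "j \<in> z" by auto
      next
        fix j assume j: "j \<in> z"
        then have js: "j < s" using z by auto
        consider "conn `` {(1, j)} \<in> L" | q where "q \<in> stV r s t" "fst q \<noteq> 1" "((1, j), q) \<in> conn"
          using mid[OF js] by blast
        then show "j \<in> Z {c \<in> L. c \<subseteq> {1} \<times> z}"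
        proof cases
          case 1
          have "conn `` {(1, j)} \<subseteq> {1} \<times> z"
          proof
            fix q assume q: "q \<in> conn `` {(1, j)}"
            then have "q \<in> full x z y" using cl[of "(1, j)" q] j by auto
            then show "q \<in> {1} \<times> z" using q L_row[OF 1] by auto
          qed
          moreover have "(1, j) \<in> conn `` {(1, j)}" by simp
          ultimately show ?thesis using 1 js unfolding Z_def by blast
        next
          case 2
          then have "q \<in> full x z y" using cl[of "(1, j)" q] j by auto
          then have "q \<in> O2 x y" using 2 by auto
          moreover have "(q, (1, j)) \<in> conn" using 2 conn_sym by blast
          ultimately have "(1, j) \<in> O'" unfolding O'_def by blast
          then show ?thesis using js by (simp add: Z_def)
        qed
      qed
    qed
    show "Z ` Pow L \<subseteq> {z. z \<subseteq> {..<s} \<and> compat a x z \<and> compat b z y}"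
    proof
      fix z assume "z \<in> Z ` Pow L"
      then obtain T where T: "T \<subseteq> L" "z = Z T" by auto
      have zs: "Z T \<subseteq> {..<s}" by (auto simp: Z_def)
      have "\<forall>p \<in> full x (Z T) y. \<forall>q. (p, q) \<in> conn \<longrightarrow> q \<in> full x (Z T) y"
        unfolding full_Z[OF T(1)] using O'_cl L_cl T(1) by blast
      then show "z \<in> {z. z \<subseteq> {..<s} \<and> compat a x z \<and> compat b z y}"
        using compat_full[OF x zs y] T zs by blast
    qed
  qed auto
  then have "card {z. z \<subseteq> {..<s} \<and> compat a x z \<and> compat b z y} = card (Pow L)"
    by (simp add: bij_betw_same_card)
  then show ?thesis using True cL finL by (simp add: card_Pow)
qed

end

section \<open>Algebra of diagrams\<close>

text \<open>Colour just the two ends of the string of \<open>d\<close> at \<open>v\<close>. If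
  \<open>d'\<close> respects this labelling, it maps \<open>v\<close> into \<open>{v, d v}\<close>,
  and it does not fix \<open>v\<close>.\<close>

lemma bdiag_ext:
  assumes d: "is_bdiag r s d" and d': "is_bdiag r s d'"
    and eq: "\<And>x y. x \<subseteq> {..<r} \<Longrightarrow> y \<subseteq> {..<s} \<Longrightarrow> compat d x y \<Longrightarrow> compat d' x y"
  shows "d = d'"
proof
  fix v
  show "d v = d' v"
  proof (cases "v \<in> bverts r s")
    case False
    then show ?thesis using d d' by (simp add: bdiag_outside)
  next
    case v: True
    let ?x = "{i. Inl i \<in> {v, d v}}" and ?y = "{j. Inr j \<in> {v, d v}}"
    have S: "w \<in> ?x <+> ?y \<longleftrightarrow> w \<in> {v, d v}" for w
      by (cases w) auto
    have dv: "d v \<in> bverts r s" using bdiag_in[OF d] v by simp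
    have "?x \<subseteq> {..<r}" "?y \<subseteq> {..<s}"
      using v dv by (metis (mono_tags, lifting) bverts_simps(1,2) empty_iff insert_iff lessThan_iff mem_Collect_eq subsetI)+
    moreover have "compat d ?x ?y"
      unfolding compat_def S using bdiag_invol[OF d] by auto
    ultimately have "compat d' ?x ?y" by (rule eq)
    then have "v \<in> ?x <+> ?y \<Longrightarrow> d' v \<in> ?x <+> ?y" unfolding compat_def by (rule bspec)
    then have "d' v \<in> {v, d v}" unfolding S by simp
    then show ?thesis using bdiag_neq[OF d' v] by auto
  qed
qed

text \<open>Valued in the naturals rather than in the coefficient ring, so that powers of
  \<open>2\<close> can be compared.\<close>

definition wt :: "bdiag \<Rightarrow> nat set \<Rightarrow> nat set \<Rightarrow> nat" where
  "wt d x y = of_bool (compat d x y)"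

text \<open>\<open>wt d\<close> is the 0-1 matrix of \<open>d\<close> in the representation where
  each strand carries a two-dimensional space and a loop counts \<open>2\<close>. Stacking becomes a
  matrix product, up to the loop factor.\<close>

lemma sum_wt:
  assumes "is_bdiag r s a" "is_bdiag s t b" "x \<subseteq> {..<r}" "y \<subseteq> {..<t}"
  shows "(\<Sum>z\<in>Pow {..<s}. wt a x z * wt b z y) = 2 ^ loops r s t b a * wt (dcomp r s t b a) x y"
proof -
  have "(\<Sum>z\<in>Pow {..<s}. wt a x z * wt b z y) = (\<Sum>z\<in>Pow {..<s}. of_bool (compat a x z \<and> compat b z y))"
    by (simp only: wt_def of_bool_conj)
  also have "\<dots> = card (Pow {..<s} \<inter> {z. compat a x z \<and> compat b z y})"
    by (simp only: sum_of_bool_eq finite_Pow_iff finite_lessThan of_nat_id)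
  also have "Pow {..<s} \<inter> {z. compat a x z \<and> compat b z y} = {z. z \<subseteq> {..<s} \<and> compat a x z \<and> compat b z y}"
    by auto
  finally show ?thesis
    using card_compat_mid[OF assms] by (simp add: wt_def)
qed

text \<open>Both sides are nonzero at the same labellings, which gives the diagram by
  \<open>bdiag_ext\<close>. The empty labelling is admissible for every diagram and isolates the
  power of \<open>2\<close>.\<close>

lemma wt_ext:
  assumes d: "is_bdiag r s d" and d': "is_bdiag r s d'"
    and eq: "\<And>x y. x \<subseteq> {..<r} \<Longrightarrow> y \<subseteq> {..<s} \<Longrightarrow> 2 ^ n * wt d x y = 2 ^ n' * wt d' x y"
  shows "d = d' \<and> n = n'"
proof
  show "d = d'"
    by (rule bdiag_ext[OF d d']) (use eq in \<open>force simp: wt_def of_bool_def split: if_splits\<close>)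
  have "compat e {} {}" for e by (auto simp: compat_def)
  then have "(2::nat) ^ n = 2 ^ n'" using eq[of "{}" "{}"] by (simp add: wt_def)
  then show "n = n'" by simp
qed

text \<open>Both bracketings count the labellings of the two middle rows.\<close>
lemma dcomp_loops_assoc:
  assumes a: "is_bdiag r s a" and b: "is_bdiag s t b" and c: "is_bdiag t u c"
  shows "dcomp r t u c (dcomp r s t b a) = dcomp r s u (dcomp s t u c b) a \<and>
    loops r s t b a + loops r t u c (dcomp r s t b a) = loops s t u c b + loops r s u (dcomp s t u c b) a"
proof (rule wt_ext)
  note ba = bdiag_dcomp[OF a b] and cb = bdiag_dcomp[OF b c]
  show "is_bdiag r u (dcomp r t u c (dcomp r s t b a))" by (rule bdiag_dcomp[OF ba c])
  show "is_bdiag r u (dcomp r s u (dcomp s t u c b) a)" by (rule bdiag_dcomp[OF a cb])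
  fix x y :: "nat set" assume x: "x \<subseteq> {..<r}" and y: "y \<subseteq> {..<u}"
  have "2 ^ (loops r s t b a + loops r t u c (dcomp r s t b a)) * wt (dcomp r t u c (dcomp r s t b a)) x y
      = 2 ^ loops r s t b a * (\<Sum>w\<in>Pow {..<t}. wt (dcomp r s t b a) x w * wt c w y)"
    by (simp add: sum_wt[OF ba c x y] power_add)
  also have "\<dots> = (\<Sum>w\<in>Pow {..<t}. (2 ^ loops r s t b a * wt (dcomp r s t b a) x w) * wt c w y)"
    by (simp add: sum_distrib_left mult.assoc)
  also have "\<dots> = (\<Sum>w\<in>Pow {..<t}. (\<Sum>z\<in>Pow {..<s}. wt a x z * wt b z w) * wt c w y)"
    using sum_wt[OF a b x] by (intro sum.cong) auto
  also have "\<dots> = (\<Sum>z\<in>Pow {..<s}. wt a x z * (\<Sum>w\<in>Pow {..<t}. wt b z w * wt c w y))"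
    unfolding sum_distrib_right sum_distrib_left mult.assoc by (rule sum.swap)
  also have "\<dots> = (\<Sum>z\<in>Pow {..<s}. wt a x z * (2 ^ loops s t u c b * wt (dcomp s t u c b) z y))"
    using sum_wt[OF b c _ y] by (intro sum.cong) auto
  also have "\<dots> = 2 ^ loops s t u c b * (\<Sum>z\<in>Pow {..<s}. wt a x z * wt (dcomp s t u c b) z y)"
    by (simp add: sum_distrib_left ac_simps)
  also have "\<dots> = 2 ^ (loops s t u c b + loops r s u (dcomp s t u c b) a) * wt (dcomp r s u (dcomp s t u c b) a) x y"
    by (simp add: sum_wt[OF a cb x y] power_add)
  finally show "2 ^ (loops r s t b a + loops r t u c (dcomp r s t b a)) * wt (dcomp r t u c (dcomp r s t b a)) x y
     = 2 ^ (loops s t u c b + loops r s u (dcomp s t u c b) a) * wt (dcomp r s u (dcomp s t u c b) a) x y" .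
qed

lemma bdiag_did [simp]: "is_bdiag n n (did n)"
  unfolding is_bdiag_def
proof (intro conjI ballI allI impI)
  fix v assume "v \<in> bverts n n"
  then show "did n v \<in> bverts n n" "did n v \<noteq> v" "did n (did n v) = v"
    by (cases v; simp add: did_def)+
next
  fix v assume "v \<notin> bverts n n"
  then show "did n v = v" by (cases v) (simp_all add: did_def)
qed

lemma compat_did: "x \<subseteq> {..<n} \<Longrightarrow> y \<subseteq> {..<n} \<Longrightarrow> compat (did n) x y \<longleftrightarrow> x = y"
proof -
  assume x: "x \<subseteq> {..<n}" and y: "y \<subseteq> {..<n}"
  have "compat (did n) x y \<longleftrightarrow> (\<forall>i\<in>x. did n (Inl i) \<in> x <+> y) \<and> (\<forall>i\<in>y. did n (Inr i) \<in> x <+> y)"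
    by (auto simp: compat_def)
  also have "\<dots> \<longleftrightarrow> x = y"
    using x y by (auto simp: did_def subset_iff)
  finally show ?thesis .
qed

text \<open>\<open>wt (did r)\<close> is the identity matrix, so the sum over the middle row
  collapses to one term.\<close>

lemma dcomp_did_right:
  assumes a: "is_bdiag r s a"
  shows "dcomp r r s a (did r) = a \<and> loops r r s a (did r) = 0"
proof (rule wt_ext)
  show "is_bdiag r s (dcomp r r s a (did r))" "is_bdiag r s a" by (simp_all add: a bdiag_dcomp)
  fix x y :: "nat set" assume x: "x \<subseteq> {..<r}" and y: "y \<subseteq> {..<s}"
  have "2 ^ loops r r s a (did r) * wt (dcomp r r s a (did r)) x y = (\<Sum>z\<in>Pow {..<r}. wt (did r) x z * wt a z y)"
    using sum_wt[OF bdiag_did a x y] by simp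
  also have "\<dots> = (\<Sum>z\<in>Pow {..<r}. if z = x then wt a x y else 0)"
    using x by (intro sum.cong) (auto simp: wt_def compat_did)
  finally show "2 ^ loops r r s a (did r) * wt (dcomp r r s a (did r)) x y = 2 ^ 0 * wt a x y"
    using x by simp
qed

lemma dcomp_did_left:
  assumes a: "is_bdiag r s a"
  shows "dcomp r s s (did s) a = a \<and> loops r s s (did s) a = 0"
proof (rule wt_ext)
  show "is_bdiag r s (dcomp r s s (did s) a)" "is_bdiag r s a" by (simp_all add: a bdiag_dcomp)
  fix x y :: "nat set" assume x: "x \<subseteq> {..<r}" and y: "y \<subseteq> {..<s}"
  have "2 ^ loops r s s (did s) a * wt (dcomp r s s (did s) a) x y = (\<Sum>z\<in>Pow {..<s}. wt a x z * wt (did s) z y)"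
    using sum_wt[OF a bdiag_did x y] by simp
  also have "\<dots> = (\<Sum>z\<in>Pow {..<s}. if z = y then wt a x y else 0)"
    using y by (intro sum.cong) (auto simp: wt_def compat_did)
  finally show "2 ^ loops r s s (did s) a * wt (dcomp r s s (did s) a) x y = 2 ^ 0 * wt a x y"
    using y by simp
qed

section \<open>Juxtaposition of diagrams\<close>

lemma shiftv_simps [simp]: "shiftv r s (Inl i) = Inl (i + r)" "shiftv r s (Inr j) = Inr (j + s)"
  by (simp_all add: shiftv_def)

lemma shiftv_inj: "shiftv r s v = shiftv r s w \<longleftrightarrow> v = w"
  by (cases v; cases w) auto

lemma shiftv_in: "shiftv r s v \<in> bverts (r + k) (s + l) \<longleftrightarrow> v \<in> bverts k l"
  by (cases v) auto

lemma shiftv_notin: "shiftv r s v \<notin> bverts r s"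
  by (cases v) auto

lemma shiftv_shiftv: "shiftv r s (shiftv k l v) = shiftv (r + k) (s + l) v"
  by (cases v) auto

lemma dtens_low: "v \<in> bverts r s \<Longrightarrow> dtens r s k l a b v = a v"
  by (cases v) (auto simp: dtens_def)

lemma dtens_high: "v \<in> bverts k l \<Longrightarrow> dtens r s k l a b (shiftv r s v) = shiftv r s (b v)"
  by (cases v) (auto simp: dtens_def)

lemma dtens_outside: "v \<notin> bverts (r + k) (s + l) \<Longrightarrow> dtens r s k l a b v = v"
  by (cases v) (auto simp: dtens_def)

lemma bverts_add_cases:
  assumes "v \<in> bverts (r + k) (s + l)"
  obtains "v \<in> bverts r s" | w where "v = shiftv r s w" "w \<in> bverts k l"
proof (cases v)
  case (Inl i)
  show ?thesis
  proof (cases "i < r")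
    case False
    then show ?thesis using Inl assms that(2)[of "Inl (i - r)"] by auto
  qed (use Inl that in auto)
next
  case (Inr i)
  show ?thesis
  proof (cases "i < s")
    case False
    then show ?thesis using Inr assms that(2)[of "Inr (i - s)"] by auto
  qed (use Inr that in auto)
qed

lemma bverts_low: "v \<in> bverts r s \<Longrightarrow> v \<in> bverts (r + k) (s + l)"
  by (cases v) auto

lemma bdiag_dtens:
  assumes a: "is_bdiag r s a" and b: "is_bdiag k l b"
  shows "is_bdiag (r + k) (s + l) (dtens r s k l a b)"
  unfolding is_bdiag_def
proof (intro conjI ballI allI impI)
  fix v assume "v \<in> bverts (r + k) (s + l)"
  then have "dtens r s k l a b v \<in> bverts (r + k) (s + l) \<and> dtens r s k l a b v \<noteq> v \<and>
     dtens r s k l a b (dtens r s k l a b v) = v"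
  proof (cases rule: bverts_add_cases)
    case 1
    then show ?thesis
      using a by (simp add: dtens_low bdiag_in bdiag_neq bdiag_invol bverts_low)
  next
    case (2 w)
    then show ?thesis
      using b by (simp add: dtens_high bdiag_in bdiag_neq bdiag_invol shiftv_in shiftv_inj)
  qed
  then show "dtens r s k l a b v \<in> bverts (r + k) (s + l)" "dtens r s k l a b v \<noteq> v"
     "dtens r s k l a b (dtens r s k l a b v) = v" by auto
qed (simp add: dtens_outside)

text \<open>Restrictions of a labelling to the left and to the right factor of a juxtaposition, the
  second one renumbered from \<open>0\<close>.\<close>

definition lowS :: "nat \<Rightarrow> nat set \<Rightarrow> nat set" where "lowS r x = x \<inter> {..<r}"
definition highS :: "nat \<Rightarrow> nat set \<Rightarrow> nat set" where "highS r x = {i. i + r \<in> x}"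

lemma lowS_sub [simp]: "lowS r x \<subseteq> {..<r}" by (simp add: lowS_def)
lemma highS_sub: "x \<subseteq> {..<r + k} \<Longrightarrow> highS r x \<subseteq> {..<k}" by (auto simp: highS_def)

lemma low_mem: "v \<in> bverts r s \<Longrightarrow> v \<in> x <+> y \<longleftrightarrow> v \<in> lowS r x <+> lowS s y"
  by (cases v) (auto simp: lowS_def)

lemma high_mem: "shiftv r s v \<in> x <+> y \<longleftrightarrow> v \<in> highS r x <+> highS s y"
  by (cases v) (auto simp: highS_def)

lemma compat_dtens:
  assumes a: "is_bdiag r s a" and b: "is_bdiag k l b" and x: "x \<subseteq> {..<r + k}" and y: "y \<subseteq> {..<s + l}"
  shows "compat (dtens r s k l a b) x y \<longleftrightarrow>
    compat a (lowS r x) (lowS s y) \<and> compat b (highS r x) (highS s y)"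
proof -
  have lv: "v \<in> bverts r s" if "v \<in> lowS r x <+> lowS s y" for v
    using that by (auto simp: lowS_def)
  have hv: "v \<in> bverts k l" if "v \<in> highS r x <+> highS s y" for v
    using that highS_sub[OF x] highS_sub[OF y] by auto
  show ?thesis
  proof
    assume L: "compat (dtens r s k l a b) x y"
    have "a v \<in> lowS r x <+> lowS s y" if v: "v \<in> lowS r x <+> lowS s y" for v
      using L v lv[OF v] low_mem[of v r s x y] low_mem[of "a v" r s x y] dtens_low[OF lv[OF v], of k l a b]
      unfolding compat_def by (metis a bdiag_in)
    moreover have "b v \<in> highS r x <+> highS s y" if v: "v \<in> highS r x <+> highS s y" for v
      using L v high_mem[of r s v x y] high_mem[of r s "b v" x y] dtens_high[OF hv[OF v], of r s a b]
      unfolding compat_def by metis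
    ultimately show "compat a (lowS r x) (lowS s y) \<and> compat b (highS r x) (highS s y)"
      unfolding compat_def by blast
  next
    assume R: "compat a (lowS r x) (lowS s y) \<and> compat b (highS r x) (highS s y)"
    show "compat (dtens r s k l a b) x y" unfolding compat_def
    proof
      fix v assume v: "v \<in> x <+> y"
      then have "v \<in> bverts (r + k) (s + l)" using x y by auto
      then show "dtens r s k l a b v \<in> x <+> y"
      proof (cases rule: bverts_add_cases)
        case 1
        then show ?thesis using R v low_mem[OF 1, of x y] low_mem[of "a v" r s x y]
          by (simp add: dtens_low compat_def bdiag_in[OF a])
      next
        case (2 w)
        then show ?thesis using R v by (simp add: dtens_high compat_def high_mem)
      qed
    qed
  qed
qed

lemma bij_low_high: "bij_betw (\<lambda>z. (lowS s z, highS s z)) (Pow {..<s + l}) (Pow {..<s} \<times> Pow {..<l})"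
proof (rule bij_betw_byWitness[where f' = "\<lambda>(u, v). u \<union> (\<lambda>i. i + s) ` v"])
  show "\<forall>z \<in> Pow {..<s + l}. (case (lowS s z, highS s z) of (u, v) \<Rightarrow> u \<union> (\<lambda>i. i + s) ` v) = z"
  proof
    fix z assume "z \<in> Pow {..<s + l}"
    have "lowS s z \<union> (\<lambda>i. i + s) ` highS s z = z"
    proof (intro equalityI subsetI)
      fix i assume "i \<in> z"
      then show "i \<in> lowS s z \<union> (\<lambda>i. i + s) ` highS s z"
        by (cases "i < s") (auto simp: lowS_def highS_def intro!: image_eqI[of _ _ "i - s"])
    qed (auto simp: lowS_def highS_def)
    then show "(case (lowS s z, highS s z) of (u, v) \<Rightarrow> u \<union> (\<lambda>i. i + s) ` v) = z" by simp
  qed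
  show "\<forall>p \<in> Pow {..<s} \<times> Pow {..<l}. (lowS s (case p of (u, v) \<Rightarrow> u \<union> (\<lambda>i. i + s) ` v),
      highS s (case p of (u, v) \<Rightarrow> u \<union> (\<lambda>i. i + s) ` v)) = p"
    by (force simp: lowS_def highS_def)
  show "(\<lambda>z. (lowS s z, highS s z)) ` Pow {..<s + l} \<subseteq> Pow {..<s} \<times> Pow {..<l}"
    using highS_sub lowS_sub by blast
  show "(\<lambda>(u, v). u \<union> (\<lambda>i. i + s) ` v) ` (Pow {..<s} \<times> Pow {..<l}) \<subseteq> Pow {..<s + l}"
    by (fastforce simp: subset_iff)
qed

lemma wt_dtens:
  assumes "is_bdiag r s a" "is_bdiag k l b" "x \<subseteq> {..<r + k}" "y \<subseteq> {..<s + l}"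
  shows "wt (dtens r s k l a b) x y = wt a (lowS r x) (lowS s y) * wt b (highS r x) (highS s y)"
  by (simp add: wt_def compat_dtens[OF assms])

text \<open>A labelling of the juxtaposed middle row is a pair of labellings, so the sum in
  \<open>sum_wt\<close> factors into one sum for each column.\<close>

lemma dcomp_dtens:
  assumes a: "is_bdiag r s a" and b: "is_bdiag s t b" and a': "is_bdiag k l a'" and b': "is_bdiag l m b'"
  shows "dcomp (r + k) (s + l) (t + m) (dtens s t l m b b') (dtens r s k l a a')
      = dtens r t k m (dcomp r s t b a) (dcomp k l m b' a') \<and>
    loops (r + k) (s + l) (t + m) (dtens s t l m b b') (dtens r s k l a a')
      = loops r s t b a + loops k l m b' a'"
proof (rule wt_ext)
  note ba = bdiag_dcomp[OF a b] and ba' = bdiag_dcomp[OF a' b']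
    and aa = bdiag_dtens[OF a a'] and bb = bdiag_dtens[OF b b']
  show "is_bdiag (r + k) (t + m) (dcomp (r + k) (s + l) (t + m) (dtens s t l m b b') (dtens r s k l a a'))"
    by (rule bdiag_dcomp[OF aa bb])
  show "is_bdiag (r + k) (t + m) (dtens r t k m (dcomp r s t b a) (dcomp k l m b' a'))"
    by (rule bdiag_dtens[OF ba ba'])
  fix x y :: "nat set" assume x: "x \<subseteq> {..<r + k}" and y: "y \<subseteq> {..<t + m}"
  let ?f = "\<lambda>u v. (wt a (lowS r x) u * wt b u (lowS t y)) * (wt a' (highS r x) v * wt b' v (highS t y))"
  have "2 ^ loops (r + k) (s + l) (t + m) (dtens s t l m b b') (dtens r s k l a a') *
      wt (dcomp (r + k) (s + l) (t + m) (dtens s t l m b b') (dtens r s k l a a')) x y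
    = (\<Sum>z\<in>Pow {..<s + l}. wt (dtens r s k l a a') x z * wt (dtens s t l m b b') z y)"
    using sum_wt[OF aa bb x y] by simp
  also have "\<dots> = (\<Sum>z\<in>Pow {..<s + l}. case (lowS s z, highS s z) of (u, v) \<Rightarrow> ?f u v)"
    using x y a b a' b' by (intro sum.cong) (auto simp: wt_dtens ac_simps)
  also have "\<dots> = (\<Sum>(u, v)\<in>Pow {..<s} \<times> Pow {..<l}. ?f u v)"
    using sum.reindex_bij_betw[OF bij_low_high, of "\<lambda>(u, v). ?f u v" s l] .
  also have "\<dots> = (\<Sum>u\<in>Pow {..<s}. wt a (lowS r x) u * wt b u (lowS t y)) *
      (\<Sum>v\<in>Pow {..<l}. wt a' (highS r x) v * wt b' v (highS t y))"
    by (simp add: sum_product sum.cartesian_product)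
  also have "\<dots> = 2 ^ (loops r s t b a + loops k l m b' a') *
      wt (dtens r t k m (dcomp r s t b a) (dcomp k l m b' a')) x y"
    using sum_wt[OF a b, of "lowS r x" "lowS t y"] sum_wt[OF a' b' highS_sub[OF x] highS_sub[OF y]]
    by (simp add: wt_dtens[OF ba ba' x y] power_add ac_simps)
  finally show "2 ^ loops (r + k) (s + l) (t + m) (dtens s t l m b b') (dtens r s k l a a') *
      wt (dcomp (r + k) (s + l) (t + m) (dtens s t l m b b') (dtens r s k l a a')) x y
    = 2 ^ (loops r s t b a + loops k l m b' a') *
      wt (dtens r t k m (dcomp r s t b a) (dcomp k l m b' a')) x y" .
qed

lemma dtens_assoc:
  assumes "is_bdiag r s a" "is_bdiag k l b" "is_bdiag m n c"
  shows "dtens (r + k) (s + l) m n (dtens r s k l a b) c = dtens r s (k + m) (l + n) a (dtens k l m n b c)"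
proof
  fix v
  show "dtens (r + k) (s + l) m n (dtens r s k l a b) c v = dtens r s (k + m) (l + n) a (dtens k l m n b c) v"
  proof (cases "v \<in> bverts (r + k + m) (s + l + n)")
    case False
    then show ?thesis by (simp add: dtens_outside add.assoc)
  next
    case True
    then show ?thesis
    proof (cases rule: bverts_add_cases)
      case 1
      then show ?thesis
      proof (cases rule: bverts_add_cases)
        case 1
        then show ?thesis by (simp add: dtens_low bverts_low)
      next
        case (2 w)
        then have "w \<in> bverts (k + m) (l + n)" by (simp add: bverts_low)
        then show ?thesis using 1 2 by (simp add: dtens_low dtens_high)
      qed
    next
      case (2 w)
      then have *: "shiftv k l w \<in> bverts (k + m) (l + n)" by (simp add: shiftv_in)
      have "v = shiftv r s (shiftv k l w)" using 2 by (simp add: shiftv_shiftv)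
      then have "dtens r s (k + m) (l + n) a (dtens k l m n b c) v = shiftv r s (dtens k l m n b c (shiftv k l w))"
        using dtens_high[OF *] by simp
      then show ?thesis using 2 by (simp add: dtens_high shiftv_shiftv)
    qed
  qed
qed

lemma dtens_did: "dtens m m n n (did m) (did n) = did (m + n)"
proof
  fix v
  show "dtens m m n n (did m) (did n) v = did (m + n) v"
    by (cases v) (auto simp: dtens_def did_def)
qed

lemma dtens_0_right: "is_bdiag r s a \<Longrightarrow> dtens r s 0 0 a (did 0) = a"
proof
  fix v assume a: "is_bdiag r s a"
  show "dtens r s 0 0 a (did 0) v = a v"
    using bdiag_outside[OF a, of v] by (cases v) (auto simp: dtens_def)
qed

lemma dtens_0_left: "is_bdiag r s a \<Longrightarrow> dtens 0 0 r s (did 0) a = a"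
proof
  fix v assume a: "is_bdiag r s a"
  have sh: "shiftv 0 0 w = w" for w by (cases w) auto
  show "dtens 0 0 r s (did 0) a v = a v"
    using bdiag_outside[OF a, of v] by (cases v) (auto simp: dtens_def sh)
qed

lemma dtens_right_inj:
  assumes b: "is_bdiag k l b" and b': "is_bdiag k l b'" and eq: "dtens r s k l a b = dtens r s k l a b'"
  shows "b = b'"
proof
  fix v
  show "b v = b' v"
  proof (cases "v \<in> bverts k l")
    case True
    then have "shiftv r s (b v) = shiftv r s (b' v)" using eq dtens_high by metis
    then show ?thesis by (simp add: shiftv_inj)
  qed (simp add: bdiag_outside[OF b] bdiag_outside[OF b'])
qed

section \<open>Linear combinations of diagrams\<close>

lemma bmor_zero [simp]: "bmor r s (\<lambda>_. 0)" by (simp add: bmor_def)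

lemma bmor_sing [simp]: "is_bdiag r s d \<Longrightarrow> bmor r s (bsing d)"
  by (simp add: bmor_def bsing_def)

lemma bmor_lin: "bmor r s f \<Longrightarrow> bmor r s g \<Longrightarrow> bmor r s (\<lambda>e. c * f e + g e)"
proof -
  assume fg: "bmor r s f" "bmor r s g"
  have "is_bdiag r s e" if "c * f e + g e \<noteq> 0" for e
  proof -
    have "f e \<noteq> 0 \<or> g e \<noteq> 0" using that by auto
    then show ?thesis using fg unfolding bmor_def by blast
  qed
  then show ?thesis unfolding bmor_def by blast
qed

lemma bmor_induct [consumes 1, case_names zero sing lin]:
  fixes f :: "bdiag \<Rightarrow> 'k::comm_ring_1"
  assumes f: "bmor r s f" and zero: "P (\<lambda>_. 0)" and sing: "\<And>d. is_bdiag r s d \<Longrightarrow> P (bsing d)"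
    and lin: "\<And>c f g. bmor r s f \<Longrightarrow> P f \<Longrightarrow> bmor r s g \<Longrightarrow> P g \<Longrightarrow> P (\<lambda>e. c * f e + g e)"
  shows "P f"
proof -
  have "P (\<lambda>e. \<Sum>d\<in>F. f d * bsing d e) \<and> bmor r s (\<lambda>e. \<Sum>d\<in>F. f d * bsing d e)"
    if "finite F" "F \<subseteq> {d. is_bdiag r s d}" for F
    using that
  proof (induction F rule: finite_induct)
    case (insert d F)
    then show ?case
      using lin[of "bsing d" "\<lambda>e. \<Sum>d\<in>F. f d * bsing d e" "f d"]
        bmor_lin[of r s "bsing d" "\<lambda>e. \<Sum>d\<in>F. f d * bsing d e" "f d"] sing by simp
  qed (simp add: zero)
  then have "P (\<lambda>e. \<Sum>d\<in>{d. is_bdiag r s d}. f d * bsing d e)"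
    using finite_bdiags by blast
  moreover have "(\<lambda>e. \<Sum>d\<in>{d. is_bdiag r s d}. f d * bsing d e) = f"
  proof
    fix e
    have "(\<Sum>d\<in>{d. is_bdiag r s d}. f d * bsing d e) = (\<Sum>d\<in>{d. is_bdiag r s d}. if d = e then f e else 0)"
      by (intro sum.cong) (auto simp: bsing_def)
    then show "(\<Sum>d\<in>{d. is_bdiag r s d}. f d * bsing d e) = f e"
      using f by (auto simp: bmor_def)
  qed
  ultimately show ?thesis by simp
qed

lemma bcomp_zero [simp]: "bcomp \<delta> r s t (\<lambda>_. 0) f = (\<lambda>_. 0)" "bcomp \<delta> r s t g (\<lambda>_. 0) = (\<lambda>_. 0)"
  by (simp_all add: bcomp_def split_def)

lemma bcomp_lin:
  "bcomp \<delta> r s t (\<lambda>d. c * g d + g' d) f = (\<lambda>d. c * bcomp \<delta> r s t g f d + bcomp \<delta> r s t g' f d)"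
  "bcomp \<delta> r s t g (\<lambda>d. c * f d + f' d) = (\<lambda>d. c * bcomp \<delta> r s t g f d + bcomp \<delta> r s t g f' d)"
  unfolding bcomp_def split_def sum_distrib_left sum.distrib[symmetric]
  by (intro ext sum.cong refl, simp add: algebra_simps)+

lemma bcomp_scale:
  "bcomp \<delta> r s t (\<lambda>d. c * g d) f = (\<lambda>d. c * bcomp \<delta> r s t g f d)"
  "bcomp \<delta> r s t g (\<lambda>d. c * f d) = (\<lambda>d. c * bcomp \<delta> r s t g f d)"
  using bcomp_lin(1)[of \<delta> r s t c g "\<lambda>_. 0" f] bcomp_lin(2)[of \<delta> r s t g c f "\<lambda>_. 0"] by simp_all

lemma bcomp_diff:
  "bcomp \<delta> r s t (\<lambda>d. g d - g' d) f = (\<lambda>d. bcomp \<delta> r s t g f d - bcomp \<delta> r s t g' f d)"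
  "bcomp \<delta> r s t g (\<lambda>d. f d - f' d) = (\<lambda>d. bcomp \<delta> r s t g f d - bcomp \<delta> r s t g f' d)"
  using bcomp_lin(1)[of \<delta> r s t "- 1" g' g f] bcomp_lin(2)[of \<delta> r s t g "- 1" f' f] by simp_all

lemma bcomp_add:
  "bcomp \<delta> r s t (\<lambda>d. g d + g' d) f = (\<lambda>d. bcomp \<delta> r s t g f d + bcomp \<delta> r s t g' f d)"
  "bcomp \<delta> r s t g (\<lambda>d. f d + f' d) = (\<lambda>d. bcomp \<delta> r s t g f d + bcomp \<delta> r s t g f' d)"
  using bcomp_lin(1)[of \<delta> r s t 1 g g' f] bcomp_lin(2)[of \<delta> r s t g 1 f f'] by simp_all

lemma finite_bdiag_pairs: "finite {(a, b). is_bdiag r s a \<and> is_bdiag k l b \<and> Q a b}"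
  by (rule finite_subset[of _ "{a. is_bdiag r s a} \<times> {b. is_bdiag k l b}"]) auto

lemma bcomp_sing:
  assumes "is_bdiag r s a" "is_bdiag s t b"
  shows "bcomp \<delta> r s t (bsing b) (bsing a) = (\<lambda>d. \<delta> ^ loops r s t b a * bsing (dcomp r s t b a) d)"
proof
  fix d
  let ?S = "{(a, b). is_bdiag r s a \<and> is_bdiag s t b \<and> dcomp r s t b a = d}"
  have "bcomp \<delta> r s t (bsing b) (bsing a) d = (\<Sum>p\<in>?S. if p = (a, b) then \<delta> ^ loops r s t b a else 0)"
    unfolding bcomp_def by (intro sum.cong) (auto simp: bsing_def split: if_splits)
  also have "\<dots> = \<delta> ^ loops r s t b a * bsing (dcomp r s t b a) d"
    using assms by (subst sum.delta) (auto simp: bsing_def intro: finite_bdiag_pairs)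
  finally show "bcomp \<delta> r s t (bsing b) (bsing a) d = \<delta> ^ loops r s t b a * bsing (dcomp r s t b a) d" .
qed

lemma bmor_bcomp: "bmor r t (bcomp \<delta> r s t g f)"
  unfolding bmor_def
proof (intro allI impI)
  fix d assume "bcomp \<delta> r s t g f d \<noteq> 0"
  then obtain p where "p \<in> {(a, b). is_bdiag r s a \<and> is_bdiag s t b \<and> dcomp r s t b a = d}"
    unfolding bcomp_def by (rule sum.not_neutral_contains_not_neutral)
  then show "is_bdiag r t d" using bdiag_dcomp by auto
qed

lemma btens_zero [simp]: "btens r s k l (\<lambda>_. 0) g = (\<lambda>_. 0)" "btens r s k l f (\<lambda>_. 0) = (\<lambda>_. 0)"
  by (simp_all add: btens_def split_def)

lemma btens_lin:
  "btens r s k l (\<lambda>d. c * f d + f' d) g = (\<lambda>d. c * btens r s k l f g d + btens r s k l f' g d)"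
  "btens r s k l f (\<lambda>d. c * g d + g' d) = (\<lambda>d. c * btens r s k l f g d + btens r s k l f g' d)"
  unfolding btens_def split_def sum_distrib_left sum.distrib[symmetric]
  by (intro ext sum.cong refl, simp add: algebra_simps)+

lemma btens_scale:
  "btens r s k l (\<lambda>d. c * f d) g = (\<lambda>d. c * btens r s k l f g d)"
  "btens r s k l f (\<lambda>d. c * g d) = (\<lambda>d. c * btens r s k l f g d)"
  using btens_lin(1)[of r s k l c f "\<lambda>_. 0" g] btens_lin(2)[of r s k l f c g "\<lambda>_. 0"] by simp_all

lemma btens_diff:
  "btens r s k l (\<lambda>d. f d - f' d) g = (\<lambda>d. btens r s k l f g d - btens r s k l f' g d)"
  "btens r s k l f (\<lambda>d. g d - g' d) = (\<lambda>d. btens r s k l f g d - btens r s k l f g' d)"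
  using btens_lin(1)[of r s k l "- 1" f' f g] btens_lin(2)[of r s k l f "- 1" g' g] by simp_all

lemma btens_sing:
  assumes "is_bdiag r s a" "is_bdiag k l b"
  shows "btens r s k l (bsing a) (bsing b) = bsing (dtens r s k l a b)"
proof
  fix d
  let ?S = "{(a, b). is_bdiag r s a \<and> is_bdiag k l b \<and> dtens r s k l a b = d}"
  have "btens r s k l (bsing a) (bsing b) d = (\<Sum>p\<in>?S. if p = (a, b) then 1 else 0)"
    unfolding btens_def by (intro sum.cong) (auto simp: bsing_def split: if_splits)
  also have "\<dots> = bsing (dtens r s k l a b) d"
    using assms by (subst sum.delta) (auto simp: bsing_def intro: finite_bdiag_pairs)
  finally show "btens r s k l (bsing a) (bsing b) d = bsing (dtens r s k l a b) d" .
qed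

lemma bmor_btens: "bmor (r + k) (s + l) (btens r s k l f g)"
  unfolding bmor_def
proof (intro allI impI)
  fix d assume "btens r s k l f g d \<noteq> 0"
  then obtain p where "p \<in> {(a, b). is_bdiag r s a \<and> is_bdiag k l b \<and> dtens r s k l a b = d}"
    unfolding btens_def by (rule sum.not_neutral_contains_not_neutral)
  then show "is_bdiag (r + k) (s + l) d" using bdiag_dtens by auto
qed

lemma bmor_bid [simp]: "bmor n n (bid n)" by (simp add: bid_def)

lemma bcomp_assoc:
  assumes "bmor r s f" "bmor s t g" "bmor t u h"
  shows "bcomp \<delta> r t u h (bcomp \<delta> r s t g f) = bcomp \<delta> r s u (bcomp \<delta> s t u h g) f"
  using assms(1)
proof (induction f rule: bmor_induct)
  case (sing a)
  show ?case using assms(2)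
  proof (induction g rule: bmor_induct)
    case (sing b)
    show ?case using assms(3)
    proof (induction h rule: bmor_induct)
      case (sing c)
      note abc = \<open>is_bdiag r s a\<close> \<open>is_bdiag s t b\<close> \<open>is_bdiag t u c\<close>
      show ?case
        using abc dcomp_loops_assoc[OF abc] bdiag_dcomp[OF abc(1,2)] bdiag_dcomp[OF abc(2,3)]
        by (simp add: bcomp_sing bcomp_scale mult.assoc[symmetric] power_add[symmetric])
    qed (simp_all add: bcomp_lin)
  qed (simp_all add: bcomp_lin)
qed (simp_all add: bcomp_lin)

lemma bcomp_bid_right: "bmor r s f \<Longrightarrow> bcomp \<delta> r r s f (bid r) = f"
  by (induction f rule: bmor_induct) (simp_all add: bcomp_lin bid_def bcomp_sing dcomp_did_right)

lemma bcomp_bid_left: "bmor r s f \<Longrightarrow> bcomp \<delta> r s s (bid s) f = f"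
  by (induction f rule: bmor_induct) (simp_all add: bcomp_lin bid_def bcomp_sing dcomp_did_left)

lemma bcomp_btens:
  assumes "bmor r s f" "bmor s t g" "bmor k l f'" "bmor l m g'"
  shows "bcomp \<delta> (r + k) (s + l) (t + m) (btens s t l m g g') (btens r s k l f f')
    = btens r t k m (bcomp \<delta> r s t g f) (bcomp \<delta> k l m g' f')"
  using assms(1)
proof (induction f rule: bmor_induct)
  case (sing a)
  show ?case using assms(2)
  proof (induction g rule: bmor_induct)
    case (sing b)
    show ?case using assms(3)
    proof (induction f' rule: bmor_induct)
      case (sing a')
      show ?case using assms(4)
      proof (induction g' rule: bmor_induct)
        case (sing b')
        note D = \<open>is_bdiag r s a\<close> \<open>is_bdiag s t b\<close> \<open>is_bdiag k l a'\<close> \<open>is_bdiag l m b'\<close>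
        show ?case
          using D dcomp_dtens[OF D] bdiag_dcomp[OF D(1,2)] bdiag_dcomp[OF D(3,4)]
            bdiag_dtens[OF D(1,3)] bdiag_dtens[OF D(2,4)]
          by (simp add: bcomp_sing btens_sing btens_scale power_add mult.assoc)
      qed (simp_all add: bcomp_lin btens_lin)
    qed (simp_all add: bcomp_lin btens_lin)
  qed (simp_all add: bcomp_lin btens_lin)
qed (simp_all add: bcomp_lin btens_lin)

lemma btens_assoc:
  assumes "bmor r s f" "bmor k l g" "bmor m n h"
  shows "btens (r + k) (s + l) m n (btens r s k l f g) h = btens r s (k + m) (l + n) f (btens k l m n g h)"
  using assms(1)
proof (induction f rule: bmor_induct)
  case (sing a)
  show ?case using assms(2)
  proof (induction g rule: bmor_induct)
    case (sing b)
    show ?case using assms(3)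
    proof (induction h rule: bmor_induct)
      case (sing c)
      note D = \<open>is_bdiag r s a\<close> \<open>is_bdiag k l b\<close> \<open>is_bdiag m n c\<close>
      show ?case
        using D dtens_assoc[OF D] bdiag_dtens[OF D(1,2)] bdiag_dtens[OF D(2,3)]
        by (simp add: btens_sing)
    qed (simp_all add: btens_lin)
  qed (simp_all add: btens_lin)
qed (simp_all add: btens_lin)

lemma btens_bid: "btens m m n n (bid m) (bid n) = bid (m + n)"
  by (simp add: bid_def btens_sing dtens_did)

lemma btens_bid0: "bmor r s f \<Longrightarrow> btens r s 0 0 f (bid 0) = f"
  by (induction f rule: bmor_induct) (simp_all add: btens_lin bid_def btens_sing dtens_0_right)

text \<open>Juxtaposition with \<open>did n\<close> is injective on diagrams, so every coefficient
  of \<open>f\<close> reappears unmixed as a coefficient of the product. For \<open>n = 1\<close>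
  this shows that \<open>A\<close> can be recovered from the image of \<open>I_0 \<otimes> A\<close>
  under \<open>varpi\<close>.\<close>

lemma btens_bid_cancel:
  assumes f: "bmor k l f" and eq: "btens n n k l (bid n) f = (\<lambda>_. 0)"
  shows "f = (\<lambda>_. 0)"
proof
  fix b
  show "f b = 0"
  proof (cases "is_bdiag k l b")
    case True
    let ?S = "{(a', b'). is_bdiag n n a' \<and> is_bdiag k l b' \<and> dtens n n k l a' b' = dtens n n k l (did n) b}"
    have "btens n n k l (bid n) f (dtens n n k l (did n) b) = (\<Sum>p\<in>?S. if p = (did n, b) then f b else 0)"
      unfolding btens_def bid_def by (intro sum.cong) (use True in \<open>auto simp: bsing_def split: if_splits dest: dtens_right_inj\<close>)
    also have "\<dots> = f b"
      using True by (subst sum.delta) (auto intro: finite_bdiag_pairs)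
    finally show ?thesis using eq by simp
  qed (use f in \<open>auto simp: bmor_def\<close>)
qed

section \<open>The four-term and skew symmetry relations in the Brauer category\<close>

text \<open>A finite test for loop-free products: the solvable outer labellings determine the
  composite, and a closed loop would give the empty outer labelling a second extension.\<close>

lemma dcomp_eqI:
  assumes a: "is_bdiag r s a" and b: "is_bdiag s t b" and d: "is_bdiag r t d"
    and ex: "\<And>x y. x \<subseteq> {..<r} \<Longrightarrow> y \<subseteq> {..<t} \<Longrightarrow>
      compat d x y \<longleftrightarrow> (\<exists>z\<in>Pow {..<s}. compat a x z \<and> compat b z y)"
    and uni: "\<forall>z\<in>Pow {..<s}. compat a {} z \<and> compat b z {} \<longrightarrow> z = {}"
  shows "dcomp r s t b a = d \<and> loops r s t b a = 0"
proof
  show "dcomp r s t b a = d"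
  proof (rule bdiag_ext[OF bdiag_dcomp[OF a b] d])
    fix x y :: "nat set" assume x: "x \<subseteq> {..<r}" and y: "y \<subseteq> {..<t}" and c: "compat (dcomp r s t b a) x y"
    then have "card {z. z \<subseteq> {..<s} \<and> compat a x z \<and> compat b z y} \<noteq> 0"
      using card_compat_mid[OF a b x y] by simp
    then have "{z. z \<subseteq> {..<s} \<and> compat a x z \<and> compat b z y} \<noteq> {}" by (metis card.empty)
    then show "compat d x y" using ex[OF x y] by blast
  qed
  have "compat e {} {}" for e by (auto simp: compat_def)
  then have "{z. z \<subseteq> {..<s} \<and> compat a {} z \<and> compat b z {}} = {{}}" using uni by auto
  \<comment> \<open>The absurd second disjunct comes from the \<open>else\<close> branch in
    \<open>card_compat_mid\<close>.\<close>
  then have "(2::nat) ^ loops r s t b a = 1 \<or> 1 = (0::nat)"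
    using card_compat_mid[OF a b, of "{}" "{}"] by (simp split: if_splits)
  then show "loops r s t b a = 0" by simp
qed

text \<open>An involution mapping the coloured vertices into themselves does the same with the
  others, so memberships can be compared vertex by vertex. For concrete \<open>r\<close> and
  \<open>s\<close> this is a finite conjunction.\<close>

lemma compat_iff:
  assumes d: "is_bdiag r s d" and "x \<subseteq> {..<r}" "y \<subseteq> {..<s}"
  shows "compat d x y \<longleftrightarrow> (\<forall>i<r. i \<in> x \<longleftrightarrow> d (Inl i) \<in> x <+> y) \<and> (\<forall>j<s. j \<in> y \<longleftrightarrow> d (Inr j) \<in> x <+> y)"
proof -
  have "compat d x y \<longleftrightarrow> (\<forall>v. v \<in> x <+> y \<longleftrightarrow> d v \<in> x <+> y)"
    unfolding compat_def using bdiag_invol[OF d] by metis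
  also have "\<dots> \<longleftrightarrow> (\<forall>v\<in>bverts r s. v \<in> x <+> y \<longleftrightarrow> d v \<in> x <+> y)"
    using bdiag_outside[OF d] by metis
  also have "\<dots> \<longleftrightarrow> (\<forall>i<r. i \<in> x \<longleftrightarrow> d (Inl i) \<in> x <+> y) \<and> (\<forall>j<s. j \<in> y \<longleftrightarrow> d (Inr j) \<in> x <+> y)"
    by (auto simp: bverts_def)
  finally show ?thesis .
qed

text \<open>The cup on top of the cap as a single diagram, so that \<open>bH\<close> becomes a
  difference of two basis elements.\<close>

definition dE :: bdiag where "dE = dswap (Inl 0) (Inl 1) \<circ> dswap (Inr 0) (Inr 1)"

lemma all_less_num: "(\<forall>i<Suc n. P i) \<longleftrightarrow> P n \<and> (\<forall>i<n. P i)" "(\<forall>i<0::nat. Q i)"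
  by (auto simp: less_Suc_eq)

lemma lessThan_num: "{..<4::nat} = {0, 1, 2, 3}" "{..<3::nat} = {0, 1, 2}" "{..<2::nat} = {0, 1}"
  "{..<1::nat} = {0}"
  by auto

lemma bdiagI:
  assumes "\<forall>i<r. d (Inl i) \<in> bverts r s \<and> d (Inl i) \<noteq> Inl i \<and> d (d (Inl i)) = Inl i"
    "\<forall>j<s. d (Inr j) \<in> bverts r s \<and> d (Inr j) \<noteq> Inr j \<and> d (d (Inr j)) = Inr j"
    "\<And>i. r \<le> i \<Longrightarrow> d (Inl i) = Inl i" "\<And>j. s \<le> j \<Longrightarrow> d (Inr j) = Inr j"
  shows "is_bdiag r s d"
  unfolding is_bdiag_def
proof (intro conjI ballI allI impI)
  fix v assume "v \<in> bverts r s"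
  then show "d v \<in> bverts r s" "d v \<noteq> v" "d (d v) = v" using assms(1,2) by (cases v; simp)+
next
  fix v assume "v \<notin> bverts r s"
  then show "d v = v" using assms(3,4) by (cases v) simp_all
qed

lemma bdiag_dX: "is_bdiag 2 2 dX" and bdiag_dE: "is_bdiag 2 2 dE"
  and bdiag_dcap: "is_bdiag 2 0 dcap" and bdiag_dcup: "is_bdiag 0 2 dcup"
  by (rule bdiagI; simp add: dX_def dE_def dcap_def dcup_def dswap_def all_less_num numeral_2_eq_2)+

lemma dcomp_cup_cap: "dcomp 2 0 2 dcup dcap = dE \<and> loops 2 0 2 dcup dcap = 0"
proof (rule dcomp_eqI[OF bdiag_dcap bdiag_dcup bdiag_dE])
  fix x y :: "nat set" assume xy: "x \<subseteq> {..<2}" "y \<subseteq> {..<2}"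
  have "(\<exists>z\<in>Pow {..<0}. compat dcap x z \<and> compat dcup z y) \<longleftrightarrow> compat dcap x {} \<and> compat dcup {} y"
    by simp
  then show "compat dE x y \<longleftrightarrow> (\<exists>z\<in>Pow {..<0}. compat dcap x z \<and> compat dcup z y)"
    unfolding compat_iff[OF bdiag_dE xy] compat_iff[OF bdiag_dcap xy(1) empty_subsetI]
      compat_iff[OF bdiag_dcup empty_subsetI xy(2)]
    by (auto simp: all_less_num numeral_2_eq_2 dE_def dcap_def dcup_def dswap_def)
qed simp

lemma bH_eq: "bH \<delta> = (\<lambda>d. bsing dX d - bsing dE d)"
  by (simp add: bH_def bX_def bcup_def bcap_def bcomp_sing[OF bdiag_dcap bdiag_dcup] dcomp_cup_cap)

lemma bmor_diff: "bmor r s f \<Longrightarrow> bmor r s g \<Longrightarrow> bmor r s (\<lambda>d. f d - g d)"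
  using bmor_lin[of r s g f "- 1"] by simp

lemma bmor_bH: "bmor 2 2 (bH \<delta>)"
  by (simp add: bH_eq bmor_diff bdiag_dX bdiag_dE)

section \<open>Diagrams given by lists of strings\<close>

definition pairing :: "(bv \<times> bv) list \<Rightarrow> bdiag" where
  "pairing ps = foldr (\<lambda>(p, q) d. dswap p q \<circ> d) ps id"

definition ends :: "(bv \<times> bv) list \<Rightarrow> bv list" where
  "ends ps = concat (map (\<lambda>(p, q). [p, q]) ps)"

text \<open>Admissibility for the diagram with these strings (\<open>compat_pairing\<close>), as a
  propositional formula in the memberships of finitely many vertices. Concrete products can then be
  checked by enumeration.\<close>

definition balanced :: "(bv \<times> bv) list \<Rightarrow> nat set \<Rightarrow> nat set \<Rightarrow> bool" where
  "balanced ps x y \<longleftrightarrow> (\<forall>(p, q) \<in> set ps. p \<in> x <+> y \<longleftrightarrow> q \<in> x <+> y)"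

lemma ends_simps [simp]: "ends [] = []" "ends ((p, q) # ps) = p # q # ends ps"
  by (simp_all add: ends_def)

lemma pairing_Cons: "pairing ((p, q) # ps) = dswap p q \<circ> pairing ps"
  by (simp add: pairing_def)

lemma ends_mem: "(p, q) \<in> set ps \<Longrightarrow> p \<in> set (ends ps) \<and> q \<in> set (ends ps)"
  by (induction ps) auto

lemma ends_cases: "v \<in> set (ends ps) \<Longrightarrow> \<exists>w. (v, w) \<in> set ps \<or> (w, v) \<in> set ps"
  by (auto simp: ends_def)

lemma pairing_outside: "v \<notin> set (ends ps) \<Longrightarrow> pairing ps v = v"
proof (induction ps)
  case Nil
  then show ?case by (simp add: pairing_def)
next
  case (Cons a ps)
  then show ?case by (cases a) (simp add: pairing_Cons dswap_def)
qed

lemma pairing_eq: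
  "distinct (ends ps) \<Longrightarrow> (p, q) \<in> set ps \<Longrightarrow> pairing ps p = q \<and> pairing ps q = p \<and> p \<noteq> q"
proof (induction ps)
  case (Cons a ps)
  obtain u v where a: "a = (u, v)" by force
  show ?case
  proof (cases "(p, q) = (u, v)")
    case True
    then show ?thesis using Cons.prems a by (auto simp: pairing_Cons pairing_outside dswap_def)
  next
    case False
    then have "(p, q) \<in> set ps" using Cons.prems a by auto
    then show ?thesis
      using Cons.IH Cons.prems a ends_mem[of p q ps] by (auto simp: pairing_Cons dswap_def)
  qed
qed simp

lemma bdiag_pairing:
  assumes "distinct (ends ps)" "set (ends ps) = bverts r s"
  shows "is_bdiag r s (pairing ps)"
  unfolding is_bdiag_def
proof (intro conjI ballI allI impI)
  fix v assume v: "v \<in> bverts r s"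
  then obtain w where w: "(v, w) \<in> set ps \<or> (w, v) \<in> set ps" using ends_cases assms(2) by metis
  then have "w \<in> bverts r s" using ends_mem assms(2) by blast
  then show "pairing ps v \<in> bverts r s" "pairing ps v \<noteq> v" "pairing ps (pairing ps v) = v"
    using pairing_eq[OF assms(1), of v w] pairing_eq[OF assms(1), of w v] w by metis+
qed (use assms(2) pairing_outside in auto)

lemma bdiag_eq_pairing:
  assumes d: "is_bdiag r s d" and ps: "distinct (ends ps)" "set (ends ps) = bverts r s"
    and eq: "\<forall>(p, q) \<in> set ps. d p = q"
  shows "d = pairing ps"
proof
  fix v
  show "d v = pairing ps v"
  proof (cases "v \<in> bverts r s")
    case True
    then obtain w where w: "(v, w) \<in> set ps \<or> (w, v) \<in> set ps" using ends_cases ps(2) by metis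
    then show ?thesis
      using pairing_eq[OF ps(1)] eq bdiag_invol[OF d, of w] by auto
  qed (use ps(2) pairing_outside bdiag_outside[OF d] in auto)
qed

lemma compat_pairing:
  assumes ps: "distinct (ends ps)"
  shows "compat (pairing ps) x y \<longleftrightarrow> balanced ps x y"
proof
  assume "compat (pairing ps) x y"
  then have c: "v \<in> x <+> y \<Longrightarrow> pairing ps v \<in> x <+> y" for v
    unfolding compat_def by (rule bspec)
  have "p \<in> x <+> y \<longleftrightarrow> q \<in> x <+> y" if "(p, q) \<in> set ps" for p q
  proof -
    have "pairing ps p = q" "pairing ps q = p" using pairing_eq[OF ps that] by auto
    then show ?thesis using c[of p] c[of q] by (simp only:) blast
  qed
  then show "balanced ps x y" unfolding balanced_def by blast
next
  assume b: "balanced ps x y"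
  have bal: "p \<in> x <+> y \<longleftrightarrow> q \<in> x <+> y" if "(p, q) \<in> set ps" for p q
    using bspec[OF b[unfolded balanced_def] that] by simp
  show "compat (pairing ps) x y" unfolding compat_def
  proof
    fix v assume v: "v \<in> x <+> y"
    show "pairing ps v \<in> x <+> y"
    proof (cases "v \<in> set (ends ps)")
      case True
      then obtain w where w: "(v, w) \<in> set ps \<or> (w, v) \<in> set ps" using ends_cases by metis
      have "w \<in> x <+> y" using w bal[of v w] bal[of w v] v by (elim disjE) simp_all
      moreover have "pairing ps v = w" using w pairing_eq[OF ps, of v w] pairing_eq[OF ps, of w v] by (elim disjE) simp_all
      ultimately show ?thesis by (simp only:)
    qed (use v pairing_outside in auto)
  qed
qed

text \<open>Only loop-free products are needed for the four-term relation and skew symmetry, so the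
  result is a single diagram and no power of \<delta> appears.\<close>

lemma dcomp_pairing:
  assumes ps: "distinct (ends ps)" "set (ends ps) = bverts r s"
    and qs: "distinct (ends qs)" "set (ends qs) = bverts s t"
    and us: "distinct (ends us)" "set (ends us) = bverts r t"
    and ex: "\<And>x y. balanced us x y \<longleftrightarrow> (\<exists>z\<in>Pow {..<s}. balanced ps x z \<and> balanced qs z y)"
    and uni: "\<forall>z\<in>Pow {..<s}. balanced ps {} z \<and> balanced qs z {} \<longrightarrow> z = {}"
  shows "bcomp \<delta> r s t (bsing (pairing qs)) (bsing (pairing ps)) = bsing (pairing us)"
proof -
  note P = bdiag_pairing[OF ps] and Q = bdiag_pairing[OF qs] and U = bdiag_pairing[OF us]
  have "dcomp r s t (pairing qs) (pairing ps) = pairing us \<and> loops r s t (pairing qs) (pairing ps) = 0"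
    by (rule dcomp_eqI[OF P Q U]) (use ex uni in \<open>simp_all add: compat_pairing ps qs us\<close>)
  then show ?thesis by (simp add: bcomp_sing[OF P Q])
qed

lemma balanced_simps [simp]:
  "balanced [] x y \<longleftrightarrow> True"
  "balanced ((p, q) # ps) x y \<longleftrightarrow> (p \<in> x <+> y \<longleftrightarrow> q \<in> x <+> y) \<and> balanced ps x y"
  by (auto simp: balanced_def)

lemma Plus_mem: "Inl i \<in> x <+> y \<longleftrightarrow> i \<in> x" "Inr j \<in> x <+> y \<longleftrightarrow> j \<in> y"
  by auto

lemma bex_Pow_Suc: "(\<exists>z\<in>Pow {..<Suc n}. P z) \<longleftrightarrow> (\<exists>z\<in>Pow {..<n}. P z \<or> P (insert n z))"
  unfolding lessThan_Suc Pow_insert by blast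

lemma ball_Pow_Suc: "(\<forall>z\<in>Pow {..<Suc n}. P z) \<longleftrightarrow> (\<forall>z\<in>Pow {..<n}. P z \<and> P (insert n z))"
  unfolding lessThan_Suc Pow_insert by blast

text \<open>The middle rows in the product tables below have three or four vertices; the quantifiers
  over their labellings are unfolded here.\<close>

lemma Pow_numeral:
  fixes P :: "nat set \<Rightarrow> bool"
  shows "(\<exists>z\<in>Pow {..<4}. P z) \<longleftrightarrow> (\<exists>z\<in>Pow {..<3}. P z \<or> P (insert 3 z))"
  "(\<exists>z\<in>Pow {..<3}. P z) \<longleftrightarrow> (\<exists>z\<in>Pow {..<2}. P z \<or> P (insert 2 z))"
  "(\<exists>z\<in>Pow {..<2}. P z) \<longleftrightarrow> P {} \<or> P {0} \<or> P {1} \<or> P {1, 0}"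
  "(\<forall>z\<in>Pow {..<4}. P z) \<longleftrightarrow> (\<forall>z\<in>Pow {..<3}. P z \<and> P (insert 3 z))"
  "(\<forall>z\<in>Pow {..<3}. P z) \<longleftrightarrow> (\<forall>z\<in>Pow {..<2}. P z \<and> P (insert 2 z))"
  "(\<forall>z\<in>Pow {..<2}. P z) \<longleftrightarrow> P {} \<and> P {0} \<and> P {1} \<and> P {1, 0}"
proof -
  have *: "Pow {..<2::nat} = {{}, {0}, {1}, {1, 0}}"
    unfolding lessThan_num by (auto simp: Pow_insert)
  show "(\<exists>z\<in>Pow {..<2}. P z) \<longleftrightarrow> P {} \<or> P {0} \<or> P {1} \<or> P {1, 0}"
    "(\<forall>z\<in>Pow {..<2}. P z) \<longleftrightarrow> P {} \<and> P {0} \<and> P {1} \<and> P {1, 0}"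
    unfolding * by simp_all
qed (use bex_Pow_Suc[of 3 P] bex_Pow_Suc[of 2 P] ball_Pow_Suc[of 3 P] ball_Pow_Suc[of 2 P] in
    \<open>simp_all only: Suc_numeral add_num_simps\<close>)

lemma bverts_numeral:
  "bverts 1 1 = {Inl 0, Inr 0}"
  "bverts 2 2 = {Inl 0, Inl 1, Inr 0, Inr 1}"
  "bverts 3 3 = {Inl 0, Inl 1, Inl 2, Inr 0, Inr 1, Inr 2}"
  "bverts 2 4 = {Inl 0, Inl 1, Inr 0, Inr 1, Inr 2, Inr 3}"
  "bverts 4 2 = {Inl 0, Inl 1, Inl 2, Inl 3, Inr 0, Inr 1}"
  "bverts 4 4 = {Inl 0, Inl 1, Inl 2, Inl 3, Inr 0, Inr 1, Inr 2, Inr 3}"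
  "bverts 3 1 = {Inl 0, Inl 1, Inl 2, Inr 0}"
  "bverts 1 3 = {Inl 0, Inr 0, Inr 1, Inr 2}"
  "bverts 2 0 = {Inl 0, Inl 1}"
  "bverts 0 2 = {Inr 0, Inr 1}"
  by (auto simp: bverts_def lessThan_num)

lemma pairing_id: "did 1 = pairing [(Inl 0, Inr 0)]"
  and pairing_X: "dX = pairing [(Inl 0, Inr 1), (Inl 1, Inr 0)]"
  and pairing_E: "dE = pairing [(Inl 0, Inl 1), (Inr 0, Inr 1)]"
  and pairing_cap: "dcap = pairing [(Inl 0, Inl 1)]"
  and pairing_cup: "dcup = pairing [(Inr 0, Inr 1)]"
proof -
  show "did 1 = pairing [(Inl 0, Inr 0)]"
    by (rule bdiag_eq_pairing[OF bdiag_did]) (simp_all add: bverts_numeral[unfolded One_nat_def] did_def)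
qed (auto simp: pairing_def dX_def dE_def dcap_def dcup_def dswap_def fun_eq_iff)

definition shift_pairs :: "nat \<Rightarrow> nat \<Rightarrow> (bv \<times> bv) list \<Rightarrow> (bv \<times> bv) list" where
  "shift_pairs r s ps = map (\<lambda>(p, q). (shiftv r s p, shiftv r s q)) ps"

lemma shift_pairs_simps [simp]: "shift_pairs r s [] = []"
  "shift_pairs r s ((p, q) # ps) = (shiftv r s p, shiftv r s q) # shift_pairs r s ps"
  by (simp_all add: shift_pairs_def)

lemma set_ends_shift: "set (ends (shift_pairs r s ps)) = shiftv r s ` set (ends ps)"
  by (induction ps) (auto simp: shift_pairs_def)

lemma ends_append [simp]: "ends (ps @ qs) = ends ps @ ends qs"
  by (simp add: ends_def)

lemma dtens_pairing:
  assumes ps: "distinct (ends ps)" "set (ends ps) = bverts r s"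
    and qs: "distinct (ends qs)" "set (ends qs) = bverts k l"
  shows "btens r s k l (bsing (pairing ps)) (bsing (pairing qs)) = bsing (pairing (ps @ shift_pairs r s qs))"
proof -
  note P = bdiag_pairing[OF ps] and Q = bdiag_pairing[OF qs]
  have "distinct (ends (shift_pairs r s qs))"
    using qs(1)
  proof (induction qs)
    case (Cons a qs)
    then show ?case by (cases a) (auto simp: shiftv_inj set_ends_shift)
  qed simp
  then have 1: "distinct (ends (ps @ shift_pairs r s qs))"
    using ps shiftv_notin by (auto simp: set_ends_shift)
  have "bverts (r + k) (s + l) = bverts r s \<union> shiftv r s ` bverts k l"
  proof (intro equalityI subsetI)
    fix v assume "v \<in> bverts (r + k) (s + l)"
    then show "v \<in> bverts r s \<union> shiftv r s ` bverts k l" by (cases rule: bverts_add_cases) auto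
  qed (auto simp: bverts_low shiftv_in)
  then have 2: "set (ends (ps @ shift_pairs r s qs)) = bverts (r + k) (s + l)"
    using ps qs by (simp add: set_ends_shift)
  have 3: "dtens r s k l (pairing ps) (pairing qs) p = q" if "(p, q) \<in> set (ps @ shift_pairs r s qs)" for p q
  proof -
    consider "(p, q) \<in> set ps" | p' q' where "(p', q') \<in> set qs" "p = shiftv r s p'" "q = shiftv r s q'"
      using \<open>(p, q) \<in> set (ps @ shift_pairs r s qs)\<close> unfolding shift_pairs_def by auto
    then show ?thesis
    proof cases
      case 1
      then show ?thesis using pairing_eq[OF ps(1)] ends_mem[of p q ps] ps(2) dtens_low by metis
    next
      case 2
      then show ?thesis using pairing_eq[OF qs(1)] ends_mem[of p' q' qs] qs(2) dtens_high by metis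
    qed
  qed
  have "dtens r s k l (pairing ps) (pairing qs) = pairing (ps @ shift_pairs r s qs)"
    by (rule bdiag_eq_pairing[OF bdiag_dtens[OF P Q] 1 2]) (use 3 in blast)
  then show ?thesis by (simp add: btens_sing[OF P Q])
qed

text \<open>Diagrams on three strands: \<open>ds\<close> is the crossing and \<open>de\<close> the cup-cap on the strands with the
given numbers, and \<open>dm1\<close>, ..., \<open>dm8\<close> are the products that occur in the four-term relation.\<close>

definition ds12 :: bdiag where "ds12 = pairing [(Inl 0, Inr 1), (Inl 1, Inr 0), (Inl 2, Inr 2)]"
definition de12 :: bdiag where "de12 = pairing [(Inl 0, Inl 1), (Inr 0, Inr 1), (Inl 2, Inr 2)]"
definition ds23 :: bdiag where "ds23 = pairing [(Inl 0, Inr 0), (Inl 1, Inr 2), (Inl 2, Inr 1)]"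
definition de23 :: bdiag where "de23 = pairing [(Inl 0, Inr 0), (Inl 1, Inl 2), (Inr 1, Inr 2)]"
definition ds13 :: bdiag where "ds13 = pairing [(Inl 0, Inr 2), (Inl 1, Inr 1), (Inl 2, Inr 0)]"
definition de13 :: bdiag where "de13 = pairing [(Inl 0, Inl 2), (Inl 1, Inr 1), (Inr 0, Inr 2)]"
definition dm1 :: bdiag where "dm1 = pairing [(Inl 0, Inr 2), (Inl 1, Inr 0), (Inl 2, Inr 1)]"
definition dm2 :: bdiag where "dm2 = pairing [(Inl 0, Inr 1), (Inl 1, Inr 2), (Inl 2, Inr 0)]"
definition dm3 :: bdiag where "dm3 = pairing [(Inl 0, Inl 2), (Inr 1, Inr 2), (Inl 1, Inr 0)]"
definition dm4 :: bdiag where "dm4 = pairing [(Inl 1, Inl 2), (Inr 0, Inr 2), (Inl 0, Inr 1)]"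
definition dm5 :: bdiag where "dm5 = pairing [(Inl 1, Inl 2), (Inr 0, Inr 1), (Inl 0, Inr 2)]"
definition dm6 :: bdiag where "dm6 = pairing [(Inl 0, Inl 2), (Inl 1, Inr 2), (Inr 0, Inr 1)]"
definition dm7 :: bdiag where "dm7 = pairing [(Inl 0, Inl 1), (Inr 1, Inr 2), (Inl 2, Inr 0)]"
definition dm8 :: bdiag where "dm8 = pairing [(Inl 0, Inl 1), (Inr 0, Inr 2), (Inl 2, Inr 1)]"

lemmas strand_defs = ds12_def de12_def ds23_def de23_def ds13_def de13_def dm1_def dm2_def dm3_def dm4_def dm5_def dm6_def dm7_def dm8_def

text \<open>The eighteen products in the three tables close no loop, so each is the same single
  diagram for every \<delta>.\<close>

lemma bcomp3_a:
  "bcomp \<delta> 3 3 3 (bsing ds12) (bsing ds23) = bsing dm2"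
  "bcomp \<delta> 3 3 3 (bsing ds23) (bsing dm2) = bsing ds13"
  "bcomp \<delta> 3 3 3 (bsing de12) (bsing ds23) = bsing dm6"
  "bcomp \<delta> 3 3 3 (bsing ds23) (bsing dm6) = bsing de13"
  "bcomp \<delta> 3 3 3 (bsing ds12) (bsing ds13) = bsing dm1"
  "bcomp \<delta> 3 3 3 (bsing ds12) (bsing de13) = bsing dm3"
  unfolding strand_defs
  by (rule dcomp_pairing; simp add: bverts_numeral Pow_numeral Plus_mem; (auto)?)+

lemma bcomp3_b:
  "bcomp \<delta> 3 3 3 (bsing ds12) (bsing de23) = bsing dm4"
  "bcomp \<delta> 3 3 3 (bsing de12) (bsing ds13) = bsing dm5"
  "bcomp \<delta> 3 3 3 (bsing de12) (bsing de13) = bsing dm6"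
  "bcomp \<delta> 3 3 3 (bsing de12) (bsing de23) = bsing dm5"
  "bcomp \<delta> 3 3 3 (bsing ds13) (bsing ds12) = bsing dm2"
  "bcomp \<delta> 3 3 3 (bsing de13) (bsing ds12) = bsing dm4"
  unfolding strand_defs
  by (rule dcomp_pairing; simp add: bverts_numeral Pow_numeral Plus_mem; (auto)?)+

lemma bcomp3_c:
  "bcomp \<delta> 3 3 3 (bsing ds23) (bsing ds12) = bsing dm1"
  "bcomp \<delta> 3 3 3 (bsing de23) (bsing ds12) = bsing dm3"
  "bcomp \<delta> 3 3 3 (bsing ds13) (bsing de12) = bsing dm7"
  "bcomp \<delta> 3 3 3 (bsing de13) (bsing de12) = bsing dm8"
  "bcomp \<delta> 3 3 3 (bsing ds23) (bsing de12) = bsing dm8"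
  "bcomp \<delta> 3 3 3 (bsing de23) (bsing de12) = bsing dm7"
  unfolding strand_defs
  by (rule dcomp_pairing; simp add: bverts_numeral Pow_numeral Plus_mem; (auto)?)+

lemmas bcomp3 = bcomp3_a bcomp3_b bcomp3_c

lemma strands3:
  "btens 2 2 1 1 (bsing dX) bI = bsing ds12" "btens 2 2 1 1 (bsing dE) bI = bsing de12"
  "btens 1 1 2 2 bI (bsing dX) = bsing ds23" "btens 1 1 2 2 bI (bsing dE) = bsing de23"
  unfolding bI_def bid_def pairing_X pairing_E pairing_id
  by (simp_all add: dtens_pairing bverts_numeral insert_commute ds12_def de12_def ds23_def de23_def del: One_nat_def add_2_eq_Suc add_2_eq_Suc')

text \<open>Strand 1 stands for the pole. The products with \<open>de12\<close> cancel in pairs: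
  \<open>de12\<close> after \<open>ds13\<close> equals \<open>de12\<close> after
  \<open>de23\<close>, and \<open>de12\<close> after \<open>de13\<close> equals \<open>de12\<close>
  after \<open>ds23\<close>, with the analogous coincidences in the other order. Both sides are left
  with \<open>dm1\<close>, \<open>dm2\<close> with coefficient \<open>1\<close> and
  \<open>dm3\<close>, \<open>dm4\<close> with coefficient \<open>-1\<close>.\<close>

lemma four_term:
  fixes \<delta> :: "'k::comm_ring_1"
  defines "h \<equiv> btens 2 2 1 1 (bH \<delta>) bI" and "x \<equiv> btens 1 1 2 2 bI bX"
    and "h' \<equiv> btens 1 1 2 2 bI (bH \<delta>)"
  defines "g \<equiv> (\<lambda>d. bcomp \<delta> 3 3 3 x (bcomp \<delta> 3 3 3 h x) d + h' d)"
  shows "bcomp \<delta> 3 3 3 h g = bcomp \<delta> 3 3 3 g h"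
proof -
  have h: "h = (\<lambda>d. bsing ds12 d - bsing de12 d)" and x: "x = bsing ds23"
    and h': "h' = (\<lambda>d. bsing ds23 d - bsing de23 d)"
    by (simp_all add: h_def x_def h'_def bH_eq bX_def btens_diff strands3 del: One_nat_def)
  \<comment> \<open>Conjugation with the crossing of strands 2 and 3 moves \<open>h\<close> from
    strands 1, 2 to strands 1, 3.\<close>
  have g: "g = (\<lambda>d. (bsing ds13 d - bsing de13 d) + (bsing ds23 d - bsing de23 d))"
    by (simp add: g_def h x h' bcomp_diff bcomp3)
  show ?thesis unfolding g
    by (rule ext) (simp add: h bcomp_add bcomp_diff bcomp3)
qed

text \<open>\<open>dCU\<close> and \<open>dCA\<close> are the two outer factors in the definition of the transpose, \<open>dXX\<close> and
\<open>dEX\<close> are the crossing and the cup-cap next to a crossing.\<close>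

definition dCU :: bdiag where "dCU = pairing [(Inl 0, Inr 0), (Inr 1, Inr 2), (Inl 1, Inr 3)]"
definition dCA :: bdiag where "dCA = pairing [(Inl 0, Inr 0), (Inl 1, Inl 2), (Inl 3, Inr 1)]"
definition dXX :: bdiag where "dXX = pairing [(Inl 0, Inr 1), (Inl 1, Inr 0), (Inl 2, Inr 3), (Inl 3, Inr 2)]"
definition dEX :: bdiag where "dEX = pairing [(Inl 0, Inl 1), (Inr 0, Inr 1), (Inl 2, Inr 3), (Inl 3, Inr 2)]"
definition dD1 :: bdiag where "dD1 = pairing [(Inl 0, Inr 1), (Inl 1, Inr 2), (Inr 0, Inr 3)]"
definition dD2 :: bdiag where "dD2 = pairing [(Inl 0, Inr 3), (Inl 1, Inr 2), (Inr 0, Inr 1)]"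

lemma bcomp4:
  "bcomp \<delta> 2 4 4 (bsing dXX) (bsing dCU) = bsing dD1"
  "bcomp \<delta> 2 4 4 (bsing dEX) (bsing dCU) = bsing dD2"
  "bcomp \<delta> 2 4 2 (bsing dCA) (bsing dD1) = bsing dE"
  "bcomp \<delta> 2 4 2 (bsing dCA) (bsing dD2) = bsing dX"
  unfolding dCU_def dCA_def dXX_def dEX_def dD1_def dD2_def pairing_X pairing_E
  by (rule dcomp_pairing; auto simp: bverts_numeral Pow_numeral Plus_mem)+

lemma strands4:
  "btens 2 2 2 2 (bsing dX) bX = bsing dXX" "btens 2 2 2 2 (bsing dE) bX = bsing dEX"
  "btens 1 1 3 1 bI (btens 2 0 1 1 bcap bI) = bsing dCA"
  "btens 1 1 1 3 bI (btens 0 2 1 1 bcup bI) = bsing dCU"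
  unfolding bI_def bid_def bX_def bcap_def bcup_def pairing_X pairing_E pairing_id pairing_cap pairing_cup
  by (simp_all add: dtens_pairing bverts_numeral insert_commute dXX_def dEX_def dCA_def dCU_def del: One_nat_def add_2_eq_Suc add_2_eq_Suc')

text \<open>Bending the strands in this way turns the crossing into the cup-cap and the cup-cap into
  the crossing, so their difference changes sign.\<close>

lemma skew_symmetric:
  "bcomp \<delta> 2 4 2 (btens 1 1 3 1 bI (btens 2 0 1 1 bcap bI))
     (bcomp \<delta> 2 4 4 (btens 2 2 2 2 (bH \<delta>) bX) (btens 1 1 1 3 bI (btens 0 2 1 1 bcup bI)))
   = (\<lambda>d. - bH \<delta> d)"
  by (simp add: strands4 bH_eq btens_diff bcomp_diff bcomp4 del: One_nat_def)

section \<open>Polar diagrams\<close>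

lemma is_pdiag_Nil [simp]: "\<not> is_pdiag r s []"
  by (simp add: is_pdiag_def)

lemma is_pdiag_single: "is_pdiag r s [(a, b, D)] \<longleftrightarrow> r = a \<and> s = b \<and> is_bdiag a b D"
  by (auto simp: is_pdiag_def)

lemma is_pdiag_Cons:
  assumes "P \<noteq> []"
  shows "is_pdiag r s ((a, b, D) # P) \<longleftrightarrow> r = a \<and> is_bdiag a b D \<and> 1 \<le> b \<and> is_pdiag b s P"
proof -
  obtain x P' where P: "P = x # P'" using assms by (cases P) auto
  have all_less: "(\<forall>i<Suc n. Q i) \<longleftrightarrow> Q 0 \<and> (\<forall>i<n. Q (Suc i))" for Q and n :: nat
    by (rule All_less_Suc2)
  have "(\<forall>i. Suc i < length ((a, b, D) # P) \<longrightarrow> fst (snd (((a, b, D) # P) ! i)) = fst (((a, b, D) # P) ! Suc i)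
        \<and> 1 \<le> fst (snd (((a, b, D) # P) ! i))) \<longleftrightarrow>
    (b = fst (hd P) \<and> 1 \<le> b) \<and> (\<forall>i. Suc i < length P \<longrightarrow> fst (snd (P ! i)) = fst (P ! Suc i) \<and> 1 \<le> fst (snd (P ! i)))"
    using all_less[of "length P'"] by (simp add: P less_Suc_eq_le flip: less_Suc_eq_le)
  then show ?thesis
    unfolding is_pdiag_def using all_less[of "length P"] by (auto simp: P)
qed

text \<open>Induction on the number of connectors, removing levels from the bottom. The top object
  stays fixed, and with it whatever is stacked above.\<close>

lemma pdiag_induct [consumes 1, case_names single Cons]:
  assumes "is_pdiag r s P"
    and "\<And>r D. is_bdiag r s D \<Longrightarrow> Q r [(r, s, D)]"
    and "\<And>r u D P. is_bdiag r u D \<Longrightarrow> 1 \<le> u \<Longrightarrow> is_pdiag u s P \<Longrightarrow> P \<noteq> [] \<Longrightarrow> Q u P \<Longrightarrow> Q r ((r, u, D) # P)"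
  shows "Q r P"
  using assms(1)
proof (induction P arbitrary: r)
  case (Cons x P)
  obtain a b D where x: "x = (a, b, D)" by (cases x)
  show ?case
  proof (cases "P = []")
    case True
    then show ?thesis using Cons.prems assms(2) by (auto simp: x is_pdiag_single)
  next
    case False
    then show ?thesis using Cons assms(3) by (auto simp: x is_pdiag_Cons)
  qed
qed simp

lemma pdiag_cases:
  assumes "is_pdiag r s P"
  obtains D where "is_bdiag r s D" "P = [(r, s, D)]"
  | u D P' where "is_bdiag r u D" "1 \<le> u" "is_pdiag u s P'" "P' \<noteq> []" "P = (r, u, D) # P'"
  using assms by (induction rule: pdiag_induct) blast+

lemma pdiag_last: "is_pdiag r s P \<Longrightarrow> fst (snd (last P)) = s"
  by (simp add: is_pdiag_def)

lemma pcomp_single [simp]: "pcomp ((a, b, E) # Q) [(r, s, D)] = (r, b, dcomp r s b E D) # Q"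
  by (simp add: pcomp_def)

lemma pcomp_Cons [simp]: "P \<noteq> [] \<Longrightarrow> pcomp Q (X # P) = X # pcomp Q P"
  by (simp add: pcomp_def)

lemma ploops_single [simp]: "ploops ((a, b, E) # Q) [(r, s, D)] = loops r s b E D"
  by (simp add: ploops_def)

lemma ploops_Cons [simp]: "P \<noteq> [] \<Longrightarrow> ploops Q (X # P) = ploops Q P"
  by (simp add: ploops_def)

lemma pcomp_not_Nil [simp]: "pcomp Q P \<noteq> []"
  by (simp add: pcomp_def)

lemma ptens_Nil [simp]: "ptens k l B [] = []"
  by (simp add: ptens_def)

lemma ptens_Cons [simp]:
  "ptens k l B ((a, b, D) # P) = (a + k, b + l, dtens a b k l D B) # ptens l l (did l) P"
  by (cases P) (auto simp: ptens_def)

lemma ptens_eq_Nil [simp]: "ptens k l B P = [] \<longleftrightarrow> P = []"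
  by (cases P) auto

lemma pdiag_pcomp:
  assumes "is_pdiag r s P" and Q: "is_pdiag s t Q"
  shows "is_pdiag r t (pcomp Q P)"
  using assms(1)
proof (induction rule: pdiag_induct)
  case (single r D)
  show ?case using Q
    by (cases rule: pdiag_cases) (use single in \<open>auto simp: is_pdiag_single is_pdiag_Cons bdiag_dcomp\<close>)
qed (simp add: is_pdiag_Cons)

lemma pdiag_ptens:
  assumes "is_pdiag r s P" "is_bdiag k l B"
  shows "is_pdiag (r + k) (s + l) (ptens k l B P)"
  using assms
proof (induction arbitrary: k B rule: pdiag_induct)
  case (Cons r u D P)
  then show ?case by (simp add: is_pdiag_Cons bdiag_dtens)
qed (simp add: is_pdiag_single bdiag_dtens)

text \<open>The two joints lie in a common level only if \<open>Q\<close> has no connector and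
  \<open>P\<close> is reduced to its top level; there associativity for Brauer diagrams applies.
  Otherwise the joints are apart and the claim concerns lists.\<close>

lemma pcomp_assoc:
  assumes "is_pdiag r s P" and Q: "is_pdiag s t Q" and R: "is_pdiag t u R"
  shows "pcomp R (pcomp Q P) = pcomp (pcomp R Q) P \<and>
    ploops Q P + ploops R (pcomp Q P) = ploops R Q + ploops (pcomp R Q) P"
  using assms(1)
proof (induction rule: pdiag_induct)
  case (single r D)
  show ?case using Q
  proof (cases rule: pdiag_cases)
    case (1 E)
    from R obtain v F R' where "R = (t, v, F) # R'" "is_bdiag t v F"
      by (cases rule: pdiag_cases) auto
    then show ?thesis using 1 single dcomp_loops_assoc[of r s D t E v F] by simp
  next
    case (2 v E Q')
    then show ?thesis by simp
  qed
qed simp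

lemma pcomp_did_right:
  assumes "is_pdiag s t Q" "is_bdiag r s D"
  shows "pcomp Q [(s, s, did s)] = Q \<and> ploops Q [(s, s, did s)] = 0"
  using assms(1) by (cases rule: pdiag_cases) (simp_all add: dcomp_did_right)

lemma ptens_assoc:
  assumes "is_pdiag r s P" "is_bdiag k l B" "is_bdiag m n C"
  shows "ptens m n C (ptens k l B P) = ptens (k + m) (l + n) (dtens k l m n B C) P"
  using assms
proof (induction arbitrary: k m B C rule: pdiag_induct)
  case (single r D)
  then show ?case by (simp add: dtens_assoc add.assoc)
next
  case (Cons r u D P)
  have "ptens n n (did n) (ptens l l (did l) P) = ptens (l + n) (l + n) (did (l + n)) P"
    using Cons.IH[of l "did l" n "did n"] by (simp add: dtens_did)
  then show ?case using Cons by (simp add: dtens_assoc add.assoc)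
qed

lemma ptens_0: "is_pdiag r s P \<Longrightarrow> ptens 0 0 (did 0) P = P"
  by (induction rule: pdiag_induct) (simp_all add: dtens_0_right)

text \<open>Factors the action of \<open>B\<close> on \<open>Q\<close> into \<open>B\<close> beside
  an identity, followed by \<open>Q\<close> beside an identity. This is strict since
  \<open>ptens\<close> puts \<open>B\<close> at the bottom.\<close>

lemma pcomp_whisker:
  assumes Q: "is_pdiag s t Q" and B: "is_bdiag l m B"
  shows "pcomp (ptens m m (did m) Q) [(s + l, s + m, dtens s s l m (did s) B)] = ptens l m B Q \<and>
    ploops (ptens m m (did m) Q) [(s + l, s + m, dtens s s l m (did s) B)] = 0"
proof -
  obtain u E Q' where Q: "Q = (s, u, E) # Q'" and E: "is_bdiag s u E"
    using Q by (cases rule: pdiag_cases) auto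
  show ?thesis
    using dcomp_dtens[OF bdiag_did E B bdiag_did] dcomp_did_right[OF E] dcomp_did_left[OF B]
    by (simp add: Q)
qed

text \<open>Interchange is strict when the upper factor is juxtaposed with an identity, for then
  nothing has to pass a connector.\<close>

lemma pcomp_ptens:
  assumes "is_pdiag r s P" and Q: "is_pdiag s t Q" and "is_bdiag k m C"
  shows "pcomp (ptens m m (did m) Q) (ptens k m C P) = ptens k m C (pcomp Q P) \<and>
    ploops (ptens m m (did m) Q) (ptens k m C P) = ploops Q P"
  using assms(1,3)
proof (induction arbitrary: k C rule: pdiag_induct)
  case (single r D)
  obtain u E Q' where Q: "Q = (s, u, E) # Q'" and E: "is_bdiag s u E"
    using Q by (cases rule: pdiag_cases) auto
  show ?case
    using dcomp_dtens[OF single(1) E single(2) bdiag_did] dcomp_did_left[OF single(2)] by (simp add: Q)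
qed simp

section \<open>Linear combinations of polar diagrams\<close>

lemma fmor_zero [simp]: "fmor r s (\<lambda>_. 0)" by (simp add: fmor_def)

lemma fmor_sing [simp]: "is_pdiag r s P \<Longrightarrow> fmor r s (psing P)"
proof -
  assume P: "is_pdiag r s P"
  have "finite {Q. psing P Q \<noteq> (0::'a)}"
    by (rule finite_subset[of _ "{P}"]) (auto simp: psing_def split: if_splits)
  then show ?thesis using P by (auto simp: fmor_def psing_def split: if_splits)
qed

lemma fmor_lin: "fmor r s x \<Longrightarrow> fmor r s y \<Longrightarrow> fmor r s (\<lambda>P. c * x P + y P)"
proof -
  assume xy: "fmor r s x" "fmor r s y"
  have *: "x P \<noteq> 0 \<or> y P \<noteq> 0" if "c * x P + y P \<noteq> 0" for P
    using that by auto
  have "finite {P. c * x P + y P \<noteq> 0}"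
    by (rule finite_subset[of _ "{P. x P \<noteq> 0} \<union> {P. y P \<noteq> 0}"]) (use * xy in \<open>auto simp: fmor_def\<close>)
  then show ?thesis using * xy unfolding fmor_def by blast
qed

lemma fmor_scale: "fmor r s x \<Longrightarrow> fmor r s (\<lambda>P. c * x P)"
  using fmor_lin[of r s x "\<lambda>_. 0" c] by simp

lemma fmor_pdiff: "fmor r s x \<Longrightarrow> fmor r s y \<Longrightarrow> fmor r s (pdiff x y)"
  using fmor_lin[of r s y x "- 1"] by (simp add: pdiff_def)

lemma fmor_padd: "fmor r s x \<Longrightarrow> fmor r s y \<Longrightarrow> fmor r s (padd x y)"
  using fmor_lin[of r s x y 1] by (simp add: padd_def)

lemma fmor_induct [consumes 1, case_names zero sing lin]:
  fixes x :: "pdiag \<Rightarrow> 'k::comm_ring_1"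
  assumes x: "fmor r s x" and zero: "Q (\<lambda>_. 0)" and sing: "\<And>P. is_pdiag r s P \<Longrightarrow> Q (psing P)"
    and lin: "\<And>c x y. fmor r s x \<Longrightarrow> Q x \<Longrightarrow> fmor r s y \<Longrightarrow> Q y \<Longrightarrow> Q (\<lambda>P. c * x P + y P)"
  shows "Q x"
proof -
  have "Q (\<lambda>R. \<Sum>P\<in>F. x P * psing P R) \<and> fmor r s (\<lambda>R. \<Sum>P\<in>F. x P * psing P R)"
    if "finite F" "F \<subseteq> {P. x P \<noteq> 0}" for F
    using that
  proof (induction F rule: finite_induct)
    case (insert P F)
    then have P: "is_pdiag r s P" using x by (auto simp: fmor_def)
    then show ?case
      using insert lin[of "psing P" "\<lambda>R. \<Sum>P\<in>F. x P * psing P R" "x P"]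
        fmor_lin[of r s "psing P" "\<lambda>R. \<Sum>P\<in>F. x P * psing P R" "x P"] sing[OF P] by simp
  qed (simp add: zero)
  moreover have fin: "finite {P. x P \<noteq> 0}" using x by (simp add: fmor_def)
  ultimately have "Q (\<lambda>R. \<Sum>P\<in>{P. x P \<noteq> 0}. x P * psing P R)" by blast
  moreover have "(\<lambda>R. \<Sum>P\<in>{P. x P \<noteq> 0}. x P * psing P R) = x"
  proof
    fix R
    have "(\<Sum>P\<in>{P. x P \<noteq> 0}. x P * psing P R) = (\<Sum>P\<in>{P. x P \<noteq> 0}. if P = R then x R else 0)"
      by (intro sum.cong) (auto simp: psing_def)
    then show "(\<Sum>P\<in>{P. x P \<noteq> 0}. x P * psing P R) = x R" using fin by auto
  qed
  ultimately show ?thesis by simp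
qed

text \<open>Polar diagrams may have any number of connectors, so \<open>pcompose\<close> sums over
  the supports of its arguments, and these change under addition. Linearity is read off after
  enlarging them to a common finite product.\<close>

lemma pcompose_eq:
  assumes "finite S" "{P. x P \<noteq> 0} \<subseteq> S" "finite T" "{Q. y Q \<noteq> 0} \<subseteq> T"
  shows "pcompose \<delta> y x R = (\<Sum>(P, Q)\<in>S \<times> T. x P * y Q * (\<delta> ^ ploops Q P * psing (pcomp Q P) R))"
  unfolding pcompose_def
  by (rule sum.mono_neutral_cong_left) (use assms in \<open>auto simp: psing_def split: if_splits\<close>)

lemma pcompose_lin_right:
  assumes "fmor r s x" "fmor r s x'" "fmor s t y"
  shows "pcompose \<delta> y (\<lambda>P. c * x P + x' P) = (\<lambda>R. c * pcompose \<delta> y x R + pcompose \<delta> y x' R)"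
proof
  fix R
  let ?S = "{P. x P \<noteq> 0} \<union> {P. x' P \<noteq> 0}" and ?T = "{Q. y Q \<noteq> 0}"
  have fin: "finite ?S" "finite ?T" using assms by (auto simp: fmor_def)
  have eq: "pcompose \<delta> y z R = (\<Sum>(P, Q)\<in>?S \<times> ?T. z P * y Q * (\<delta> ^ ploops Q P * psing (pcomp Q P) R))"
    if "{P. z P \<noteq> 0} \<subseteq> ?S" for z
    by (rule pcompose_eq) (use fin that in auto)
  have sub: "{P. c * x P + x' P \<noteq> 0} \<subseteq> ?S" by auto
  show "pcompose \<delta> y (\<lambda>P. c * x P + x' P) R = c * pcompose \<delta> y x R + pcompose \<delta> y x' R"
    unfolding eq[OF sub] eq[of x, OF Un_upper1] eq[of x', OF Un_upper2] split_def
      sum_distrib_left sum.distrib[symmetric]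
    by (rule sum.cong) (simp_all add: algebra_simps)
qed

lemma pcompose_lin_left:
  assumes "fmor r s x" "fmor s t y" "fmor s t y'"
  shows "pcompose \<delta> (\<lambda>P. c * y P + y' P) x = (\<lambda>R. c * pcompose \<delta> y x R + pcompose \<delta> y' x R)"
proof
  fix R
  let ?T = "{P. y P \<noteq> 0} \<union> {P. y' P \<noteq> 0}" and ?S = "{Q. x Q \<noteq> 0}"
  have fin: "finite ?S" "finite ?T" using assms by (auto simp: fmor_def)
  have eq: "pcompose \<delta> z x R = (\<Sum>(P, Q)\<in>?S \<times> ?T. x P * z Q * (\<delta> ^ ploops Q P * psing (pcomp Q P) R))"
    if "{P. z P \<noteq> 0} \<subseteq> ?T" for z
    by (rule pcompose_eq) (use fin that in auto)
  have sub: "{P. c * y P + y' P \<noteq> 0} \<subseteq> ?T" by auto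
  show "pcompose \<delta> (\<lambda>P. c * y P + y' P) x R = c * pcompose \<delta> y x R + pcompose \<delta> y' x R"
    unfolding eq[OF sub] eq[of y, OF Un_upper1] eq[of y', OF Un_upper2] split_def
      sum_distrib_left sum.distrib[symmetric]
    by (rule sum.cong) (simp_all add: algebra_simps)
qed

lemma pcompose_zero [simp]: "pcompose \<delta> y (\<lambda>_. 0) = (\<lambda>_. 0)" "pcompose \<delta> (\<lambda>_. 0) x = (\<lambda>_. 0)"
  by (simp_all add: pcompose_def)

lemma pcompose_sing: "pcompose \<delta> (psing Q) (psing P) = (\<lambda>R. \<delta> ^ ploops Q P * psing (pcomp Q P) R)"
proof
  fix R
  have "pcompose \<delta> (psing Q) (psing P) R =
    (\<Sum>(P', Q')\<in>{P} \<times> {Q}. psing P P' * psing Q Q' * (\<delta> ^ ploops Q' P' * psing (pcomp Q' P') R))"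
    by (rule pcompose_eq) (auto simp: psing_def split: if_splits)
  then show "pcompose \<delta> (psing Q) (psing P) R = \<delta> ^ ploops Q P * psing (pcomp Q P) R"
    by (simp add: psing_def)
qed

lemma pcompose_scale_right:
  "fmor r s x \<Longrightarrow> fmor s t y \<Longrightarrow> pcompose \<delta> y (\<lambda>P. c * x P) = (\<lambda>R. c * pcompose \<delta> y x R)"
  using pcompose_lin_right[of r s x "\<lambda>_. 0" t y \<delta> c] by simp

lemma pcompose_scale_left:
  "fmor r s x \<Longrightarrow> fmor s t y \<Longrightarrow> pcompose \<delta> (\<lambda>P. c * y P) x = (\<lambda>R. c * pcompose \<delta> y x R)"
  using pcompose_lin_left[of r s x t y "\<lambda>_. 0" \<delta> c] by simp

lemma fmor_pcompose:
  assumes x: "fmor r s x" and y: "fmor s t y"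
  shows "fmor r t (pcompose \<delta> y x)"
  using x
proof (induction x rule: fmor_induct)
  case (sing P)
  show ?case using y
  proof (induction y rule: fmor_induct)
    case (sing Q)
    then show ?case using pdiag_pcomp \<open>is_pdiag r s P\<close> by (simp add: pcompose_sing fmor_scale)
  next
    case (lin c y y')
    then show ?case using pcompose_lin_left[OF fmor_sing[OF \<open>is_pdiag r s P\<close>] lin(1,2), of \<delta> c]
      by (simp add: fmor_lin)
  qed simp
next
  case (lin c x x')
  then show ?case using y by (subst pcompose_lin_right) (auto intro: fmor_lin)
qed simp

lemma ftens_eq:
  assumes "finite S" "{P. x P \<noteq> 0} \<subseteq> S"
  shows "ftens k l x g R = (\<Sum>(P, B)\<in>S \<times> {B. is_bdiag k l B}. x P * g B * psing (ptens k l B P) R)"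
  unfolding ftens_def
  by (rule sum.mono_neutral_cong_left) (use assms in \<open>auto simp: psing_def split: if_splits\<close>)

lemma ftens_lin_left:
  assumes "fmor r s x" "fmor r s x'"
  shows "ftens k l (\<lambda>P. c * x P + x' P) g = (\<lambda>R. c * ftens k l x g R + ftens k l x' g R)"
proof
  fix R
  let ?S = "{P. x P \<noteq> 0} \<union> {P. x' P \<noteq> 0}"
  have fin: "finite ?S" using assms by (auto simp: fmor_def)
  have eq: "ftens k l z g R = (\<Sum>(P, B)\<in>?S \<times> {B. is_bdiag k l B}. z P * g B * psing (ptens k l B P) R)"
    if "{P. z P \<noteq> 0} \<subseteq> ?S" for z
    by (rule ftens_eq) (use fin that in auto)
  have sub: "{P. c * x P + x' P \<noteq> 0} \<subseteq> ?S" by auto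
  show "ftens k l (\<lambda>P. c * x P + x' P) g R = c * ftens k l x g R + ftens k l x' g R"
    unfolding eq[OF sub] eq[of x, OF Un_upper1] eq[of x', OF Un_upper2] split_def
      sum_distrib_left sum.distrib[symmetric]
    by (rule sum.cong) (simp_all add: algebra_simps)
qed

lemma ftens_lin_right:
  assumes "fmor r s x"
  shows "ftens k l x (\<lambda>d. c * g d + g' d) = (\<lambda>R. c * ftens k l x g R + ftens k l x g' R)"
proof
  fix R
  have fin: "finite {P. x P \<noteq> 0}" using assms by (auto simp: fmor_def)
  note eq = ftens_eq[OF fin order_refl, of k l _ R]
  show "ftens k l x (\<lambda>d. c * g d + g' d) R = c * ftens k l x g R + ftens k l x g' R"
    unfolding eq split_def sum_distrib_left sum.distrib[symmetric]
    by (rule sum.cong) (simp_all add: algebra_simps)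
qed

lemma ftens_zero [simp]: "ftens k l x (\<lambda>_. 0) = (\<lambda>_. 0)" "ftens k l (\<lambda>_. 0) g = (\<lambda>_. 0)"
  by (simp_all add: ftens_def)

lemma ftens_sing:
  assumes "is_bdiag k l B"
  shows "ftens k l (psing P) (bsing B) = psing (ptens k l B P)"
proof
  fix R
  have "ftens k l (psing P) (bsing B) R =
    (\<Sum>(P', B')\<in>{P} \<times> {B. is_bdiag k l B}. psing P P' * bsing B B' * psing (ptens k l B' P') R)"
    by (rule ftens_eq) (auto simp: psing_def split: if_splits)
  also have "\<dots> = (\<Sum>B'\<in>{B. is_bdiag k l B}. psing P P * bsing B B' * psing (ptens k l B' P) R)"
    unfolding sum.cartesian_product[symmetric] by simp
  also have "\<dots> = (\<Sum>B'\<in>{B. is_bdiag k l B}. if B' = B then psing (ptens k l B P) R else 0)"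
    by (intro sum.cong) (simp_all add: psing_def bsing_def)
  finally show "ftens k l (psing P) (bsing B) R = psing (ptens k l B P) R" using assms by simp
qed

lemma ftens_scale_left: "fmor r s x \<Longrightarrow> ftens k l (\<lambda>P. c * x P) g = (\<lambda>R. c * ftens k l x g R)"
  using ftens_lin_left[of r s x "\<lambda>_. 0" k l c g] by simp

lemma ftens_scale_right: "fmor r s x \<Longrightarrow> ftens k l x (\<lambda>d. c * g d) = (\<lambda>R. c * ftens k l x g R)"
  using ftens_lin_right[of r s x k l c g "\<lambda>_. 0"] by simp

lemma fmor_ftens:
  assumes x: "fmor r s x" and g: "bmor k l g"
  shows "fmor (r + k) (s + l) (ftens k l x g)"
  using x
proof (induction x rule: fmor_induct)
  case (sing P)
  show ?case using g
  proof (induction g rule: bmor_induct)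
    case (sing B)
    then show ?case using pdiag_ptens \<open>is_pdiag r s P\<close> by (simp add: ftens_sing)
  next
    case (lin c g g')
    then show ?case using ftens_lin_right[OF fmor_sing[OF \<open>is_pdiag r s P\<close>], of k l c g g'] by (simp add: fmor_lin)
  qed simp
next
  case (lin c x x')
  then show ?case by (subst ftens_lin_left) (auto intro: fmor_lin)
qed simp

section \<open>The functor to the Brauer category\<close>

definition pole_tens :: "nat \<Rightarrow> nat \<Rightarrow> bdiag \<Rightarrow> bdiag \<Rightarrow> 'k::comm_ring_1" where
  "pole_tens r s D = btens 1 1 r s bI (bsing D)"

text \<open>Only used for \<open>s \<ge> 1\<close>, so that \<open>s - 1\<close> does not truncate.\<close>

definition connector :: "'k::comm_ring_1 \<Rightarrow> nat \<Rightarrow> bdiag \<Rightarrow> 'k" where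
  "connector \<delta> s = btens 2 2 (s - 1) (s - 1) (bH \<delta>) (bid (s - 1))"

text \<open>The value at \<open>[]\<close>, which is not a polar diagram, is a default. The top
  object is read off the last level, as it is not among the arguments.\<close>

fun polar_image :: "'k::comm_ring_1 \<Rightarrow> pdiag \<Rightarrow> bdiag \<Rightarrow> 'k" where
  "polar_image \<delta> [] = (\<lambda>_. 0)"
| "polar_image \<delta> ((r, s, D) # P) = (if P = [] then pole_tens r s D else
     bcomp \<delta> (Suc r) (Suc s) (Suc (fst (snd (last P)))) (polar_image \<delta> P)
       (bcomp \<delta> (Suc r) (Suc s) (Suc s) (connector \<delta> s) (pole_tens r s D)))"

definition varpi :: "'k::comm_ring_1 \<Rightarrow> (pdiag \<Rightarrow> 'k) \<Rightarrow> bdiag \<Rightarrow> 'k" where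
  "varpi \<delta> x = (\<lambda>d. \<Sum>P\<in>{P. x P \<noteq> 0}. x P * polar_image \<delta> P d)"

lemma bmor_bI [simp]: "bmor 1 1 bI" "bmor (Suc 0) (Suc 0) bI"
  using bmor_bid[of 1] by (simp_all add: bI_def)

lemma bcomp_bI: "bcomp \<delta> 1 1 1 bI bI = bI"
  unfolding bI_def by (rule bcomp_bid_right) simp

lemma bmor_pole_tens: "bmor (Suc r) (Suc s) (pole_tens r s D)"
  using bmor_btens[of 1 r 1 s] by (simp add: pole_tens_def)

lemma bmor_connector: "1 \<le> s \<Longrightarrow> bmor (Suc s) (Suc s) (connector \<delta> s)"
  using bmor_btens[of 2 "s - 1" 2 "s - 1"] by (simp add: connector_def numeral_2_eq_2)

lemma bmor_polar_image: "is_pdiag r s P \<Longrightarrow> bmor (Suc r) (Suc s) (polar_image \<delta> P)"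
  by (cases rule: pdiag_cases, assumption) (auto simp: bmor_pole_tens bmor_bcomp pdiag_last)

lemma pole_tens_dcomp:
  assumes "is_bdiag r s D" "is_bdiag s t E"
  shows "bcomp \<delta> (Suc r) (Suc s) (Suc t) (pole_tens s t E) (pole_tens r s D)
    = (\<lambda>d. \<delta> ^ loops r s t E D * pole_tens r t (dcomp r s t E D) d)"
  using bcomp_btens[of 1 1 bI 1 bI r s "bsing D" t "bsing E" \<delta>] assms
  by (simp add: pole_tens_def bcomp_bI[simplified] bcomp_sing btens_scale)

text \<open>Induction on the lower diagram leads to the joint, where two Brauer levels merge; the
  loops closed there are those counted by \<open>ploops\<close>.\<close>

lemma polar_image_pcomp:
  assumes "is_pdiag r s P" and Q: "is_pdiag s t Q"
  shows "bcomp \<delta> (Suc r) (Suc s) (Suc t) (polar_image \<delta> Q) (polar_image \<delta> P)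
    = (\<lambda>d. \<delta> ^ ploops Q P * polar_image \<delta> (pcomp Q P) d)"
  using assms(1)
proof (induction rule: pdiag_induct)
  case (single r D)
  show ?case using Q
  proof (cases rule: pdiag_cases)
    case (1 E)
    then show ?thesis using single by (simp add: pole_tens_dcomp)
  next
    case (2 u E Q')
    let ?C = "connector \<delta> u" and ?Q = "polar_image \<delta> Q'"
    note bm = bmor_pole_tens bmor_connector[OF 2(2)] bmor_polar_image[OF 2(3)] bmor_bcomp
    have "bcomp \<delta> (Suc r) (Suc s) (Suc t) (polar_image \<delta> Q) (polar_image \<delta> [(r, s, D)])
      = bcomp \<delta> (Suc r) (Suc s) (Suc t) (bcomp \<delta> (Suc s) (Suc u) (Suc t) ?Q
          (bcomp \<delta> (Suc s) (Suc u) (Suc u) ?C (pole_tens s u E))) (pole_tens r s D)"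
      using 2 by (simp add: pdiag_last[OF 2(3)])
    \<comment> \<open>Regrouping brings the two Brauer levels of the joint next to each other, ready
      for \<open>pole_tens_dcomp\<close>.\<close>
    also have "\<dots> = bcomp \<delta> (Suc r) (Suc u) (Suc t) ?Q (bcomp \<delta> (Suc r) (Suc u) (Suc u) ?C
        (bcomp \<delta> (Suc r) (Suc s) (Suc u) (pole_tens s u E) (pole_tens r s D)))"
      by (simp add: bcomp_assoc[OF bm(1) bm(4) bm(3), symmetric] bcomp_assoc[OF bm(1) bm(1) bm(2), symmetric])
    also have "\<dots> = (\<lambda>d. \<delta> ^ ploops Q [(r, s, D)] * polar_image \<delta> (pcomp Q [(r, s, D)]) d)"
      using 2 single by (simp add: pole_tens_dcomp bcomp_scale pdiag_last[OF 2(3)])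
    finally show ?thesis .
  qed
next
  case (Cons r u D P)
  note bm = bmor_bcomp bmor_polar_image[OF Cons(3)] bmor_polar_image[OF Q]
  have "fst (snd (last (pcomp Q P))) = t" using pdiag_last[OF pdiag_pcomp[OF Cons(3) Q]] .
  then show ?case
    using Cons by (simp add: pdiag_last[OF Cons(3)] bcomp_assoc[OF bm] bcomp_scale)
qed

text \<open>A connector touches only the pole and the leftmost thin strand, so strands added on the
  right join its identity factor.\<close>

lemma connector_add:
  assumes "1 \<le> u"
  shows "connector \<delta> (u + l) = btens (Suc u) (Suc u) l l (connector \<delta> u) (bid l)"
proof -
  obtain v where u: "u = Suc v" using assms by (cases u) auto
  show ?thesis
    using btens_assoc[OF bmor_bH bmor_bid bmor_bid, of v l \<delta>]
    by (simp add: connector_def u btens_bid)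
qed

lemma pole_tens_add:
  assumes "is_bdiag r u D" "is_bdiag k l B"
  shows "(pole_tens (r + k) (u + l) (dtens r u k l D B) :: bdiag \<Rightarrow> 'k::comm_ring_1)
    = btens (Suc r) (Suc u) k l (pole_tens r u D) (bsing B)"
  using btens_assoc[of 1 1 "bI :: bdiag \<Rightarrow> 'k" r u "bsing D" k l "bsing B"] assms
  by (simp add: pole_tens_def btens_sing)

text \<open>Interchange in the Brauer category, level by level: \<open>B\<close> enters the lowest
  level, while the connectors and the higher levels are juxtaposed with identities, as in
  \<open>ptens\<close>.\<close>

lemma polar_image_ptens:
  assumes "is_pdiag r s P" "is_bdiag k l B"
  shows "polar_image \<delta> (ptens k l B P) = btens (Suc r) (Suc s) k l (polar_image \<delta> P) (bsing B)"
  using assms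
proof (induction arbitrary: k B rule: pdiag_induct)
  case (single r D)
  then show ?case by (simp add: pole_tens_add)
next
  case (Cons r u D P)
  note B = bmor_sing[OF Cons.prems]
  have "polar_image \<delta> (ptens l l (did l) P) = btens (Suc u) (Suc s) l l (polar_image \<delta> P) (bid l)"
    using Cons.IH[of l "did l"] by (simp add: bid_def)
  moreover have "fst (snd (last (ptens l l (did l) P))) = s + l"
    using pdiag_last[OF pdiag_ptens[OF Cons(3) bdiag_did]] .
  moreover have "bcomp \<delta> (Suc r + k) (Suc u + l) (Suc u + l) (connector \<delta> (u + l)) (pole_tens (r + k) (u + l) (dtens r u k l D B))
    = btens (Suc r) (Suc u) k l (bcomp \<delta> (Suc r) (Suc u) (Suc u) (connector \<delta> u) (pole_tens r u D)) (bsing B)"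
    unfolding connector_add[OF Cons(2)] pole_tens_add[OF Cons(1) Cons.prems]
    by (subst bcomp_btens[OF bmor_pole_tens bmor_connector[OF Cons(2)] B bmor_bid])
      (simp add: bcomp_bid_left[OF B])
  moreover have "bcomp \<delta> (Suc r + k) (Suc u + l) (Suc s + l) (btens (Suc u) (Suc s) l l (polar_image \<delta> P) (bid l))
      (btens (Suc r) (Suc u) k l (bcomp \<delta> (Suc r) (Suc u) (Suc u) (connector \<delta> u) (pole_tens r u D)) (bsing B))
    = btens (Suc r) (Suc s) k l (bcomp \<delta> (Suc r) (Suc u) (Suc s) (polar_image \<delta> P)
      (bcomp \<delta> (Suc r) (Suc u) (Suc u) (connector \<delta> u) (pole_tens r u D))) (bsing B)"
    by (subst bcomp_btens[OF bmor_bcomp bmor_polar_image[OF Cons(3)] B bmor_bid])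
      (simp add: bcomp_bid_left[OF B])
  ultimately show ?case using Cons(4) by (simp add: pdiag_last[OF Cons(3)])
qed

lemma varpi_eq:
  assumes "finite S" "{P. x P \<noteq> 0} \<subseteq> S"
  shows "varpi \<delta> x d = (\<Sum>P\<in>S. x P * polar_image \<delta> P d)"
  unfolding varpi_def by (rule sum.mono_neutral_left) (use assms in auto)

lemma varpi_lin:
  assumes "fmor r s x" "fmor r s y"
  shows "varpi \<delta> (\<lambda>P. c * x P + y P) = (\<lambda>d. c * varpi \<delta> x d + varpi \<delta> y d)"
proof
  fix d
  let ?S = "{P. x P \<noteq> 0} \<union> {P. y P \<noteq> 0}"
  have fin: "finite ?S" using assms by (auto simp: fmor_def)
  have sub: "{P. c * x P + y P \<noteq> 0} \<subseteq> ?S" by auto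
  show "varpi \<delta> (\<lambda>P. c * x P + y P) d = c * varpi \<delta> x d + varpi \<delta> y d"
    unfolding varpi_eq[OF fin sub] varpi_eq[of ?S x, OF fin Un_upper1] varpi_eq[of ?S y, OF fin Un_upper2]
      sum_distrib_left sum.distrib[symmetric]
    by (rule sum.cong) (simp_all add: algebra_simps)
qed

lemma varpi_zero [simp]: "varpi \<delta> (\<lambda>_. 0) = (\<lambda>_. 0)"
  by (simp add: varpi_def)

lemma varpi_sing: "varpi \<delta> (psing P) = polar_image \<delta> P"
proof
  fix d
  have "varpi \<delta> (psing P) d = (\<Sum>Q\<in>{P}. psing P Q * polar_image \<delta> Q d)"
    by (rule varpi_eq) (auto simp: psing_def split: if_splits)
  then show "varpi \<delta> (psing P) d = polar_image \<delta> P d" by (simp add: psing_def)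
qed

lemma varpi_scale: "fmor r s x \<Longrightarrow> varpi \<delta> (\<lambda>P. c * x P) = (\<lambda>d. c * varpi \<delta> x d)"
  using varpi_lin[of r s x "\<lambda>_. 0" \<delta> c] by simp

lemma varpi_pdiff:
  "fmor r s x \<Longrightarrow> fmor r s y \<Longrightarrow> varpi \<delta> (pdiff x y) = (\<lambda>d. varpi \<delta> x d - varpi \<delta> y d)"
  using varpi_lin[of r s y x \<delta> "- 1"] by (simp add: pdiff_def)

lemma varpi_padd:
  "fmor r s x \<Longrightarrow> fmor r s y \<Longrightarrow> varpi \<delta> (padd x y) = (\<lambda>d. varpi \<delta> x d + varpi \<delta> y d)"
  using varpi_lin[of r s x y \<delta> 1] by (simp add: padd_def)

lemma bmor_varpi: "fmor r s x \<Longrightarrow> bmor (Suc r) (Suc s) (varpi \<delta> x)"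
proof (induction x rule: fmor_induct)
  case (sing P)
  then show ?case by (simp add: varpi_sing bmor_polar_image)
qed (simp_all add: varpi_lin bmor_lin)

lemma varpi_pcompose:
  assumes x: "fmor r s x" and y: "fmor s t y"
  shows "varpi \<delta> (pcompose \<delta> y x) = bcomp \<delta> (Suc r) (Suc s) (Suc t) (varpi \<delta> y) (varpi \<delta> x)"
  using x
proof (induction x rule: fmor_induct)
  case (sing P)
  show ?case using y
  proof (induction y rule: fmor_induct)
    case (sing Q)
    note PQ = \<open>is_pdiag r s P\<close> \<open>is_pdiag s t Q\<close>
    show ?case using varpi_scale[OF fmor_sing[OF pdiag_pcomp[OF PQ]]]
      by (simp add: pcompose_sing varpi_sing polar_image_pcomp[OF PQ])
  next
    case (lin c y y')
    note P = fmor_sing[OF \<open>is_pdiag r s P\<close>]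
    show ?case
      using lin varpi_lin[OF lin(1,2)] varpi_lin[OF fmor_pcompose[OF P lin(1)] fmor_pcompose[OF P lin(2)]]
      by (simp add: pcompose_lin_left[OF P lin(1,2)] bcomp_lin)
  qed simp
next
  case (lin c x x')
  then show ?case
    using varpi_lin[OF lin(1,2)] varpi_lin[OF fmor_pcompose[OF lin(1) y] fmor_pcompose[OF lin(2) y]]
    by (simp add: pcompose_lin_right[OF lin(1,2) y] bcomp_lin)
qed simp

lemma varpi_ftens:
  assumes x: "fmor r s x" and g: "bmor k l g"
  shows "varpi \<delta> (ftens k l x g) = btens (Suc r) (Suc s) k l (varpi \<delta> x) g"
  using x
proof (induction x rule: fmor_induct)
  case (sing P)
  note P = fmor_sing[OF \<open>is_pdiag r s P\<close>]
  show ?case using g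
  proof (induction g rule: bmor_induct)
    case (sing B)
    show ?case
      by (simp add: ftens_sing[OF sing] varpi_sing polar_image_ptens[OF \<open>is_pdiag r s P\<close> sing])
  next
    case (lin c g g')
    then show ?case
      using varpi_lin[OF fmor_ftens[OF P lin(1)] fmor_ftens[OF P lin(2)]]
      by (simp add: ftens_lin_right[OF P] btens_lin)
  qed simp
next
  case (lin c x x')
  then show ?case
    using varpi_lin[OF lin(1,2)] varpi_lin[OF fmor_ftens[OF lin(1) g] fmor_ftens[OF lin(2) g]]
    by (simp add: ftens_lin_left[OF lin(1,2)] btens_lin)
qed simp

section \<open>Images of the generators and of the relations\<close>

lemma pdiag_I0: "is_pdiag 0 0 [(0, 0, did 0)]"
  and pdiag_H: "is_pdiag 1 1 [(1, 1, did 1), (1, 1, did 1)]"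
  by (simp_all add: is_pdiag_single is_pdiag_Cons)

lemma fmor_I0: "fmor 0 0 pI0" and fmor_H: "fmor 1 1 pH"
  unfolding pI0_def pH_def by (intro fmor_sing pdiag_I0 pdiag_H)+

lemma varpi_I0: "varpi \<delta> pI0 = bI"
  using btens_bid[of 1 0] by (simp add: pI0_def varpi_sing pole_tens_def bI_def bid_def)

lemma pole_tens_did: "pole_tens n n (did n) = bid (Suc n)"
  using btens_bid[of 1 n] by (simp add: pole_tens_def bI_def bid_def)

lemma varpi_H: "varpi \<delta> pH = bH \<delta>"
proof -
  have "connector \<delta> 1 = bH \<delta>" using btens_bid0[OF bmor_bH] by (simp add: connector_def)
  then show ?thesis
    using bcomp_bid_right[OF bmor_bH, of \<delta> \<delta>] bcomp_bid_left[OF bmor_bH, of \<delta> \<delta>]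
    by (simp add: pH_def varpi_sing numeral_2_eq_2 pole_tens_did[of 1, simplified])
qed

lemma fmor_I0_tens: "bmor k l A \<Longrightarrow> fmor k l (ftens k l pI0 A)"
  using fmor_ftens[OF fmor_I0, of k l A] by simp

lemma varpi_I0_tens: "bmor k l A \<Longrightarrow> varpi \<delta> (ftens k l pI0 A) = btens 1 1 k l bI A"
  using varpi_ftens[OF fmor_I0, of k l A \<delta>] by (simp add: varpi_I0)

lemma fmor_H_tens: "bmor k l A \<Longrightarrow> fmor (1 + k) (1 + l) (ftens k l pH A)"
  using fmor_ftens[OF fmor_H, of k l A] by simp

lemma varpi_H_tens: "bmor k l A \<Longrightarrow> varpi \<delta> (ftens k l pH A) = btens 2 2 k l (bH \<delta>) A"
  using varpi_ftens[OF fmor_H, of k l A \<delta>] by (simp add: varpi_H numeral_2_eq_2)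

lemma bmor_bX: "bmor 2 2 bX" and bmor_bcap: "bmor 2 0 bcap" and bmor_bcup: "bmor 0 2 bcup"
  by (simp_all add: bX_def bcap_def bcup_def bdiag_dX bdiag_dcap bdiag_dcup)

lemma fmor_I1: "fmor 1 1 (ftens 1 1 pI0 bI)"
  by (rule fmor_I0_tens) simp

lemma fmor_four_term:
  "fmor 2 2 pH01" "fmor 2 2 pX0" "fmor 2 2 (pH02 \<delta>)" "fmor 2 2 (pH12 \<delta>)"
proof -
  show 1: "fmor 2 2 pH01"
    using fmor_H_tens[of 1 1 bI] by (simp add: pH01_def numeral_2_eq_2)
  show 2: "fmor 2 2 pX0" unfolding pX0_def by (rule fmor_I0_tens[OF bmor_bX])
  show "fmor 2 2 (pH02 \<delta>)" unfolding pH02_def by (rule fmor_pcompose[OF fmor_pcompose[OF 2 1] 2])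
  show "fmor 2 2 (pH12 \<delta>)" unfolding pH12_def by (rule fmor_I0_tens[OF bmor_bH])
qed

lemma varpi_four_term:
  "varpi \<delta> (pcompose \<delta> pH01 (padd (pH02 \<delta>) (pH12 \<delta>))) = varpi \<delta> (pcompose \<delta> (padd (pH02 \<delta>) (pH12 \<delta>)) pH01)"
proof -
  note f = fmor_four_term
  have 1: "varpi \<delta> pH01 = btens 2 2 1 1 (bH \<delta>) bI"
    unfolding pH01_def by (rule varpi_H_tens) simp
  have 2: "varpi \<delta> pX0 = btens 1 1 2 2 bI bX"
    unfolding pX0_def by (rule varpi_I0_tens[OF bmor_bX])
  have 3: "varpi \<delta> (pH12 \<delta>) = btens 1 1 2 2 bI (bH \<delta>)"
    unfolding pH12_def by (rule varpi_I0_tens[OF bmor_bH])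
  have s: "Suc 2 = 3" by simp
  have 4: "varpi \<delta> (pH02 \<delta>) = bcomp \<delta> 3 3 3 (btens 1 1 2 2 bI bX)
      (bcomp \<delta> 3 3 3 (btens 2 2 1 1 (bH \<delta>) bI) (btens 1 1 2 2 bI bX))"
    unfolding pH02_def varpi_pcompose[OF fmor_pcompose[OF f(2,1)] f(2)] varpi_pcompose[OF f(2,1)] 1 2 s ..
  show ?thesis
    unfolding varpi_pcompose[OF fmor_padd[OF f(3,4)] f(1)] varpi_pcompose[OF f(1) fmor_padd[OF f(3,4)]]
      varpi_padd[OF f(3,4)] 1 3 4 s
    by (rule four_term)
qed

lemma fmor_transp_parts:
  "fmor 1 3 (ftens 1 3 pI0 (btens 0 2 1 1 bcup bI))" "fmor 3 3 (ftens 2 2 pH bX)"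
  "fmor 3 1 (ftens 3 1 pI0 (btens 2 0 1 1 bcap bI))"
proof -
  show "fmor 3 3 (ftens 2 2 pH bX)"
    using fmor_H_tens[OF bmor_bX] by (simp add: numeral_3_eq_3 numeral_2_eq_2)
  show "fmor 1 3 (ftens 1 3 pI0 (btens 0 2 1 1 bcup bI))" "fmor 3 1 (ftens 3 1 pI0 (btens 2 0 1 1 bcap bI))"
    using bmor_btens[of 0 1 2 1 bcup bI] bmor_btens[of 2 1 0 1 bcap bI]
    by (auto intro!: fmor_I0_tens simp: numeral_3_eq_3)
qed

lemma fmor_ptransp: "fmor 1 1 (ptransp \<delta> pH)"
  unfolding ptransp_def
  by (rule fmor_pcompose[OF fmor_pcompose[OF fmor_transp_parts(1,2)] fmor_transp_parts(3)])

lemma varpi_ptransp: "varpi \<delta> (ptransp \<delta> pH) = (\<lambda>d. - bH \<delta> d)"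
proof -
  note f = fmor_transp_parts
  have s: "Suc 1 = 2" "Suc 3 = 4" by simp_all
  have b: "bmor 1 3 (btens 0 2 1 1 bcup bI)" "bmor 3 1 (btens 2 0 1 1 bcap bI)"
    using bmor_btens[of 0 1 2 1 bcup bI] bmor_btens[of 2 1 0 1 bcap bI] by (simp_all add: numeral_3_eq_3)
  show ?thesis
    unfolding ptransp_def varpi_pcompose[OF fmor_pcompose[OF f(1,2)] f(3)] varpi_pcompose[OF f(1,2)]
      varpi_H_tens[OF bmor_bX] varpi_I0_tens[OF b(1)] varpi_I0_tens[OF b(2)] s
    by (rule skew_symmetric)
qed

text \<open>Induction over the generation of the submodule of relations. The claim
  \<open>fmor\<close> is carried along because linearity and functoriality of \<open>varpi\<close>
  are available only for finite combinations of polar diagrams with the right ends.\<close>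

lemma relAB_varpi: "relAB \<delta> r s x \<Longrightarrow> fmor r s x \<and> varpi \<delta> x = (\<lambda>_. 0)"
proof (induction rule: relAB.induct)
  case (rel_i1 k1 k2 A k3 B)
  let ?a = "ftens k1 k2 pI0 A" and ?b = "ftens k2 k3 pI0 B"
  have f: "fmor k1 k2 ?a" "fmor k2 k3 ?b" "fmor k1 k3 (ftens k1 k3 pI0 (bcomp \<delta> k1 k2 k3 B A))"
    using rel_i1 by (auto intro: fmor_I0_tens bmor_bcomp)
  have "bcomp \<delta> (Suc k1) (Suc k2) (Suc k3) (btens 1 1 k2 k3 bI B) (btens 1 1 k1 k2 bI A)
      = btens 1 1 k1 k3 bI (bcomp \<delta> k1 k2 k3 B A)"
    using bcomp_btens[OF bmor_bI(1) bmor_bI(1) rel_i1, of \<delta>] bcomp_bI[of \<delta>] by simp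
  then show ?case
    using rel_i1 by (simp add: fmor_pdiff fmor_pcompose[OF f(1,2)] f(3) varpi_pdiff[OF fmor_pcompose[OF f(1,2)] f(3)]
        varpi_pcompose[OF f(1,2)] varpi_I0_tens bmor_bcomp)
next
  case (rel_i2 k1 k2 A k3 B)
  let ?a = "ftens k1 k2 (ftens 1 1 pI0 bI) A" and ?b = "ftens k2 k3 pH B"
  have f: "fmor (1 + k1) (1 + k2) ?a" "fmor (1 + k2) (1 + k3) ?b"
    "fmor (1 + k1) (1 + k3) (ftens k1 k3 pH (bcomp \<delta> k1 k2 k3 B A))"
    using rel_i2 by (auto intro: fmor_H_tens[simplified] fmor_ftens[OF fmor_I1, simplified] bmor_bcomp)
  have a: "varpi \<delta> ?a = btens 2 2 k1 k2 (bid 2) A"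
    using varpi_ftens[OF fmor_I1 rel_i2(1), of \<delta>] varpi_I0_tens[OF bmor_bI(1), of \<delta>]
    by (simp add: bI_def numeral_2_eq_2 btens_bid[of 1 1, simplified])
  have "bcomp \<delta> (Suc (1 + k1)) (Suc (1 + k2)) (Suc (1 + k3)) (btens 2 2 k2 k3 (bH \<delta>) B) (btens 2 2 k1 k2 (bid 2) A)
      = btens 2 2 k1 k3 (bH \<delta>) (bcomp \<delta> k1 k2 k3 B A)"
    using bcomp_btens[OF bmor_bid bmor_bH rel_i2, of \<delta> \<delta>] bcomp_bid_right[OF bmor_bH, of \<delta> \<delta>] by simp
  then show ?case
    using rel_i2 unfolding varpi_pdiff[OF fmor_pcompose[OF f(1,2)] f(3)] varpi_pcompose[OF f(1,2)] a
    by (simp add: fmor_pdiff[OF fmor_pcompose[OF f(1,2)] f(3), simplified] varpi_H_tens bmor_bcomp)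
next
  case (rel_i3 k1 k2 A k3 B)
  let ?a = "ftens k1 k2 pH A" and ?b = "ftens k2 k3 (ftens 1 1 pI0 bI) B"
  have f: "fmor (1 + k1) (1 + k2) ?a" "fmor (1 + k2) (1 + k3) ?b"
    "fmor (1 + k1) (1 + k3) (ftens k1 k3 pH (bcomp \<delta> k1 k2 k3 B A))"
    using rel_i3 by (auto intro: fmor_H_tens[simplified] fmor_ftens[OF fmor_I1, simplified] bmor_bcomp)
  have b: "varpi \<delta> ?b = btens 2 2 k2 k3 (bid 2) B"
    using varpi_ftens[OF fmor_I1 rel_i3(2), of \<delta>] varpi_I0_tens[OF bmor_bI(1), of \<delta>]
    by (simp add: bI_def numeral_2_eq_2 btens_bid[of 1 1, simplified])
  have "bcomp \<delta> (Suc (1 + k1)) (Suc (1 + k2)) (Suc (1 + k3)) (btens 2 2 k2 k3 (bid 2) B) (btens 2 2 k1 k2 (bH \<delta>) A)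
      = btens 2 2 k1 k3 (bH \<delta>) (bcomp \<delta> k1 k2 k3 B A)"
    using bcomp_btens[OF bmor_bH bmor_bid rel_i3, of \<delta> \<delta>] bcomp_bid_left[OF bmor_bH, of \<delta> \<delta>] by simp
  then show ?case
    using rel_i3 unfolding varpi_pdiff[OF fmor_pcompose[OF f(1,2)] f(3)] varpi_pcompose[OF f(1,2)] b
    by (simp add: fmor_pdiff[OF fmor_pcompose[OF f(1,2)] f(3), simplified] varpi_H_tens bmor_bcomp)
next
  case rel_4T
  note f = fmor_padd[OF fmor_four_term(3,4)]
  show ?case
    unfolding varpi_pdiff[OF fmor_pcompose[OF f fmor_four_term(1)] fmor_pcompose[OF fmor_four_term(1) f]]
    using fmor_pdiff[OF fmor_pcompose[OF f fmor_four_term(1)] fmor_pcompose[OF fmor_four_term(1) f]]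
    by (simp add: varpi_four_term)
next
  case rel_skew
  then show ?case
    unfolding varpi_padd[OF fmor_ptransp fmor_H] varpi_ptransp varpi_H
    by (intro conjI fmor_padd[OF fmor_ptransp fmor_H]) simp
next
  case (rel_tens r s x k l B)
  then show ?case using varpi_ftens[of r s x k l B \<delta>] by (simp add: fmor_ftens)
next
  case (rel_compL r s x t y)
  then show ?case using varpi_pcompose[of r s x t y \<delta>] fmor_pcompose[of r s x t y \<delta>] by simp
next
  case (rel_compR r s x q y)
  then show ?case using varpi_pcompose[of q r y s x \<delta>] fmor_pcompose[of q r y s x \<delta>] by simp
next
  case (rel_add r s x y)
  then show ?case using varpi_padd[of r s x y \<delta>] by (simp add: fmor_padd)
next
  case (rel_smult r s x c)
  then show ?case using varpi_scale[of r s x \<delta> c] by (simp add: fmor_scale)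
qed simp

section \<open>The right action of the Brauer category\<close>

lemma abeq_refl: "abeq \<delta> r s x x"
  by (simp add: abeq_def pdiff_def rel_zero)

lemma abeq_lin:
  assumes "abeq \<delta> r s x x'" "abeq \<delta> r s y y'"
  shows "abeq \<delta> r s (\<lambda>P. c * x P + y P) (\<lambda>P. c * x' P + y' P)"
proof -
  have "relAB \<delta> r s (padd (\<lambda>P. c * pdiff x x' P) (pdiff y y'))"
    using assms unfolding abeq_def by (intro rel_add rel_smult)
  moreover have "padd (\<lambda>P. c * pdiff x x' P) (pdiff y y') = pdiff (\<lambda>P. c * x P + y P) (\<lambda>P. c * x' P + y' P)"
    by (simp add: padd_def pdiff_def fun_eq_iff algebra_simps)
  ultimately show ?thesis by (simp add: abeq_def)
qed

lemma abeq_trans: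
  assumes "abeq \<delta> r s x y" "abeq \<delta> r s y z"
  shows "abeq \<delta> r s x z"
proof -
  have "padd (pdiff x y) (pdiff y z) = pdiff x z" by (simp add: padd_def pdiff_def fun_eq_iff)
  then show ?thesis using rel_add[OF assms[unfolded abeq_def]] by (simp add: abeq_def)
qed

lemma pcompose_pdiff_right:
  "fmor r s x \<Longrightarrow> fmor r s x' \<Longrightarrow> fmor s t y \<Longrightarrow>
    pcompose \<delta> y (pdiff x x') = pdiff (pcompose \<delta> y x) (pcompose \<delta> y x')"
  using pcompose_lin_right[of r s x' x t y \<delta> "- 1"] by (simp add: pdiff_def)

lemma pcompose_pdiff_left:
  "fmor r s x \<Longrightarrow> fmor s t y \<Longrightarrow> fmor s t y' \<Longrightarrow>
    pcompose \<delta> (pdiff y y') x = pdiff (pcompose \<delta> y x) (pcompose \<delta> y' x)"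
  using pcompose_lin_left[of r s x t y' y \<delta> "- 1"] by (simp add: pdiff_def)

lemma abeq_compL:
  assumes "abeq \<delta> r s x x'" "fmor r s x" "fmor r s x'" "fmor s t y"
  shows "abeq \<delta> r t (pcompose \<delta> y x) (pcompose \<delta> y x')"
  using rel_compL[OF assms(1)[unfolded abeq_def] assms(4)] pcompose_pdiff_right[OF assms(2-4), of \<delta>]
  by (simp add: abeq_def)

lemma abeq_compR:
  assumes "abeq \<delta> s t y y'" "fmor r s x" "fmor s t y" "fmor s t y'"
  shows "abeq \<delta> r t (pcompose \<delta> y x) (pcompose \<delta> y' x)"
  using rel_compR[OF assms(1)[unfolded abeq_def] assms(2)] pcompose_pdiff_left[OF assms(2-4), of \<delta>]
  by (simp add: abeq_def)

lemma ftens_pdiff: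
  "fmor r s x \<Longrightarrow> fmor r s y \<Longrightarrow> ftens k l (pdiff x y) B = pdiff (ftens k l x B) (ftens k l y B)"
  using ftens_lin_left[of r s y x k l "- 1" B] by (simp add: pdiff_def)

section \<open>Moving Brauer diagrams past connectors\<close>

lemma pcompose_assoc_sing:
  assumes P: "is_pdiag r s P" and Q: "is_pdiag s t Q" and R: "is_pdiag t u R"
  shows "pcompose \<delta> (psing R) (pcompose \<delta> (psing Q) (psing P))
    = pcompose \<delta> (pcompose \<delta> (psing R) (psing Q)) (psing P)"
  using pcomp_assoc[OF P Q R] pcompose_scale_right[OF fmor_sing[OF pdiag_pcomp[OF P Q]] fmor_sing[OF R], of \<delta>]
    pcompose_scale_left[OF fmor_sing[OF P] fmor_sing[OF pdiag_pcomp[OF Q R]], of \<delta>]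
  by (simp add: pcompose_sing mult.assoc[symmetric] power_add[symmetric])

lemma pcompose_sing0: "ploops Q P = 0 \<Longrightarrow> pcompose \<delta> (psing Q) (psing P) = psing (pcomp Q P)"
  by (simp add: pcompose_sing)

text \<open>This is \<open>(I_1 \<otimes> C)(H \<otimes> I) = H \<otimes> C\<close> from relation
  (i): on the left \<open>C\<close> lies above the connector, and on the right the convention of
  \<open>ptens\<close> puts it below.\<close>

lemma slide_connector:
  assumes s: "1 \<le> s" and B: "is_bdiag l m B"
  shows "abeq \<delta> (s + l) (s + m) (psing [(s + l, s + l, did (s + l)), (s + l, s + m, dtens s s l m (did s) B)])
    (psing [(s + l, s + m, dtens s s l m (did s) B), (s + m, s + m, did (s + m))])"
proof -
  obtain v where v: "s = 1 + v" using s by (metis le_add_diff_inverse)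
  \<comment> \<open>\<open>pH\<close> has a single thin strand, so the other \<open>v\<close> of the
    \<open>s\<close> strands are counted to the Brauer factor.\<close>
  define C where "C = dtens v v l m (did v) B"
  have C: "is_bdiag (v + l) (v + m) C" unfolding C_def by (rule bdiag_dtens[OF bdiag_did B])
  have IC: "dtens 1 1 (v + l) (v + m) (did 1) C = dtens s s l m (did s) B"
    using dtens_assoc[OF bdiag_did bdiag_did B, of 1 v] dtens_did[of 1 v] by (simp add: C_def v)
  have B': "is_bdiag (s + l) (s + m) (dtens s s l m (did s) B)" by (rule bdiag_dtens[OF bdiag_did B])
  have II: "dtens 1 1 (v + n) (v + n) (did 1) (did (v + n)) = did (s + n)" for n
    using dtens_did[of 1 "v + n"] by (simp add: v)
  have I1: "ftens 1 1 pI0 bI = psing [(1, 1, did 1)]"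
    using ftens_sing[of 1 1 "did 1" "[(0, 0, did 0)]"] dtens_0_left[of 1 1 "did 1"]
    by (simp add: pI0_def bI_def bid_def)
  have 1: "ftens (v + l) (v + m) (ftens 1 1 pI0 bI) (bsing C) = psing [(s + l, s + m, dtens s s l m (did s) B)]"
    using ftens_sing[OF C, of "[(1, 1, did 1)]"] IC unfolding I1 by (simp add: v)
  have 2: "ftens (v + l) (v + l) pH (bid (v + l)) = psing [(s + l, s + l, did (s + l)), (s + l, s + l, did (s + l))]"
    using ftens_sing[OF bdiag_did, of "v + l" "[(1, 1, did 1), (1, 1, did 1)]"] II[of l]
    unfolding pH_def bid_def by (simp add: v)
  have 3: "ftens (v + l) (v + m) pH (bsing C)
      = psing [(s + l, s + m, dtens s s l m (did s) B), (s + m, s + m, did (s + m))]"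
    using ftens_sing[OF C, of "[(1, 1, did 1), (1, 1, did 1)]"] II[of m] IC
    unfolding pH_def by (simp add: v)
  have 4: "pcompose \<delta> (psing [(s + l, s + m, dtens s s l m (did s) B)])
      (psing [(s + l, s + l, did (s + l)), (s + l, s + l, did (s + l))])
    = psing [(s + l, s + l, did (s + l)), (s + l, s + m, dtens s s l m (did s) B)]"
    using dcomp_did_right[OF B'] by (subst pcompose_sing0) simp_all
  show ?thesis
    using rel_i3[OF bmor_bid bmor_sing[OF C], of \<delta>]
    unfolding bcomp_bid_right[OF bmor_sing[OF C]] 1 2 3 4 abeq_def by (simp add: v)
qed

text \<open>The same move inside a larger diagram. The picture is cut into the part above, a piece
  with one connector, and the level below; after the move \<open>B'\<close> meets \<open>B\<close>
  in that level, which may close loops.\<close>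

lemma slide_context:
  assumes D: "is_bdiag r s D" and s: "1 \<le> s" and B: "is_bdiag k l B" and B': "is_bdiag l m B'"
    and P: "is_pdiag s t P"
  shows "abeq \<delta> (r + k) (t + m) (psing ((r + k, s + l, dtens r s k l D B) # ptens l m B' P))
    (\<lambda>R. \<delta> ^ loops k l m B' B *
      psing ((r + k, s + m, dtens r s k m D (dcomp k l m B' B)) # ptens m m (did m) P) R)"
proof -
  let ?F = "dtens s s l m (did s) B'"
  let ?X = "[(r + k, s + l, dtens r s k l D B)]"
  let ?L = "[(s + l, s + l, did (s + l)), (s + l, s + m, ?F)]"
  let ?R = "[(s + l, s + m, ?F), (s + m, s + m, did (s + m))]"
  let ?P = "ptens m m (did m) P"
  have F: "is_bdiag (s + l) (s + m) ?F" by (rule bdiag_dtens[OF bdiag_did B'])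
  have DB: "is_bdiag (r + k) (s + l) (dtens r s k l D B)" by (rule bdiag_dtens[OF D B])
  have X: "is_pdiag (r + k) (s + l) ?X" by (simp add: is_pdiag_single DB)
  have L: "is_pdiag (s + l) (s + m) ?L" and R: "is_pdiag (s + l) (s + m) ?R"
    using F s by (simp_all add: is_pdiag_single is_pdiag_Cons)
  have P': "is_pdiag (s + m) (t + m) ?P" by (rule pdiag_ptens[OF P bdiag_did])
  have FD: "dcomp (r + k) (s + l) (s + m) ?F (dtens r s k l D B) = dtens r s k m D (dcomp k l m B' B) \<and>
      loops (r + k) (s + l) (s + m) ?F (dtens r s k l D B) = loops k l m B' B"
    using dcomp_dtens[OF D bdiag_did B B'] dcomp_did_left[OF D] by simp
  have XL: "is_pdiag (r + k) (s + m) (?X @ [(s + l, s + m, ?F)])"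
    using DB F s by (simp add: is_pdiag_single is_pdiag_Cons)
  have XR: "is_pdiag (r + k) (s + m) [(r + k, s + m, dtens r s k m D (dcomp k l m B' B)), (s + m, s + m, did (s + m))]"
    using s bdiag_dtens[OF D bdiag_dcomp[OF B B']] by (simp add: is_pdiag_single is_pdiag_Cons)
  have lhs: "pcompose \<delta> (psing ?P) (pcompose \<delta> (psing ?L) (psing ?X)) = psing (?X @ ptens l m B' P)"
  proof -
    have "pcompose \<delta> (psing ?L) (psing ?X) = psing (?X @ [(s + l, s + m, ?F)])"
      using dcomp_did_left[OF DB] by (subst pcompose_sing0) simp_all
    then show ?thesis using pcomp_whisker[OF P B'] by (simp add: pcompose_sing0)
  qed
  have rhs: "pcompose \<delta> (psing ?P) (pcompose \<delta> (psing ?R) (psing ?X)) = (\<lambda>Q. \<delta> ^ loops k l m B' B *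
      psing ((r + k, s + m, dtens r s k m D (dcomp k l m B' B)) # ?P) Q)"
  proof -
    have "pcompose \<delta> (psing ?R) (psing ?X) = (\<lambda>Q. \<delta> ^ loops k l m B' B *
        psing [(r + k, s + m, dtens r s k m D (dcomp k l m B' B)), (s + m, s + m, did (s + m))] Q)"
      using FD by (simp add: pcompose_sing)
    moreover have "pcompose \<delta> (psing ?P)
        (psing [(r + k, s + m, dtens r s k m D (dcomp k l m B' B)), (s + m, s + m, did (s + m))])
      = psing ((r + k, s + m, dtens r s k m D (dcomp k l m B' B)) # ?P)"
      using pcomp_did_right[OF P' bdiag_did] by (subst pcompose_sing0) simp_all
    ultimately show ?thesis
      using pcompose_scale_right[OF fmor_sing[OF XR] fmor_sing[OF P'], of \<delta>] by simp
  qed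
  have "abeq \<delta> (r + k) (s + m) (pcompose \<delta> (psing ?L) (psing ?X)) (pcompose \<delta> (psing ?R) (psing ?X))"
    by (rule abeq_compR[OF slide_connector[OF s B'] fmor_sing[OF X] fmor_sing[OF L] fmor_sing[OF R]])
  then have "abeq \<delta> (r + k) (t + m) (pcompose \<delta> (psing ?P) (pcompose \<delta> (psing ?L) (psing ?X)))
      (pcompose \<delta> (psing ?P) (pcompose \<delta> (psing ?R) (psing ?X)))"
    by (rule abeq_compL) (intro fmor_pcompose[OF fmor_sing[OF X]] fmor_sing L R P')+
  then show ?thesis unfolding lhs rhs by simp
qed

text \<open>A Brauer diagram on top of the added strands can be moved down through all connectors,
one at a time, by relation (i).\<close>
lemma slide:
  assumes "is_pdiag r s P" "is_bdiag k l B" and B': "is_bdiag l m B'"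
  shows "abeq \<delta> (r + k) (s + m)
    (pcompose \<delta> (psing [(s + l, s + m, dtens s s l m (did s) B')]) (psing (ptens k l B P)))
    (\<lambda>R. \<delta> ^ loops k l m B' B * psing (ptens k m (dcomp k l m B' B) P) R)"
  using assms(1,2)
proof (induction arbitrary: k B rule: pdiag_induct)
  case (single r D)
  have "pcompose \<delta> (psing [(s + l, s + m, dtens s s l m (did s) B')]) (psing (ptens k l B [(r, s, D)]))
    = (\<lambda>R. \<delta> ^ loops k l m B' B * psing (ptens k m (dcomp k l m B' B) [(r, s, D)]) R)"
    using dcomp_dtens[OF single(1) bdiag_did single(2) B'] dcomp_did_left[OF single(1)]
    by (simp add: pcompose_sing)
  then show ?case by (simp add: abeq_refl)
next
  case (Cons r u D P)
  note D = Cons(1) and u = Cons(2) and P = Cons(3) and ne = Cons(4) and B = Cons.prems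
  let ?W = "[(s + l, s + m, dtens s s l m (did s) B')]"
  let ?Y = "ptens l l (did l) P"
  let ?X = "(r + k, u + l, dtens r u k l D B)"
  \<comment> \<open>The identity level on top makes \<open>?Z\<close> stand for the level
    \<open>?X\<close> together with the connector above it: stacking \<open>Q\<close> on
    \<open>?Z\<close> gives \<open>?X # Q\<close>.\<close>
  let ?Z = "[?X, (u + l, u + l, did (u + l))]"
  have W: "is_pdiag (s + l) (s + m) ?W" by (simp add: is_pdiag_single bdiag_dtens B')
  have Y: "is_pdiag (u + l) (s + l) ?Y" by (rule pdiag_ptens[OF P bdiag_did])
  have Z: "is_pdiag (r + k) (u + l) ?Z"
    using u by (simp add: is_pdiag_single is_pdiag_Cons bdiag_dtens[OF D B])
  have pre: "pcompose \<delta> (psing Q) (psing ?Z) = psing (?X # Q)" if "is_pdiag (u + l) n Q" for n Q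
    using pcomp_did_right[OF that bdiag_did] by (subst pcompose_sing0) simp_all
  have "pcompose \<delta> (psing ?W) (psing (ptens k l B ((r, u, D) # P)))
      = pcompose \<delta> (pcompose \<delta> (psing ?W) (psing ?Y)) (psing ?Z)"
    unfolding pcompose_assoc_sing[OF Z Y W, symmetric] pre[OF Y] by simp
  \<comment> \<open>Above the lowest level the added strands carry identities, so the induction
    hypothesis is taken with the identity in place of \<open>B\<close>. The lowest connector is left
    to \<open>slide_context\<close>.\<close>
  moreover have "abeq \<delta> (u + l) (s + m) (pcompose \<delta> (psing ?W) (psing ?Y)) (psing (ptens l m B' P))"
    using Cons.IH[OF bdiag_did] dcomp_did_right[OF B'] by simp
  then have "abeq \<delta> (r + k) (s + m) (pcompose \<delta> (pcompose \<delta> (psing ?W) (psing ?Y)) (psing ?Z))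
      (pcompose \<delta> (psing (ptens l m B' P)) (psing ?Z))"
    by (rule abeq_compR) (intro fmor_sing Z fmor_pcompose[OF fmor_sing[OF Y]] W pdiag_ptens[OF P B'])+
  ultimately have "abeq \<delta> (r + k) (s + m) (pcompose \<delta> (psing ?W) (psing (ptens k l B ((r, u, D) # P))))
      (psing (?X # ptens l m B' P))"
    using pre[OF pdiag_ptens[OF P B']] by simp
  then show ?case
    using abeq_trans slide_context[OF D u B B' P] by fastforce
qed

text \<open>\<open>Q \<otimes> B'\<close> is split into \<open>Q \<otimes> I\<close> on top of
  \<open>I \<otimes> B'\<close>. The lower factor slides down through \<open>P\<close> to meet
  \<open>B\<close>; putting \<open>Q \<otimes> I\<close> back on top is strict by
  \<open>pcomp_ptens\<close>.\<close>

lemma interchange_sing: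
  assumes P: "is_pdiag r s P" and Q: "is_pdiag s t Q" and B: "is_bdiag k l B" and B': "is_bdiag l m B'"
  shows "abeq \<delta> (r + k) (t + m) (pcompose \<delta> (ftens l m (psing Q) (bsing B')) (ftens k l (psing P) (bsing B)))
     (ftens k m (pcompose \<delta> (psing Q) (psing P)) (bcomp \<delta> k l m (bsing B') (bsing B)))"
proof -
  let ?W = "[(s + l, s + m, dtens s s l m (did s) B')]"
  let ?Q = "ptens m m (did m) Q" and ?C = "dcomp k l m B' B"
  note C = bdiag_dcomp[OF B B']
  have W: "is_pdiag (s + l) (s + m) ?W" by (simp add: is_pdiag_single bdiag_dtens B')
  have PB: "is_pdiag (r + k) (s + l) (ptens k l B P)" by (rule pdiag_ptens[OF P B])
  have PC: "is_pdiag (r + k) (s + m) (ptens k m ?C P)" by (rule pdiag_ptens[OF P C])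
  have Qm: "is_pdiag (s + m) (t + m) ?Q" by (rule pdiag_ptens[OF Q bdiag_did])
  have "pcompose \<delta> (ftens l m (psing Q) (bsing B')) (ftens k l (psing P) (bsing B))
      = pcompose \<delta> (pcompose \<delta> (psing ?Q) (psing ?W)) (psing (ptens k l B P))"
    using pcomp_whisker[OF Q B'] by (simp add: ftens_sing B B' pcompose_sing0)
  also have "\<dots> = pcompose \<delta> (psing ?Q) (pcompose \<delta> (psing ?W) (psing (ptens k l B P)))"
    by (rule pcompose_assoc_sing[OF PB W Qm, symmetric])
  finally have 1: "pcompose \<delta> (ftens l m (psing Q) (bsing B')) (ftens k l (psing P) (bsing B))
      = pcompose \<delta> (psing ?Q) (pcompose \<delta> (psing ?W) (psing (ptens k l B P)))" .
  have "pcompose \<delta> (psing ?Q) (\<lambda>R. \<delta> ^ loops k l m B' B * psing (ptens k m ?C P) R)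
      = (\<lambda>R. \<delta> ^ loops k l m B' B * (\<delta> ^ ploops Q P * psing (ptens k m ?C (pcomp Q P)) R))"
    using pcomp_ptens[OF P Q C] pcompose_scale_right[OF fmor_sing[OF PC] fmor_sing[OF Qm], of \<delta>]
    by (simp add: pcompose_sing)
  also have "\<dots> = ftens k m (pcompose \<delta> (psing Q) (psing P)) (bcomp \<delta> k l m (bsing B') (bsing B))"
    using ftens_scale_left[OF fmor_sing[OF pdiag_pcomp[OF P Q]], of k m "\<delta> ^ ploops Q P"]
      ftens_scale_right[OF fmor_scale[OF fmor_sing[OF pdiag_pcomp[OF P Q]]], of k m "\<delta> ^ ploops Q P"]
    by (simp add: bcomp_sing[OF B B'] pcompose_sing ftens_sing[OF C])
  finally have 2: "pcompose \<delta> (psing ?Q) (\<lambda>R. \<delta> ^ loops k l m B' B * psing (ptens k m ?C P) R)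
      = ftens k m (pcompose \<delta> (psing Q) (psing P)) (bcomp \<delta> k l m (bsing B') (bsing B))" .
  show ?thesis
    unfolding 1 2[symmetric]
    by (rule abeq_compL[OF slide[OF P B B']])
      (intro fmor_pcompose[OF fmor_sing[OF PB]] fmor_sing fmor_scale W PC Qm)+
qed

lemma interchange:
  assumes x: "fmor r s x" and y: "fmor s t y" and f: "bmor k l f" and g: "bmor l m g"
  shows "abeq \<delta> (r + k) (t + m) (pcompose \<delta> (ftens l m y g) (ftens k l x f))
     (ftens k m (pcompose \<delta> y x) (bcomp \<delta> k l m g f))"
  using x
proof (induction x rule: fmor_induct)
  case (sing P)
  note P = fmor_sing[OF \<open>is_pdiag r s P\<close>]
  show ?case using y
  proof (induction y rule: fmor_induct)
    case (sing Q)
    note Q = fmor_sing[OF \<open>is_pdiag s t Q\<close>] and PQ = fmor_pcompose[OF P fmor_sing[OF \<open>is_pdiag s t Q\<close>]]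
    show ?case using f
    proof (induction f rule: bmor_induct)
      case (sing B)
      note PB = fmor_ftens[OF P bmor_sing[OF sing]]
      show ?case using g
      proof (induction g rule: bmor_induct)
        case (sing B')
        then show ?case by (rule interchange_sing[OF \<open>is_pdiag r s P\<close> \<open>is_pdiag s t Q\<close> \<open>is_bdiag k l B\<close>])
      next
        case (lin c g g')
        then show ?case
          using pcompose_lin_left[OF PB fmor_ftens[OF Q lin(1)] fmor_ftens[OF Q lin(2)]]
          by (simp add: ftens_lin_right[OF Q] ftens_lin_right[OF PQ] bcomp_lin abeq_lin)
      qed (simp add: abeq_refl)
    next
      case (lin c f f')
      then show ?case
        using pcompose_lin_right[OF fmor_ftens[OF P lin(1)] fmor_ftens[OF P lin(2)] fmor_ftens[OF Q g]]
        by (simp add: ftens_lin_right[OF P] ftens_lin_right[OF PQ] bcomp_lin abeq_lin)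
    qed (simp add: abeq_refl)
  next
    case (lin c y y')
    then show ?case
      using pcompose_lin_left[OF fmor_ftens[OF P f] fmor_ftens[OF lin(1) g] fmor_ftens[OF lin(2) g]]
        ftens_lin_left[OF fmor_pcompose[OF P lin(1)] fmor_pcompose[OF P lin(2)]]
      by (simp add: ftens_lin_left[OF lin(1,2)] pcompose_lin_left[OF P lin(1,2)] abeq_lin)
  qed (simp add: abeq_refl)
next
  case (lin c x x')
  then show ?case
    using pcompose_lin_right[OF fmor_ftens[OF lin(1) f] fmor_ftens[OF lin(2) f] fmor_ftens[OF y g]]
      ftens_lin_left[OF fmor_pcompose[OF lin(1) y] fmor_pcompose[OF lin(2) y]]
    by (simp add: ftens_lin_left[OF lin(1,2)] pcompose_lin_right[OF lin(1,2) y] abeq_lin)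
qed (simp add: abeq_refl)

section \<open>Unit and associativity laws of the action\<close>

lemma pid_eq: "pid r = psing [(r, r, did r)]"
  using ftens_sing[OF bdiag_did, of r "[(0, 0, did 0)]"] dtens_0_left[of r r "did r"]
  by (simp add: pid_def pI0_def bid_def)

lemma ftens_pid: "ftens k k (pid r) (bid k) = pid (r + k)"
  by (simp add: pid_eq bid_def ftens_sing dtens_did)

lemma ftens_assoc:
  assumes x: "fmor r s x" and f: "bmor k l f" and g: "bmor m n g"
  shows "ftens m n (ftens k l x f) g = ftens (k + m) (l + n) x (btens k l m n f g)"
  using x
proof (induction x rule: fmor_induct)
  case (sing P)
  note P = fmor_sing[OF \<open>is_pdiag r s P\<close>]
  show ?case using f
  proof (induction f rule: bmor_induct)
    case (sing B)
    note B = \<open>is_bdiag k l B\<close>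
    note PB = fmor_ftens[OF P bmor_sing[OF B]]
    show ?case using g
    proof (induction g rule: bmor_induct)
      case (sing C)
      show ?case
        using ptens_assoc[OF \<open>is_pdiag r s P\<close> B sing] bdiag_dtens[OF B sing]
        by (simp add: ftens_sing B sing btens_sing)
    next
      case (lin c g g')
      then show ?case by (simp add: ftens_lin_right[OF PB] ftens_lin_right[OF P] btens_lin)
    qed simp
  next
    case (lin c f f')
    then show ?case
      using ftens_lin_left[OF fmor_ftens[OF P lin(1)] fmor_ftens[OF P lin(2)]]
      by (simp add: ftens_lin_right[OF P] btens_lin)
  qed simp
next
  case (lin c x x')
  then show ?case
    using ftens_lin_left[OF fmor_ftens[OF lin(1) f] fmor_ftens[OF lin(2) f]]
    by (simp add: ftens_lin_left[OF lin(1,2)])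
qed simp

lemma ftens_bid0: "fmor r s x \<Longrightarrow> ftens 0 0 x (bid 0) = x"
proof (induction x rule: fmor_induct)
  case (sing P)
  then show ?case by (simp add: bid_def ftens_sing ptens_0)
next
  case (lin c x y)
  then show ?case by (simp add: ftens_lin_left[OF lin(1,2)])
qed simp

lemma I0_tens_inj:
  assumes A: "bmor r s A" and 0: "abeq \<delta> r s (ftens r s pI0 A) (\<lambda>_. 0)"
  shows "A = (\<lambda>_. 0)"
proof -
  have "pdiff (ftens r s pI0 A) (\<lambda>_. 0) = ftens r s pI0 A" by (simp add: pdiff_def)
  then have "varpi \<delta> (ftens r s pI0 A) = (\<lambda>_. 0)" using 0 relAB_varpi unfolding abeq_def by metis
  then show ?thesis
    using btens_bid_cancel[OF A, of 1] by (simp only: varpi_I0_tens[OF A] bI_def)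
qed

lemma abeq_ftens:
  assumes "fmor r s x" "fmor r s y" "abeq \<delta> r s x y" "bmor k l B"
  shows "abeq \<delta> (r + k) (s + l) (ftens k l x B) (ftens k l y B)"
  using rel_tens[OF assms(3)[unfolded abeq_def] assms(4)] ftens_pdiff[OF assms(1,2)] by (simp add: abeq_def)

lemma varpi_pid: "varpi \<delta> (pid r) = bid (Suc r)"
  by (simp add: pid_eq varpi_sing pole_tens_did)

lemma abeq_eq: "x = y \<Longrightarrow> abeq \<delta> r s x y"
  by (simp add: abeq_refl)

theorem theorem2p13:
  fixes \<delta> :: "'k::comm_ring_1"
  shows
  \<comment> \<open>(1) A \<mapsto> I_0 \<otimes> A: K-linear, compatible with composition and identities, injective,
     so the span of the I_0 \<otimes> A is a subcategory AB_0 isomorphic to B(delta)\<close>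
  "(\<forall>r s (A :: bdiag \<Rightarrow> 'k). bmor r s A \<longrightarrow> fmor r s (ftens r s pI0 A))
 \<and> (\<forall>r s (A :: bdiag \<Rightarrow> 'k) B c. bmor r s A \<longrightarrow> bmor r s B \<longrightarrow>
      abeq \<delta> r s (ftens r s pI0 (\<lambda>d. c * A d + B d)) (\<lambda>P. c * ftens r s pI0 A P + ftens r s pI0 B P))
 \<and> (\<forall>r s t (A :: bdiag \<Rightarrow> 'k) B. bmor r s A \<longrightarrow> bmor s t B \<longrightarrow>
      abeq \<delta> r t (pcompose \<delta> (ftens s t pI0 B) (ftens r s pI0 A)) (ftens r t pI0 (bcomp \<delta> r s t B A)))
 \<and> (\<forall>r s (A :: bdiag \<Rightarrow> 'k). bmor r s A \<longrightarrow> abeq \<delta> r s (ftens r s pI0 A) (\<lambda>_. 0) \<longrightarrow> A = (\<lambda>_. 0))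
  \<comment> \<open>(2) right action \<otimes> : AB(delta) \<times> B(delta) \<rightarrow> AB(delta) is a well-defined bifunctor making
     AB(delta) a right module category over B(delta)\<close>
 \<and> (\<forall>r s k l (x :: pdiag \<Rightarrow> 'k) B. fmor r s x \<longrightarrow> bmor k l B \<longrightarrow> fmor (r + k) (s + l) (ftens k l x B))
 \<and> (\<forall>r s k l (x :: pdiag \<Rightarrow> 'k) y B. fmor r s x \<longrightarrow> fmor r s y \<longrightarrow> abeq \<delta> r s x y \<longrightarrow> bmor k l B \<longrightarrow>
      abeq \<delta> (r + k) (s + l) (ftens k l x B) (ftens k l y B))
 \<and> (\<forall>r s k l (x :: pdiag \<Rightarrow> 'k) y B c. fmor r s x \<longrightarrow> fmor r s y \<longrightarrow> bmor k l B \<longrightarrow>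
      abeq \<delta> (r + k) (s + l) (ftens k l (\<lambda>P. c * x P + y P) B) (\<lambda>P. c * ftens k l x B P + ftens k l y B P))
 \<and> (\<forall>r s k l (x :: pdiag \<Rightarrow> 'k) B C c. fmor r s x \<longrightarrow> bmor k l B \<longrightarrow> bmor k l C \<longrightarrow>
      abeq \<delta> (r + k) (s + l) (ftens k l x (\<lambda>d. c * B d + C d)) (\<lambda>P. c * ftens k l x B P + ftens k l x C P))
 \<and> (\<forall>r s t k l m (x :: pdiag \<Rightarrow> 'k) x' B B'. fmor r s x \<longrightarrow> fmor s t x' \<longrightarrow> bmor k l B \<longrightarrow> bmor l m B' \<longrightarrow>
      abeq \<delta> (r + k) (t + m) (pcompose \<delta> (ftens l m x' B') (ftens k l x B))
                            (ftens k m (pcompose \<delta> x' x) (bcomp \<delta> k l m B' B)))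
 \<and> (\<forall>r k. abeq \<delta> (r + k) (r + k) (ftens k k (pid r :: pdiag \<Rightarrow> 'k) (bid k)) (pid (r + k)))
 \<and> (\<forall>r s k l k' l' (x :: pdiag \<Rightarrow> 'k) B C. fmor r s x \<longrightarrow> bmor k l B \<longrightarrow> bmor k' l' C \<longrightarrow>
      abeq \<delta> (r + k + k') (s + l + l') (ftens k' l' (ftens k l x B) C) (ftens (k + k') (l + l') x (btens k l k' l' B C)))
 \<and> (\<forall>r s (x :: pdiag \<Rightarrow> 'k). fmor r s x \<longrightarrow> abeq \<delta> r s (ftens 0 0 x (bid 0)) x)
  \<comment> \<open>(3) the functor varpi : AB(delta) \<rightarrow> B(delta), r \<mapsto> r + 1\<close>
 \<and> (\<exists>\<pi> :: (pdiag \<Rightarrow> 'k) \<Rightarrow> (bdiag \<Rightarrow> 'k).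
      (\<forall>r s x. fmor r s x \<longrightarrow> bmor (r + 1) (s + 1) (\<pi> x))
    \<and> (\<forall>r s x y c. fmor r s x \<longrightarrow> fmor r s y \<longrightarrow> \<pi> (\<lambda>P. c * x P + y P) = (\<lambda>d. c * \<pi> x d + \<pi> y d))
    \<and> (\<forall>r s x. fmor r s x \<longrightarrow> relAB \<delta> r s x \<longrightarrow> \<pi> x = (\<lambda>_. 0))
    \<and> (\<forall>r s t x y. fmor r s x \<longrightarrow> fmor s t y \<longrightarrow>
         \<pi> (pcompose \<delta> y x) = bcomp \<delta> (r + 1) (s + 1) (t + 1) (\<pi> y) (\<pi> x))
    \<and> (\<forall>r. \<pi> (pid r) = bid (r + 1))
    \<and> \<pi> pI0 = bI
    \<and> \<pi> pH = bH \<delta>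
    \<and> (\<forall>r s k l x B. fmor r s x \<longrightarrow> bmor k l B \<longrightarrow>
         \<pi> (ftens k l x B) = btens (r + 1) (s + 1) k l (\<pi> x) B))"
  \<comment> \<open>In (1) and (2), the laws obtained from \<open>abeq_eq\<close> or
    \<open>abeq_refl\<close> hold already for formal combinations. The relations enter in the two
    clauses on stacking, in the well-definedness of the action and, through \<open>varpi\<close>, in
    the injectivity.\<close>
  apply (intro conjI exI[of _ "varpi \<delta>"] allI impI)
                      apply (erule fmor_I0_tens)
                     apply (rule abeq_eq, rule ftens_lin_right[OF fmor_I0])
                    apply (unfold abeq_def, erule (1) rel_i1, fold abeq_def)
                   apply (erule (1) I0_tens_inj)
                  apply (erule (1) fmor_ftens)
                 apply (erule (3) abeq_ftens)
                apply (rule abeq_eq, erule (1) ftens_lin_left)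
               apply (rule abeq_eq, erule ftens_lin_right)
              apply (erule (3) interchange)
             apply (rule abeq_eq, rule ftens_pid)
            apply (simp add: ftens_assoc abeq_refl)
           apply (simp add: ftens_bid0 abeq_refl)
          apply (simp add: bmor_varpi)
         apply (erule (1) varpi_lin)
        apply (simp add: relAB_varpi)
       apply (simp add: varpi_pcompose)
      apply (simp add: varpi_pid)
     apply (rule varpi_I0)
    apply (rule varpi_H)
   apply (simp add: varpi_ftens)
  done

end
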